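(* Assume condition (c-e). Let $f:V\setminus\{0\}\to\mathbb C$ be a compactly supported Lipschitz function with $\mathrm{Re}f\ge0$. Then, with $N^s_n(f)=\sum_{i=1}^nf(u_n^{-1}X_i)$, $$-\log\lim_{n\to\infty}\mathbb E_\rho\exp(-N^s_n(f))=\mathbb E_{\Lambda_0}\big[(\exp f(v)-1)\exp(-\pi_v^\omega(f))\big].$$
   Context: Let $d\ge1$, $V=\mathbb R^d$ with Euclidean norm $|\cdot|$ (and the associated operator norm on matrices), $G=GL(V)$, and $H$ the affine group of $V$, whose elements $h=(g,b)$ act by $hx=gx+b$. For $g\in G$ put $\gamma(g)=\max(|g|,|g^{-1}|)$. Let $\lambda$ be a probability on $H$ and $\mu$ its image on $G$ under $(g,b)\mapsto g$. Let $(A_n,B_n)_{n\ge1}$ be i.i.d. $H$-valued random variables with law $\lambda$ (probability $\mathbb P$, expectation $\mathbb E$), $S_0=I$, $S_n=A_n\cdots A_1$. Let $P\varphi(x)=\int\varphi(hx)\,d\lambda(h)$ and $Q\varphi(v)=\int\varphi(gv)\,d\mu(g)$ ($v\in V\setminus\{0\}$). Put $k(s)=\lim_n(\mathbb E|S_n|^s)^{1/n}$. Let $T$ be the closed subsemigroup of $G$ generated by the support of $\mu$. $T$ satisfies condition i-p if (a) no finite family of proper nonzero subspaces of $V$ is invariant (as a family) under $T$, and (b) $T$ contains an element having a unique eigenvalue of maximal modulus, this eigenvalue being real and simple. Condition (c-e) on $\lambda$ means: $\int\log\gamma\,d\mu<\infty$ and (1) no point of $V$ is fixed by all elements of the support of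 $\lambda$; (2) there is $\alpha>0$ with $k(\alpha)=1$; (3) there is $\varepsilon>0$ with $\mathbb E(|A_1|^\alpha\gamma(A_1)^\varepsilon+|B_1|^{\alpha+\varepsilon})<\infty$; (4) if $d>1$, $T$ satisfies i-p; if $d=1$, the additive subgroup of $\mathbb R$ generated by $\{\log|a|:a\in T\}$ is dense. Under (c-e) it is known that $\alpha$ is unique, $\lim_n S_n=0$ a.s., $P$ has a unique invariant probability $\rho$ on $V$, and there exist $c>0$ and a probability $\sigma^\alpha$ on $\mathbb S^{d-1}$ such that $t^{-\alpha}(t\cdot\rho)\to\Lambda$ vaguely on $V\setminus\{0\}$ as $t\to0^+$, where $t\cdot\rho$ is the image of $\rho$ under $v\mapsto tv$ and $\Lambda$ is the image of $c\,\sigma^\alpha\otimes r^{-\alpha-1}dr$ under $(u,r)\mapsto ru$; $\Lambda$ is $Q$-invariant and $\Lambda(\{|v|>t\})=\alpha^{-1}ct^{-\alpha}$. Notation: $\Lambda_0=\alpha c^{-1}\Lambda$; $u_n=(\alpha^{-1}cn)^{1/\alpha}$. $\mathbb P_\rho$ is the law of the stationary Markov chain $(X_n)_{n\ge0}$, $X_n=A_nX_{n-1}+B_n$, with $X_0\sim\rho$ independent of $(A_n,B_n)_{n\ge1}$, and $\mathbb E_\rho$ its expectation. $\mathbb E_{\Lambda_0}$ denotes integration of $v$ against $\Lambda_0$ combined with expectation over $(A_n)$. $\pi_v^\omega=\sum_{i\ge0}\varepsilon_{S_iv}$ is the occupation measure ($\varepsilon_x$ the Dirac mass), so $\pi_v^\omega(f)=\sum_{i\ge0}f(S_iv)$.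 *)

theory Defs
  imports "HOL-Probability.Probability" "HOL-Computational_Algebra.Polynomial"
begin

text \<open>Elements of the affine group H are pairs (g,b), acting by x |-> g x + b.
  V = real^'d (Euclidean norm), matrices real^'d^'d.\<close>

type_synonym 'd aff = "(real^'d^'d) \<times> (real^'d)"

definition opnorm :: "real^'d^'d \<Rightarrow> real" where
  "opnorm g = onorm (\<lambda>x. g *v x)"

definition gam :: "real^'d^'d \<Rightarrow> real" where
  "gam g = max (opnorm g) (opnorm (matrix_inv g))"

definition msupp :: "'a::metric_space measure \<Rightarrow> 'a set" where
  "msupp M = {x. \<forall>e>0. emeasure M (ball x e) \<noteq> 0}"

definition mu_of :: "'d::finite aff measure \<Rightarrow> (real^'d^'d) measure" where
  "mu_of lam = distr lam borel fst"

inductive_set semigroup_gen :: "(real^'d^'d) set \<Rightarrow> (real^'d^'d) set" for S where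
  base: "g \<in> S \<Longrightarrow> g \<in> semigroup_gen S"
| mult: "g \<in> semigroup_gen S \<Longrightarrow> h \<in> semigroup_gen S \<Longrightarrow> g ** h \<in> semigroup_gen S"

text \<open>T: closed (in G = GL(V)) subsemigroup of G generated by the support of mu
  (support taken in G).\<close>
definition Tsg :: "'d::finite aff measure \<Rightarrow> (real^'d^'d) set" where
  "Tsg lam = closure (semigroup_gen (msupp (mu_of lam) \<inter> {g. invertible g})) \<inter> {g. invertible g}"

definition charpoly_c :: "real^'d::finite^'d \<Rightarrow> complex poly" where
  "charpoly_c g = det (\<chi> i j. (if i = j then [:0, 1:] else 0) - [:complex_of_real (g $ i $ j):])"

definition cond_ip :: "(real^'d::finite^'d) set \<Rightarrow> bool" where
  "cond_ip T \<longleftrightarrow>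
     \<not> (\<exists>F. finite F \<and> F \<noteq> {} \<and>
            (\<forall>W\<in>F. subspace W \<and> W \<noteq> {0} \<and> W \<noteq> UNIV) \<and>
            (\<forall>g\<in>T. \<forall>W\<in>F. (\<lambda>x. g *v x) ` W \<in> F))
   \<and> (\<exists>g\<in>T. \<exists>r::real.
         poly (charpoly_c g) (complex_of_real r) = 0 \<and>
         order (complex_of_real r) (charpoly_c g) = 1 \<and>
         (\<forall>z. poly (charpoly_c g) z = 0 \<and> z \<noteq> complex_of_real r \<longrightarrow> cmod z < \<bar>r\<bar>))"

definition add_subgroup_gen :: "real set \<Rightarrow> real set" where
  "add_subgroup_gen A = \<Inter>{G. A \<subseteq> G \<and> 0 \<in> G \<and> (\<forall>x\<in>G. \<forall>y\<in>G. x - y \<in> G)}"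

fun Spow :: "(real^'d^'d) measure \<Rightarrow> nat \<Rightarrow> (real^'d^'d) measure" where
  "Spow mu 0 = return borel (mat 1)"
| "Spow mu (Suc n) = distr (mu \<Otimes>\<^sub>M Spow mu n) borel (\<lambda>(g, h). g ** h)"

fun Sprod :: "'d aff stream \<Rightarrow> nat \<Rightarrow> real^'d^'d" where
  "Sprod \<omega> 0 = mat 1"
| "Sprod \<omega> (Suc n) = fst (\<omega> !! n) ** Sprod \<omega> n"

fun chain :: "real^'d \<Rightarrow> 'd aff stream \<Rightarrow> nat \<Rightarrow> real^'d" where
  "chain x \<omega> 0 = x"
| "chain x \<omega> (Suc n) = fst (\<omega> !! n) *v chain x \<omega> n + snd (\<omega> !! n)"

definition cond_ce :: "'d::finite aff measure \<Rightarrow> real \<Rightarrow> bool" where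
  "cond_ce lam \<alpha> \<longleftrightarrow>
     (\<integral>\<^sup>+ g. ennreal (ln (gam g)) \<partial>(mu_of lam)) < \<infinity>
   \<and> \<not> (\<exists>x. \<forall>h \<in> msupp lam \<inter> {h. invertible (fst h)}. fst h *v x + snd h = x)
   \<and> \<alpha> > 0
   \<and> (\<lambda>n. (\<integral>g. opnorm g powr \<alpha> \<partial>(Spow (mu_of lam) n)) powr (1 / real n)) \<longlonglongrightarrow> 1
   \<and> (\<exists>\<epsilon>>0. (\<integral>\<^sup>+ h. ennreal (opnorm (fst h) powr \<alpha> * gam (fst h) powr \<epsilon>
                          + norm (snd h) powr (\<alpha> + \<epsilon>)) \<partial>lam) < \<infinity>)
   \<and> (CARD('d) > 1 \<longrightarrow> cond_ip (Tsg lam))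
   \<and> (CARD('d) = 1 \<longrightarrow> closure (add_subgroup_gen {ln (opnorm a) | a. a \<in> Tsg lam}) = UNIV)"

text \<open>The measure on V: image of sigma (x) kappa r^(-alpha-1) dr under (u,r) |-> r u.
  Lambda = radial_meas sigma c alpha; Lambda_0 = alpha c^-1 Lambda = radial_meas sigma alpha alpha.\<close>
definition radial_meas :: "(real^'d) measure \<Rightarrow> real \<Rightarrow> real \<Rightarrow> (real^'d) measure" where
  "radial_meas \<sigma> \<kappa> \<alpha> =
     distr (\<sigma> \<Otimes>\<^sub>M density lborel (\<lambda>r. ennreal (indicator {0<..} r * \<kappa> * r powr (- \<alpha> - 1))))
       borel (\<lambda>(u, r). r *\<^sub>R u)"

end

theory Submission
  imports Defs "HOL-Complex_Analysis.Great_Picard"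
    "HOL-Computational_Algebra.Fundamental_Theorem_Algebra"
begin

text \<open>
  Contraction. Let s = min 1 alpha. If E|S_n|^(s/2) were never below 1, normalised resolvents of
  x |-> |x|^s would accumulate, as their parameter tends to the critical one, at a superharmonic
  gauge h with E h(Ax) <= h(x), positive by irreducibility. Comparing with the square root of h,
  either E|S_n|^(s/2) decays or h is constant along an orbit of T. For d = 1
  the latter forces |g| = 1 on T, against density; for d > 1 it bounds T, and a proximal element
  then produces a finite invariant family of hyperplanes. Hence E|S_n|^(s/2) < 1 for some n, and
  by submultiplicativity these moments are summable.

  Limit. With t = 1/u_n, G_j(x) = E_x exp(-sum_{i=1..j} f(t X_i)) and phi_j the rho-integral of G_j,
  stationarity gives phi_j - phi_{j+1} = E_rho[(1 - exp(-f(t X_0))) G_j(X_0)]. The integrand lives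
  on an event of probability O(1/n) where X_0 is of order 1/t. There the first m terms of
  the sum follow the linear chain S_i X_0, and by contraction the remaining ones
  decouple from X_0 and contribute a factor phi_{j-m}. So phi_{j+1} = exp(-I/n) phi_j + o(1/n)
  uniformly in j, and phi_n tends to exp(-I). No block decomposition is needed.
\<close>

subsection \<open>Operator norm\<close>

text \<open>The moments E|S_n|^s are log-convex in s, so k(0) = k(\<alpha>) = 1 only gives k \<le> 1
  between 0 and \<alpha>. The obstacle is that k might be constant there; strictness at one exponent
  has to come from the geometry of T. Capping s at 1 makes |x|^s subadditive: normalised resolvents
  then share one Hoelder modulus, and zero sets of gauges are subspaces. The square root of the
  gauge is taken because Cauchy-Schwarz has a rigid equality case. For complex f the numbers phi_j
  may vanish, so they are neither divided by nor put under a logarithm; the recursion is compared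
  additively with a geometric sequence. Moments of rho are avoided by measuring distances with
  min(1, |x|^s), whose rho-mean at scale t tends to 0 by dominated convergence. The limits are taken
  in a fixed order: n first, with m fixed, so that vague convergence acts on a continuous compactly
  supported function, and m afterwards.\<close>

lemma norm_mult_opnorm: "norm (g *v x) \<le> opnorm g * norm x"
  for g :: "real^'d^'d"
  unfolding opnorm_def by (rule onorm) (rule matrix_vector_mul_bounded_linear)

lemma opnorm_nonneg [simp]: "0 \<le> opnorm g" for g :: "real^'d^'d"
  unfolding opnorm_def by (rule onorm_pos_le) (rule matrix_vector_mul_bounded_linear)

lemma opnorm_mat_1 [simp]: "opnorm (mat 1 :: real^'d^'d) = 1"
proof -
  have "(*v) (mat 1 :: real^'d^'d) = (\<lambda>x. x)" by auto
  then show ?thesis by (simp add: opnorm_def onorm_id)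
qed

lemma opnorm_mult: "opnorm (g ** h) \<le> opnorm g * opnorm h" for g h :: "real^'d^'d"
  using onorm_compose[OF matrix_vector_mul_bounded_linear[of g] matrix_vector_mul_bounded_linear[of h]]
  unfolding opnorm_def comp_def by (simp add: matrix_vector_mul_assoc)

lemma opnorm_add: "opnorm (g + h) \<le> opnorm g + opnorm h" for g h :: "real^'d^'d"
  unfolding opnorm_def matrix_vector_mult_add_rdistrib
  by (rule onorm_triangle) (rule matrix_vector_mul_bounded_linear)+

lemma opnorm_scaleR: "opnorm (c *\<^sub>R g) = \<bar>c\<bar> * opnorm g" for g :: "real^'d^'d"
  unfolding opnorm_def scaleR_matrix_vector_assoc[symmetric]
  by (rule onorm_scaleR) (rule matrix_vector_mul_bounded_linear)

text \<open>A seminorm is convex, and finite convex functions on a finite-dimensional space are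
  continuous.\<close>

lemma continuous_opnorm: "continuous_on UNIV (opnorm :: real^'d^'d \<Rightarrow> real)"
proof (rule convex_on_continuous)
  show "convex_on UNIV (opnorm :: real^'d^'d \<Rightarrow> real)"
    by (rule convex_onI)
       (auto intro!: order_trans[OF opnorm_add] simp: opnorm_scaleR)
qed simp

lemma opnorm_measurable [measurable]: "(opnorm :: real^'d^'d \<Rightarrow> real) \<in> borel_measurable borel"
  using continuous_opnorm by (rule borel_measurable_continuous_onI)

lemma matrix_vector_mult_axis_sum: "g *v x = (\<Sum>j\<in>UNIV. (x $ j) *\<^sub>R (g *v axis j 1))"
  for g :: "real^'d^'d"
  by (simp add: matrix_vector_mult_basis) (simp add: matrix_mult_sum scalar_mult_eq_scaleR)

text \<open>Reduces moments of the operator norm to those of finitely many vectors, to which gauge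
  inequalities apply.\<close>

lemma opnorm_le_sum: "opnorm g \<le> (\<Sum>j\<in>UNIV. norm (g *v axis j 1))" for g :: "real^'d^'d"
  unfolding opnorm_def
proof (rule onorm_le)
  fix x :: "real^'d"
  have "norm (g *v x) \<le> (\<Sum>j\<in>UNIV. norm ((x $ j) *\<^sub>R (g *v axis j 1)))"
    by (subst matrix_vector_mult_axis_sum) (rule norm_sum)
  also have "\<dots> \<le> (\<Sum>j\<in>UNIV. norm x * norm (g *v axis j 1))"
    by (intro sum_mono) (auto intro!: mult_right_mono simp: component_le_norm_cart)
  finally show "norm (g *v x) \<le> (\<Sum>j\<in>UNIV. norm (g *v axis j 1)) * norm x"
    by (simp add: sum_distrib_left mult.commute)
qed

text \<open>The norms of g and of its inverse have product at least 1, so they cannot both be below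
  1.\<close>

lemma gam_ge_1:
  fixes g :: "real^'d^'d"
  assumes "invertible g"
  shows "1 \<le> gam g"
proof -
  have "g ** matrix_inv g = mat 1"
    using someI_ex[OF assms[unfolded invertible_def]] by (simp add: matrix_inv_def)
  then have "1 = opnorm (g ** matrix_inv g)" by simp
  also have "\<dots> \<le> opnorm g * opnorm (matrix_inv g)" by (rule opnorm_mult)
  finally have *: "1 \<le> opnorm g * opnorm (matrix_inv g)" .
  show ?thesis
  proof (rule ccontr)
    assume "\<not> ?thesis"
    then have "opnorm g < 1" "opnorm (matrix_inv g) < 1" by (auto simp: gam_def)
    then have "opnorm g * opnorm (matrix_inv g) < 1"
      using mult_strict_mono'[of "opnorm g" 1 "opnorm (matrix_inv g)" 1] by simp
    with * show False by simp
  qed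
qed

lemma matrix_vector_mult_continuous:
  fixes F :: "'a::topological_space \<Rightarrow> real^'d^'d"
  assumes that: "continuous_on A F" "continuous_on A G"
  shows "continuous_on A (\<lambda>z. F z *v G z)"
proof -
  have "continuous_on A (\<lambda>z. \<chi> i. \<Sum>j\<in>UNIV. F z $ i $ j * G z $ j)"
    by (intro continuous_intros that)
  then show ?thesis by (simp add: matrix_vector_mult_def)
qed

lemma matrix_apply_continuous: "continuous_on A (\<lambda>g :: real^'d^'d. g *v x)"
  by (intro matrix_vector_mult_continuous continuous_on_id continuous_on_const)

lemma matrix_mult_continuous:
  fixes F :: "'a::topological_space \<Rightarrow> real^'d^'d"
  assumes that: "continuous_on A F" "continuous_on A G"
  shows "continuous_on A (\<lambda>z. F z ** G z)"
proof -
  have "continuous_on A (\<lambda>z. \<chi> i j. \<Sum>k\<in>UNIV. F z $ i $ k * G z $ k $ j)"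
    by (intro continuous_intros that)
  then show ?thesis by (simp add: matrix_matrix_mult_def)
qed

subsection \<open>Linear recurrences\<close>

text \<open>A polynomial acting on sequences, the indeterminate being the shift.\<close>

definition shift_act :: "complex poly \<Rightarrow> (nat \<Rightarrow> complex) \<Rightarrow> nat \<Rightarrow> complex" where
  "shift_act p y n = (\<Sum>k\<le>degree p. coeff p k * y (n + k))"

lemma shift_act_bound: "degree p \<le> N \<Longrightarrow> shift_act p y n = (\<Sum>k\<le>N. coeff p k * y (n + k))"
  unfolding shift_act_def
  by (rule sum.mono_neutral_left) (auto simp: coeff_eq_0)

lemma shift_act_0 [simp]: "shift_act 0 y n = 0"
  by (simp add: shift_act_def)

lemma shift_act_zero_seq [simp]: "shift_act p (\<lambda>_. 0) = (\<lambda>_. 0)"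
  by (simp add: shift_act_def fun_eq_iff)

lemma shift_act_pCons: "shift_act (pCons a p) y n = a * y n + shift_act p y (Suc n)"
proof -
  have "shift_act (pCons a p) y n = (\<Sum>k\<le>Suc (degree p). coeff (pCons a p) k * y (n + k))"
    by (rule shift_act_bound) (rule degree_pCons_le)
  also have "\<dots> = a * y n + (\<Sum>k\<le>degree p. coeff p k * y (Suc n + k))"
    by (subst sum.atMost_Suc_shift) simp
  finally show ?thesis by (simp add: shift_act_def)
qed

lemma shift_act_add: "shift_act (p + q) y n = shift_act p y n + shift_act q y n"
proof -
  let ?N = "max (degree p) (degree q)"
  have "shift_act (p + q) y n = (\<Sum>k\<le>?N. coeff (p + q) k * y (n + k))"
    by (rule shift_act_bound) (rule degree_add_le_max)
  moreover have "shift_act p y n = (\<Sum>k\<le>?N. coeff p k * y (n + k))"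
    "shift_act q y n = (\<Sum>k\<le>?N. coeff q k * y (n + k))"
    by (rule shift_act_bound; simp)+
  ultimately show ?thesis by (simp add: sum.distrib algebra_simps)
qed

lemma shift_act_smult: "shift_act (smult a p) y n = a * shift_act p y n"
  by (subst shift_act_bound[of _ "degree p"])
     (auto simp: degree_smult_le shift_act_def sum_distrib_left mult.assoc)

text \<open>Sequences form a module over the polynomial ring, so the roots of an annihilating
  polynomial can be treated one at a time.\<close>

lemma shift_act_mult: "shift_act (p * q) y n = shift_act p (shift_act q y) n"
proof (induction p arbitrary: n)
  case (pCons a p)
  then show ?case
    by (simp add: shift_act_add shift_act_smult shift_act_pCons)
qed simp

lemma shift_act_seq_mult: "shift_act (p * q) y = shift_act p (shift_act q y)"
  by (rule ext) (rule shift_act_mult)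

lemma tendsto_0_linear_recurrence:
  fixes y :: "nat \<Rightarrow> complex"
  assumes z: "cmod z < 1" and lim: "(\<lambda>n. y (Suc n) - z * y n) \<longlonglongrightarrow> 0"
  shows "y \<longlonglongrightarrow> 0"
proof (rule LIMSEQ_I)
  fix \<epsilon> :: real assume "\<epsilon> > 0"
  define q where "q = cmod z"
  have q: "0 \<le> q" "q < 1" using z by (auto simp: q_def)
  \<comment> \<open>Chosen so that \<epsilon>/2 is the fixed point of x |-> q x + e.\<close>
  define e where "e = \<epsilon> * (1 - q) / 2"
  have "e > 0" using q \<open>\<epsilon> > 0\<close> by (simp add: e_def)
  then obtain N where N: "\<And>n. n \<ge> N \<Longrightarrow> cmod (y (Suc n) - z * y n) < e"
    using LIMSEQ_D[OF lim] by auto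
  have bd: "cmod (y (N + k)) \<le> q ^ k * cmod (y N) + \<epsilon> / 2" for k
  proof (induction k)
    case 0
    then show ?case using \<open>\<epsilon> > 0\<close> by simp
  next
    case (Suc k)
    have "cmod (y (N + Suc k)) \<le> cmod (y (Suc (N + k)) - z * y (N + k)) + cmod (z * y (N + k))"
      using norm_triangle_ineq[of "y (Suc (N + k)) - z * y (N + k)" "z * y (N + k)"] by simp
    also have "\<dots> \<le> e + q * (q ^ k * cmod (y N) + \<epsilon> / 2)"
      using N[of "N + k"] Suc q by (intro add_mono) (auto simp: norm_mult q_def intro: mult_left_mono)
    also have "\<dots> = q ^ Suc k * cmod (y N) + \<epsilon> / 2"
      by (simp add: e_def field_simps)
    finally show ?case .
  qed
  have "(\<lambda>k. q ^ k * cmod (y N)) \<longlonglongrightarrow> 0 * cmod (y N)"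
    using q by (intro tendsto_mult LIMSEQ_realpow_zero tendsto_const)
  then have "(\<lambda>k. q ^ k * cmod (y N)) \<longlonglongrightarrow> 0" by simp
  from order_tendstoD(2)[OF this, of "\<epsilon> / 2"] obtain M where
    M: "\<And>k. k \<ge> M \<Longrightarrow> q ^ k * cmod (y N) < \<epsilon> / 2"
    using \<open>\<epsilon> > 0\<close> by (auto simp: eventually_sequentially)
  show "\<exists>no. \<forall>n\<ge>no. norm (y n - 0) < \<epsilon>"
  proof (intro exI allI impI)
    fix n assume "n \<ge> N + M"
    then obtain k where "n = N + k" "k \<ge> M" using that[of "n - N"] by simp
    then show "norm (y n - 0) < \<epsilon>" using bd[of k] M[of k] by simp
  qed
qed

text \<open>Each linear factor is split off in turn: the cofactor annihilates y(n+1) - z y(n), which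
  tends to 0 by induction, and a first-order recurrence with |z| < 1 then forces y to 0. No closed
  form with multiplicities is required.\<close>

lemma shift_act_eq_0_imp_tendsto_0:
  assumes "p \<noteq> 0" "\<And>z. poly p z = 0 \<Longrightarrow> cmod z < 1" "shift_act p y = (\<lambda>_. 0)"
  shows "y \<longlonglongrightarrow> 0"
  using assms
proof (induction "degree p" arbitrary: p y)
  case 0
  then obtain a where "p = [:a:]" by (metis degree_eq_zeroE)
  with 0 have "y = (\<lambda>_. 0)"
    by (auto simp: fun_eq_iff shift_act_pCons)
  then show ?case by simp
next
  case (Suc d)
  then have "\<not> constant (poly p)" by (simp add: constant_degree)
  then obtain z where z: "poly p z = 0" using fundamental_theorem_of_algebra by blast
  then obtain q where q: "p = [:-z, 1:] * q" by (meson poly_eq_0_iff_dvd dvdE)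
  have "q \<noteq> 0" using Suc.prems q by auto
  then have "degree q = d" using Suc.hyps(2) degree_mult_eq[of "[:-z, 1:]" q] q by (simp del: mult_pCons_left)
  have "shift_act q (shift_act [:-z, 1:] y) = (\<lambda>_. 0)"
    using Suc.prems(3) q by (simp add: shift_act_seq_mult[symmetric] mult.commute)
  with Suc.hyps(1)[of q "shift_act [:-z, 1:] y"] \<open>degree q = d\<close> \<open>q \<noteq> 0\<close> Suc.prems(2) q
  have "shift_act [:-z, 1:] y \<longlonglongrightarrow> 0" by (auto simp: poly_mult)
  then have "(\<lambda>n. y (Suc n) - z * y n) \<longlonglongrightarrow> 0"
    by (simp add: shift_act_pCons[abs_def] )
  then show ?case using Suc.prems(2)[OF z] by (rule tendsto_0_linear_recurrence[rotated])
qed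

lemma shift_act_bounded:
  assumes "\<And>n. cmod (y n) \<le> B"
  shows "\<exists>B'. \<forall>n. cmod (shift_act p y n) \<le> B'"
proof (intro exI allI)
  fix n
  have "cmod (shift_act p y n) \<le> (\<Sum>k\<le>degree p. cmod (coeff p k * y (n + k)))"
    unfolding shift_act_def by (rule norm_sum)
  also have "\<dots> \<le> (\<Sum>k\<le>degree p. cmod (coeff p k) * B)"
    by (intro sum_mono) (auto simp: norm_mult intro!: mult_left_mono assms)
  finally show "cmod (shift_act p y n) \<le> (\<Sum>k\<le>degree p. cmod (coeff p k) * B)" .
qed

text \<open>A double root r would contribute a multiple of n r^n, which is unbounded for |r| =
  1.\<close>

lemma shift_act_square_bounded:
  assumes r: "cmod r = 1" and B: "\<And>n. cmod (y n) \<le> B"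
    and 0: "shift_act [:-r, 1:] (shift_act [:-r, 1:] y) = (\<lambda>_. 0)"
  shows "shift_act [:-r, 1:] y = (\<lambda>_. 0)"
proof -
  define z where "z = shift_act [:-r, 1:] y"
  have y: "y (Suc n) = r * y n + z n" for n by (simp add: z_def shift_act_pCons)
  have zS: "z (Suc n) = r * z n" for n
    using fun_cong[OF 0, of n] by (simp add: z_def[symmetric] shift_act_pCons)
  have z: "z n = r ^ n * z 0" for n
  proof (induction n)
    case (Suc n)
    then show ?case by (simp only: zS[of n] power_Suc mult.assoc)
  qed simp
  \<comment> \<open>The solution r^n y_0 + n r^(n-1) z_0, multiplied by r to avoid the exponent n -
    1.\<close>
  have yn: "r * y n = r ^ Suc n * y 0 + of_nat n * r ^ n * z 0" for n
  proof (induction n)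
    case (Suc n)
    have "r * y (Suc n) = r * (r * y n + z n)" by (simp only: y)
    also have "\<dots> = r * (r ^ Suc n * y 0 + of_nat n * r ^ n * z 0 + r ^ n * z 0)"
      by (simp only: Suc z[of n])
    finally show ?case by (simp add: algebra_simps)
  qed simp
  have "z 0 = 0"
  proof (rule ccontr)
    assume "z 0 \<noteq> 0"
    then have "cmod (z 0) > 0" by simp
    obtain n :: nat where n: "2 * B / cmod (z 0) < real n" using reals_Archimedean2 by blast
    have "of_nat n * r ^ n * z 0 = r * y n - r ^ Suc n * y 0" using yn[of n] by simp
    then have "cmod (of_nat n * r ^ n * z 0) \<le> cmod (r * y n) + cmod (r ^ Suc n * y 0)"
      by (metis norm_triangle_ineq4)
    then have "real n * cmod (z 0) \<le> 2 * B"
      using r B[of n] B[of 0] by (simp add: norm_mult norm_power)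
    with n \<open>cmod (z 0) > 0\<close> show False by (simp add: field_simps)
  qed
  then have "z n = 0" for n by (subst z) simp
  then show ?thesis by (simp add: fun_eq_iff z_def)
qed

text \<open>The exponent drops by one at a time: the square case applies to the sequence
  \<open>w\<close> left after all but two factors have acted, and \<open>w\<close> is still
  bounded.\<close>

lemma shift_act_power_bounded:
  assumes r: "cmod r = 1" and B: "\<And>n. cmod (y n) \<le> B"
    and 0: "shift_act ([:-r, 1:] ^ k) y = (\<lambda>_. 0)"
  shows "shift_act [:-r, 1:] y = (\<lambda>_. 0)"
  using 0
proof (induction k)
  case 0
  then have "y = (\<lambda>_. 0)" by (simp add: fun_eq_iff shift_act_pCons one_pCons)
  then show ?case by simp
next
  case (Suc k)
  show ?case
  proof (cases k)
    case 0
    with Suc show ?thesis by simp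
  next
    case (Suc l)
    define w where "w = shift_act ([:-r, 1:] ^ l) y"
    obtain B' where B': "\<And>n. cmod (w n) \<le> B'"
      using shift_act_bounded[of y B, OF B] unfolding w_def by blast
    have "shift_act [:-r, 1:] (shift_act [:-r, 1:] w) = (\<lambda>_. 0)"
      using Suc.prems unfolding w_def Suc by (simp add: shift_act_seq_mult[symmetric] mult.assoc)
    then have "shift_act [:-r, 1:] w = (\<lambda>_. 0)"
      using shift_act_square_bounded[of r w B', OF r B'] by blast
    then have "shift_act ([:-r, 1:] ^ k) y = (\<lambda>_. 0)"
      unfolding w_def Suc by (simp add: shift_act_seq_mult[symmetric])
    then show ?thesis by (rule Suc.IH)
  qed
qed

subsection \<open>Powers of a matrix with a simple dominant eigenvalue\<close>

primrec mpow :: "'a::semiring_1^'d^'d \<Rightarrow> nat \<Rightarrow> 'a^'d^'d" where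
  "mpow g 0 = mat 1"
| "mpow g (Suc n) = g ** mpow g n"

lemma mpow_Suc2: "mpow g (Suc n) = mpow g n ** g"
proof (induction n)
  case (Suc n)
  then show ?case by (metis matrix_mul_assoc mpow.simps(2))
qed simp

definition cmat :: "real^'d^'d \<Rightarrow> complex^'d^'d" where
  "cmat g = (\<chi> i j. complex_of_real (g $ i $ j))"

definition pow_entry :: "real^'d^'d \<Rightarrow> 'd \<Rightarrow> 'd \<Rightarrow> nat \<Rightarrow> complex" where
  "pow_entry g i j n = complex_of_real (mpow g n $ i $ j)"

lemma pow_entry_Suc: "pow_entry g i j (Suc n) = (\<Sum>l\<in>UNIV. cmat g $ i $ l * pow_entry g l j n)"
  by (simp add: pow_entry_def matrix_matrix_mult_def cmat_def)

lemma shift_act_pow_entry_Suc: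
  "shift_act p (pow_entry g i j) (Suc n) = (\<Sum>l\<in>UNIV. cmat g $ i $ l * shift_act p (pow_entry g l j) n)"
proof -
  have "shift_act p (pow_entry g i j) (Suc n) =
     (\<Sum>k\<le>degree p. \<Sum>l\<in>UNIV. coeff p k * (cmat g $ i $ l * pow_entry g l j (n + k)))"
    by (simp add: shift_act_def pow_entry_Suc sum_distrib_left)
  also have "\<dots> = (\<Sum>l\<in>UNIV. cmat g $ i $ l * shift_act p (pow_entry g l j) n)"
    by (subst sum.swap) (simp add: shift_act_def sum_distrib_left mult_ac)
  finally show ?thesis .
qed

definition annihilates :: "complex poly \<Rightarrow> real^'d^'d \<Rightarrow> bool" where
  "annihilates p g \<longleftrightarrow> (\<forall>i j. shift_act p (pow_entry g i j) = (\<lambda>_. 0))"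

text \<open>Index 0 says p(g) = 0; index n is the same matrix multiplied by the n-th power of
  g.\<close>

lemma annihilates_iff: "annihilates p g \<longleftrightarrow> (\<forall>i j. shift_act p (pow_entry g i j) 0 = 0)"
proof
  assume *: "\<forall>i j. shift_act p (pow_entry g i j) 0 = 0"
  have "shift_act p (pow_entry g i j) n = 0" for i j n
    by (induction n arbitrary: i j) (simp_all add: * shift_act_pow_entry_Suc)
  then show "annihilates p g" by (auto simp: annihilates_def)
qed (simp add: annihilates_def)

lemma shift_act_monom: "shift_act (monom a k) y n = a * y (n + k)"
  by (subst shift_act_bound[of _ k]) (auto simp: degree_monom_le if_distrib if_distribR cong: if_cong)

lemma shift_act_sum: "finite S \<Longrightarrow> shift_act (\<Sum>i\<in>S. p i) y n = (\<Sum>i\<in>S. shift_act (p i) y n)"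
  by (induction S rule: finite_induct) (simp_all add: shift_act_add)

lemma ex_annihilates:
  fixes g :: "real^'d^'d"
  shows "\<exists>p. p \<noteq> 0 \<and> annihilates p g"
proof -
  let ?N = "DIM(real^'d^'d)"
  \<comment> \<open>If two powers coincide, their set is too small for the dimension count, but
    their difference is already a relation.\<close>
  have "\<exists>c. (\<exists>k\<in>{..?N}. c k \<noteq> 0) \<and> (\<Sum>k\<le>?N. c k *\<^sub>R mpow g k) = 0"
  proof (cases "inj_on (mpow g) {..?N}")
    case True
    then have "card (mpow g ` {..?N}) = Suc ?N" by (simp add: card_image)
    then have "dependent (mpow g ` {..?N})"
      using independent_bound[of "mpow g ` {..?N}"] by auto
    then obtain u v where u: "v \<in> mpow g ` {..?N}" "u v \<noteq> 0"
      "(\<Sum>v\<in>mpow g ` {..?N}. u v *\<^sub>R v) = 0"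
      by (auto simp: dependent_finite)
    have "(\<Sum>v\<in>mpow g ` {..?N}. u v *\<^sub>R v) = (\<Sum>k\<le>?N. u (mpow g k) *\<^sub>R mpow g k)"
      by (simp only: sum.reindex[OF True] comp_def)
    with u show ?thesis by (intro exI[of _ "\<lambda>k. u (mpow g k)"]) auto
  next
    case False
    then obtain i j where ij: "i \<le> ?N" "j \<le> ?N" "i \<noteq> j" "mpow g i = mpow g j"
      by (auto simp: inj_on_def)
    let ?c = "\<lambda>k. (if k = i then 1 else 0) - (if k = j then 1 else 0 :: real)"
    have "(\<Sum>k\<le>?N. ?c k *\<^sub>R mpow g k) =
      (\<Sum>k\<le>?N. if k = i then mpow g k else 0) - (\<Sum>k\<le>?N. if k = j then mpow g k else 0)"
      by (subst sum_subtractf[symmetric], rule sum.cong) auto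
    also have "\<dots> = 0" using ij by simp
    finally have "(\<Sum>k\<le>?N. ?c k *\<^sub>R mpow g k) = 0" .
    with ij show ?thesis by (intro exI[of _ ?c]) auto
  qed
  then obtain c k0 where k0: "k0 \<le> ?N" "c k0 \<noteq> 0" and c: "(\<Sum>k\<le>?N. c k *\<^sub>R mpow g k) = 0"
    by auto
  define p where "p = (\<Sum>k\<le>?N. monom (complex_of_real (c k)) k)"
  have "coeff p k0 = of_real (c k0)"
    using k0 by (simp add: p_def coeff_sum if_distrib cong: if_cong)
  then have "p \<noteq> 0" using k0 by auto
  moreover have "annihilates p g"
    unfolding annihilates_iff
  proof (intro allI)
    fix i j
    have "shift_act p (pow_entry g i j) 0 = complex_of_real (\<Sum>k\<le>?N. c k * mpow g k $ i $ j)"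
      by (simp add: p_def shift_act_sum shift_act_monom pow_entry_def)
    also have "(\<Sum>k\<le>?N. c k * mpow g k $ i $ j) = (\<Sum>k\<le>?N. c k *\<^sub>R mpow g k) $ i $ j"
      by simp
    finally show "shift_act p (pow_entry g i j) 0 = 0" unfolding c by simp
  qed
  ultimately show ?thesis by blast
qed

lemma poly_det: "poly (det M) z = det (\<chi> i j. poly (M $ i $ j) z)" for M :: "complex poly^'d^'d"
  by (simp add: det_def poly_sum poly_prod)

lemma poly_charpoly_c: "poly (charpoly_c g) z = det (mat z - cmat g)"
  unfolding charpoly_c_def poly_det
  by (rule arg_cong[where f = det]) (auto simp: vec_eq_iff mat_def cmat_def)

lemma charpoly_c_root_iff:
  "poly (charpoly_c g) z = 0 \<longleftrightarrow> (\<exists>v. v \<noteq> 0 \<and> cmat g *v v = z *s v)" (is "?L \<longleftrightarrow> ?R")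
proof -
  have mat: "mat z *v v = z *s v" for v :: "complex^'a"
    by (simp add: vec_eq_iff matrix_vector_mult_def mat_def if_distrib if_distribR cong: if_cong)
  have "?L \<longleftrightarrow> \<not> invertible (mat z - cmat g)"
    by (simp add: poly_charpoly_c invertible_det_nz)
  also have "\<dots> \<longleftrightarrow> \<not> (\<forall>x. (mat z - cmat g) *v x = 0 \<longrightarrow> x = 0)"
    by (simp add: invertible_left_inverse matrix_left_invertible_ker)
  also have "\<dots> \<longleftrightarrow> ?R"
    unfolding matrix_vector_mult_diff_rdistrib mat by (metis right_minus_eq)
  finally show ?thesis .
qed

text \<open>A minimal annihilating polynomial has only eigenvalues as roots; the Cayley--Hamilton
  theorem is not needed.\<close>

lemma ex_annihilates_roots:
  fixes g :: "real^'d^'d"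
  obtains p where "p \<noteq> 0" "annihilates p g" "\<And>z. poly p z = 0 \<Longrightarrow> poly (charpoly_c g) z = 0"
proof -
  obtain p where p: "p \<noteq> 0" "annihilates p g"
    and min: "\<And>q. q \<noteq> 0 \<Longrightarrow> annihilates q g \<Longrightarrow> degree p \<le> degree q"
    using ex_annihilates[of g] ex_has_least_nat[of "\<lambda>p. p \<noteq> 0 \<and> annihilates p g" _ degree] by metis
  have "poly (charpoly_c g) z = 0" if "poly p z = 0" for z
  proof -
    from that obtain q where q: "p = [:-z, 1:] * q" by (meson poly_eq_0_iff_dvd dvdE)
    have "q \<noteq> 0" using p q by auto
    have "degree q < degree p" using \<open>q \<noteq> 0\<close> degree_mult_eq[of "[:-z, 1:]" q] q by (simp del: mult_pCons_left)
    with min[of q] \<open>q \<noteq> 0\<close> have "\<not> annihilates q g" by auto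
    then obtain i j where ij: "shift_act q (pow_entry g i j) 0 \<noteq> 0"
      by (auto simp: annihilates_iff)
    \<comment> \<open>This is column j of q(g): nonzero because p was minimal, and an eigenvector
      because (g - z) q(g) = p(g) = 0.\<close>
    define v where "v = (\<chi> i. shift_act q (pow_entry g i j) 0)"
    have "v \<noteq> 0" using ij by (auto simp: v_def vec_eq_iff)
    moreover have "cmat g *v v = z *s v"
    proof -
      have "(cmat g *v v) $ i = (z *s v) $ i" for i
      proof -
        have "shift_act p (pow_entry g i j) 0 = 0"
          using p(2) by (simp add: annihilates_def)
        then have "shift_act q (pow_entry g i j) (Suc 0) - z * shift_act q (pow_entry g i j) 0 = 0"
          by (simp add: q shift_act_mult shift_act_pCons del: mult_pCons_left)
        then show ?thesis
          by (simp add: v_def matrix_vector_mult_def shift_act_pow_entry_Suc)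
      qed
      then show ?thesis by (simp add: vec_eq_iff)
    qed
    ultimately show ?thesis by (auto simp: charpoly_c_root_iff)
  qed
  with p that show ?thesis by blast
qed

text \<open>On an eigenvector v the n-th power of g acts as z^n, which bounded entries allow only
  for |z| \<le> 1.\<close>

lemma charpoly_c_root_bounded_powers:
  assumes root: "poly (charpoly_c g) z = 0" and B: "\<And>n i j. \<bar>mpow g n $ i $ j\<bar> \<le> B"
  shows "cmod z \<le> 1"
proof (rule ccontr)
  assume "\<not> cmod z \<le> 1"
  then have z: "cmod z > 1" by simp
  obtain v where v: "v \<noteq> 0" "cmat g *v v = z *s v" using root charpoly_c_root_iff by blast
  then obtain i where i: "v $ i \<noteq> 0" by (auto simp: vec_eq_iff)
  have eq: "(\<Sum>j\<in>UNIV. pow_entry g i j n * v $ j) = z ^ n * v $ i" for n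
  proof (induction n arbitrary: i)
    case 0
    show ?case by (simp add: pow_entry_def mat_def if_distrib if_distribR cong: if_cong)
  next
    case (Suc n)
    have "(\<Sum>j\<in>UNIV. pow_entry g i j (Suc n) * v $ j) =
        (\<Sum>j\<in>UNIV. \<Sum>l\<in>UNIV. cmat g $ i $ l * (pow_entry g l j n * v $ j))"
      by (simp add: pow_entry_Suc sum_distrib_right mult.assoc)
    also have "\<dots> = (\<Sum>l\<in>UNIV. cmat g $ i $ l * (z ^ n * v $ l))"
      by (subst sum.swap) (simp only: sum_distrib_left[symmetric] Suc)
    also have "\<dots> = z ^ n * (cmat g *v v) $ i"
      by (simp add: matrix_vector_mult_def sum_distrib_left mult_ac)
    finally show ?case by (simp add: v(2))
  qed
  have bd: "cmod z ^ n * cmod (v $ i) \<le> (\<Sum>j\<in>UNIV. B * cmod (v $ j))" for n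
  proof -
    have "cmod z ^ n * cmod (v $ i) = cmod (\<Sum>j\<in>UNIV. pow_entry g i j n * v $ j)"
      by (simp add: eq norm_mult norm_power)
    also have "\<dots> \<le> (\<Sum>j\<in>UNIV. cmod (pow_entry g i j n * v $ j))" by (rule norm_sum)
    also have "\<dots> \<le> (\<Sum>j\<in>UNIV. B * cmod (v $ j))"
      by (intro sum_mono) (auto simp: norm_mult pow_entry_def intro!: mult_right_mono B)
    finally show ?thesis .
  qed
  obtain n where "(\<Sum>j\<in>UNIV. B * cmod (v $ j)) / cmod (v $ i) < cmod z ^ n"
    using real_arch_pow[OF z] by blast
  with i bd[of n] show False by (simp add: field_simps)
qed

text \<open>Boundedness gives |r| \<le> 1. If |r| < 1, all entries tend to 0. If |r| = 1,
  boundedness reduces the factor X - r to multiplicity one, and the other roots lie strictly inside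
  the disc.\<close>

lemma dominant_eigenvalue_bounded_powers:
  fixes g :: "real^'d^'d"
  assumes root: "poly (charpoly_c g) (complex_of_real r) = 0"
    and dom: "\<And>z. poly (charpoly_c g) z = 0 \<Longrightarrow> z \<noteq> complex_of_real r \<Longrightarrow> cmod z < \<bar>r\<bar>"
    and B: "\<And>n i j. \<bar>mpow g n $ i $ j\<bar> \<le> B"
  shows "(\<lambda>n. mpow g (Suc n) $ i $ j - r * mpow g n $ i $ j) \<longlonglongrightarrow> 0"
proof -
  let ?r = "complex_of_real r"
  have r1: "\<bar>r\<bar> \<le> 1" using charpoly_c_root_bounded_powers[OF root B] by simp
  obtain p where p: "p \<noteq> 0" "annihilates p g"
    and roots: "\<And>z. poly p z = 0 \<Longrightarrow> poly (charpoly_c g) z = 0"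
    using ex_annihilates_roots by blast
  define y where "y = pow_entry g i j"
  have y0: "shift_act p y = (\<lambda>_. 0)" using p by (simp add: annihilates_def y_def)
  have yB: "cmod (y n) \<le> B" for n using B by (simp add: y_def pow_entry_def)
  have "shift_act [:-?r, 1:] y \<longlonglongrightarrow> 0"
  proof (cases "\<bar>r\<bar> < 1")
    case True
    have "cmod z < 1" if "poly p z = 0" for z
      using roots[OF that] dom[of z] True by (cases "z = ?r") auto
    then have "y \<longlonglongrightarrow> 0" using p y0 by (intro shift_act_eq_0_imp_tendsto_0[of p])
    then have "(\<lambda>n. -?r * y n + y (Suc n)) \<longlonglongrightarrow> -?r * 0 + 0"
      by (intro tendsto_intros LIMSEQ_Suc)
    then show ?thesis by (simp add: shift_act_pCons[abs_def])
  next
    case False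
    then have r: "\<bar>r\<bar> = 1" using r1 by simp
    \<comment> \<open>The cofactor has all its roots in the open disc: r is no longer a root, and
      any other root is dominated by |r| = 1.\<close>
    obtain q where q: "p = [:-?r, 1:] ^ order ?r p * q" and nq: "\<not> [:-?r, 1:] dvd q"
      using order_decomp[OF p(1)] by blast
    have "q \<noteq> 0" using nq by auto
    have "poly q ?r \<noteq> 0" using nq by (simp add: poly_eq_0_iff_dvd)
    have qroots: "cmod z < 1" if "poly q z = 0" for z
    proof -
      have "poly p z = 0" using that by (subst q) simp
      then show ?thesis using dom[of z] roots[of z] that \<open>poly q ?r \<noteq> 0\<close> r by auto
    qed
    obtain B' where B': "\<And>n. cmod (shift_act q y n) \<le> B'"
      using shift_act_bounded[of y B, OF yB] by blast
    have "shift_act ([:-?r, 1:] ^ order ?r p) (shift_act q y) = (\<lambda>_. 0)"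
      using y0 by (subst (asm) q) (simp add: shift_act_seq_mult)
    then have "shift_act [:-?r, 1:] (shift_act q y) = (\<lambda>_. 0)"
      using r B' by (intro shift_act_power_bounded) auto
    then have "shift_act q (shift_act [:-?r, 1:] y) = (\<lambda>_. 0)"
      by (simp only: shift_act_seq_mult[symmetric] mult.commute)
    then show ?thesis using \<open>q \<noteq> 0\<close> qroots by (intro shift_act_eq_0_imp_tendsto_0[of q])
  qed
  then have "(\<lambda>n. complex_of_real (mpow g (Suc n) $ i $ j - r * mpow g n $ i $ j)) \<longlonglongrightarrow> complex_of_real 0"
    by (simp add: shift_act_pCons[abs_def] y_def pow_entry_def algebra_simps)
  then show ?thesis by (rule tendsto_of_real_iff[THEN iffD1])
qed

section \<open>Left eigenvectors of a simple eigenvalue\<close>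

lemma invertible_two_rows:
  fixes v w :: "real^'d"
  assumes "i \<noteq> j" and minor: "v $ i * w $ j - v $ j * w $ i \<noteq> 0"
  shows "invertible (\<chi> k. if k = i then v else if k = j then w else axis k 1 :: real^'d^'d)"
proof -
  let ?P = "\<chi> k. if k = i then v else if k = j then w else axis k 1 :: real^'d^'d"
  have "x = 0" if Px: "?P *v x = 0" for x
  proof -
    have row: "(?P $ k) \<bullet> x = 0" for k
      using arg_cong[OF Px, of "\<lambda>y. y $ k"] by (simp add: matrix_mult_dot)
    have xk: "x $ k = 0" if "k \<noteq> i" "k \<noteq> j" for k
      using row[of k] that by (simp add: inner_axis' )
    have split: "u \<bullet> x = u $ i * x $ i + u $ j * x $ j" for u :: "real^'d"
    proof -
      have "u \<bullet> x = (\<Sum>k\<in>UNIV. u $ k * x $ k)" by (simp add: inner_vec_def)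
      also have "\<dots> = (\<Sum>k\<in>{i, j}. u $ k * x $ k)"
        by (rule sum.mono_neutral_right) (auto simp: xk)
      finally show ?thesis using \<open>i \<noteq> j\<close> by simp
    qed
    have e1: "v $ i * x $ i + v $ j * x $ j = 0" using row[of i] split[of v] by simp
    have e2: "w $ i * x $ i + w $ j * x $ j = 0" using row[of j] split[of w] \<open>i \<noteq> j\<close> by simp
    have "(v $ i * w $ j - v $ j * w $ i) * x $ i = 0" "(v $ i * w $ j - v $ j * w $ i) * x $ j = 0"
      using e1 e2 by algebra+
    with minor have "x $ i = 0" "x $ j = 0" by simp_all
    with xk show ?thesis by (metis vec_eq_iff zero_index)
  qed
  then show ?thesis by (simp add: invertible_left_inverse matrix_left_invertible_ker)
qed

text \<open>A simple root of the characteristic polynomial has geometric multiplicity one: two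
  independent left eigenvectors, completed to an invertible matrix P, would give two rows of
  P (X - g) divisible by X - r.\<close>

lemma simple_eigenvalue_minor:
  fixes g :: "real^'d^'d"
  assumes ord: "order (complex_of_real r) (charpoly_c g) = 1" and nz: "charpoly_c g \<noteq> 0"
    and v: "v v* g = r *\<^sub>R v" and w: "w v* g = r *\<^sub>R w"
  shows "v $ i * w $ j = v $ j * w $ i"
proof (rule ccontr)
  assume ne: "\<not> ?thesis"
  then have "i \<noteq> j" by auto
  let ?r = "complex_of_real r"
  define P :: "real^'d^'d" where "P = (\<chi> k. if k = i then v else if k = j then w else axis k 1)"
  have "invertible P" unfolding P_def using ne \<open>i \<noteq> j\<close> by (intro invertible_two_rows) auto
  \<comment> \<open>P as a matrix of constant polynomials, so that its product with X - g has
    determinant \<open>det PP * charpoly_c g\<close>.\<close>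
  define PP :: "complex poly^'d^'d" where "PP = (\<chi> k l. [:complex_of_real (P $ k $ l):])"
  define X :: "complex poly^'d^'d" where
    "X = (\<chi> i j. (if i = j then [:0, 1:] else 0) - [:complex_of_real (g $ i $ j):])"
  have "invertible (cmat P)"
  proof -
    obtain Q where "P ** Q = mat 1" "Q ** P = mat 1" using \<open>invertible P\<close> by (auto simp: invertible_def)
    moreover have "cmat A ** cmat B = cmat (A ** B)" for A B :: "real^'d^'d"
      by (simp add: cmat_def matrix_matrix_mult_def vec_eq_iff)
    moreover have "cmat (mat 1) = mat (1::complex)" by (auto simp: cmat_def mat_def vec_eq_iff)
    ultimately show ?thesis unfolding invertible_def by metis
  qed
  moreover have "poly (det PP) 0 = det (cmat P)"
    unfolding poly_det by (rule arg_cong[where f = det]) (simp add: PP_def cmat_def vec_eq_iff)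
  ultimately have "det PP \<noteq> 0" by (auto simp: invertible_det_nz)
  define W :: "real^'d \<Rightarrow> complex poly^'d" where "W u = (\<chi> l. [:complex_of_real (u $ l):])" for u
  define q where "q = [:- ?r, 1:]"
  \<comment> \<open>A left eigenvector u multiplied into X - g is (X - r) u, so rows i and j of
    \<open>Y\<close> each release a factor \<open>q\<close>.\<close>
  have rowX: "(\<Sum>k\<in>UNIV. [:complex_of_real (u $ k):] * X $ k $ l) = q * W u $ l"
    if u: "u v* g = r *\<^sub>R u" for u l
  proof -
    have "(\<Sum>k\<in>UNIV. [:complex_of_real (u $ k):] * X $ k $ l) =
      (\<Sum>k\<in>UNIV. if k = l then [:complex_of_real (u $ k):] * [:0, 1:] else 0)
       - (\<Sum>k\<in>UNIV. [:complex_of_real (u $ k * g $ k $ l):])"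
      by (subst sum_subtractf[symmetric], rule sum.cong) (auto simp: X_def)
    also have "(\<Sum>k\<in>UNIV. [:complex_of_real (u $ k * g $ k $ l):]) = [:complex_of_real ((u v* g) $ l):]"
    proof -
      have "(\<Sum>k\<in>A. [:h k:]) = [:\<Sum>k\<in>A. h k:]" if "finite A" for h :: "'d \<Rightarrow> complex" and A
        using that by (induction A rule: finite_induct) auto
      then show ?thesis by (simp add: vector_matrix_mult_def)
    qed
    finally show ?thesis by (simp add: u q_def W_def)
  qed
  define Y where "Y = PP ** X"
  have Yi: "Y $ i = q *s W v"
    using rowX[OF v] by (simp add: Y_def vec_eq_iff matrix_matrix_mult_def PP_def P_def)
  have Yj: "Y $ j = q *s W w"
    using rowX[OF w] \<open>i \<noteq> j\<close> by (simp add: Y_def vec_eq_iff matrix_matrix_mult_def PP_def P_def)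
  define Z where "Z = (\<chi> k. if k = i then W v else if k = j then W w else Y $ k)"
  have "det Y = det (\<chi> k. if k = i then q *s W v else Y $ k)"
    by (rule arg_cong[where f = det]) (auto simp: vec_eq_iff Yi)
  also have "\<dots> = q * det (\<chi> k. if k = i then W v else Y $ k)" by (rule det_row_mul)
  also have "det (\<chi> k. if k = i then W v else Y $ k)
      = det (\<chi> k. if k = j then q *s W w else (if k = i then W v else Y $ k))"
    using \<open>i \<noteq> j\<close> by (intro arg_cong[where f = det]) (auto simp: vec_eq_iff Yj)
  also have "\<dots> = q * det (\<chi> k. if k = j then W w else (if k = i then W v else Y $ k))"
    by (rule det_row_mul)
  finally have dY: "q ^ 2 dvd det Y" by (simp add: power2_eq_square mult.assoc[symmetric])
  have "det Y = det PP * charpoly_c g"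
    by (simp add: Y_def det_mul X_def charpoly_c_def)
  \<comment> \<open>A nonzero constant is a unit, hence can be cancelled in the divisibility by
    \<open>q ^ 2\<close>.\<close>
  moreover have dPP: "\<exists>a. a \<noteq> 0 \<and> det PP = [:a:]"
  proof -
    have "degree (det PP) \<le> 0"
      unfolding det_def
    proof (rule degree_sum_le)
      fix \<pi>
      have "degree (\<Prod>k\<in>UNIV. PP $ k $ \<pi> k) \<le> 0"
        using degree_prod_sum_le[of UNIV "\<lambda>k. PP $ k $ \<pi> k"] by (simp add: PP_def)
      moreover have "degree (of_int (sign \<pi>) :: complex poly) = 0" by simp
      ultimately show "degree (of_int (sign \<pi>) * (\<Prod>k\<in>UNIV. PP $ k $ \<pi> k)) \<le> 0"
        using degree_mult_le[of "of_int (sign \<pi>) :: complex poly" "\<Prod>k\<in>UNIV. PP $ k $ \<pi> k"] by simp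
    qed simp
    then obtain a where "det PP = [:a:]" by (metis degree_eq_zeroE le_zero_eq)
    with \<open>det PP \<noteq> 0\<close> show ?thesis by auto
  qed
  ultimately have "q ^ 2 dvd charpoly_c g"
    using dY by (auto simp: dvd_smult_iff)
  with nz have "2 \<le> order ?r (charpoly_c g)"
    unfolding q_def using order_divides by blast
  with ord show False by simp
qed

subsection \<open>Semigroups preserving a homogeneous function along an orbit\<close>

lemma invertible_inj: "invertible g \<Longrightarrow> g *v x = 0 \<Longrightarrow> x = 0" for g :: "real^'d^'d"
  using matrix_left_invertible_ker[of g] by (auto simp: invertible_left_inverse)

text \<open>Bridges two notions of invariance: \<open>irreducible_action\<close> speaks of
  inclusion, while \<open>cond_ip\<close> asks the image itself to belong to the family.\<close>

lemma subspace_image_eq_of_subset: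
  fixes g :: "real^'d^'d"
  assumes g: "invertible g" and W: "subspace W" and sub: "(\<lambda>x. g *v x) ` W \<subseteq> W"
  shows "(\<lambda>x. g *v x) ` W = W"
proof -
  have inj: "inj ((*v) g)"
    using g by (simp add: invertible_left_inverse matrix_left_invertible_injective)
  have "dim ((*v) g ` W) = dim W"
    by (rule dim_image_eq) (use inj in \<open>auto simp: inj_on_def\<close>)
  then show ?thesis
    using sub W by (intro subspace_dim_equal) (auto intro: linear_subspace_image)
qed

definition irreducible_action :: "(real^'d^'d) set \<Rightarrow> bool" where
  "irreducible_action T \<longleftrightarrow>
     (\<forall>W. subspace W \<and> (\<forall>g\<in>T. (\<lambda>x. g *v x) ` W \<subseteq> W) \<longrightarrow> W = {0} \<or> W = UNIV)"

lemma irreducible_actionD: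
  assumes "irreducible_action T" "subspace W" "\<And>g x. g \<in> T \<Longrightarrow> x \<in> W \<Longrightarrow> g *v x \<in> W"
    and "x \<in> W" "x \<noteq> 0"
  shows "W = UNIV"
  using assms unfolding irreducible_action_def by blast

text \<open>A proper nonzero invariant subspace alone is a finite invariant family.\<close>

lemma cond_ip_irreducible_action:
  assumes "cond_ip T" "\<And>g. g \<in> T \<Longrightarrow> invertible g"
  shows "irreducible_action T"
  unfolding irreducible_action_def
proof (intro allI impI, rule ccontr)
  fix W assume W: "subspace W \<and> (\<forall>g\<in>T. (\<lambda>x. g *v x) ` W \<subseteq> W)" and "\<not> (W = {0} \<or> W = UNIV)"
  then have 1: "subspace W" "W \<noteq> {0}" "W \<noteq> UNIV" by blast+
  have 2: "(\<lambda>x. g *v x) ` W = W" if "g \<in> T" for g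
    using W that assms(2) by (intro subspace_image_eq_of_subset) blast+
  have "\<exists>F. finite F \<and> F \<noteq> {} \<and> (\<forall>W\<in>F. subspace W \<and> W \<noteq> {0} \<and> W \<noteq> UNIV) \<and>
      (\<forall>g\<in>T. \<forall>W\<in>F. (\<lambda>v. g *v v) ` W \<in> F)"
    using 1 by (intro exI[of _ "{W}"] conjI ballI) (simp_all add: 2)
  then show False using assms(1)[unfolded cond_ip_def, THEN conjunct1] by (rule notE[rotated])
qed

lemma irreducible_action_dim_1:
  assumes "CARD('d) = 1"
  shows "irreducible_action (T :: (real^'d::finite^'d) set)"
  unfolding irreducible_action_def
proof (intro allI impI)
  fix W assume W: "subspace W \<and> (\<forall>g\<in>T. (\<lambda>x. g *v x) ` W \<subseteq> W)"
  show "W = {0} \<or> W = UNIV"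
  proof (cases "dim W = 0")
    case True
    then show ?thesis using W subspace_0 by (auto simp: dim_eq_0)
  next
    case False
    then have "dim W = DIM(real^'d)"
      using dim_subset_UNIV[of W] assms by (simp del: dim_eq_0)
    then have "W = UNIV" using W by (metis dim_eq_full span_eq_iff)
    then show ?thesis ..
  qed
qed

definition closed_semigroup :: "(real^'d^'d) set \<Rightarrow> (real^'d^'d) set" where
  "closed_semigroup S = closure (semigroup_gen S) \<inter> {g. invertible g}"

lemma invertible_closed_semigroup: "g \<in> closed_semigroup S \<Longrightarrow> invertible g"
  by (simp add: closed_semigroup_def)

lemma closed_semigroup_mult:
  fixes g h :: "real^'d^'d"
  assumes "g \<in> closed_semigroup S" "h \<in> closed_semigroup S"
  shows "g ** h \<in> closed_semigroup S"
proof -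
  obtain u where u: "\<And>n. u n \<in> semigroup_gen S" "u \<longlonglongrightarrow> g"
    using assms(1) by (auto simp: closed_semigroup_def closure_sequential)
  obtain v where v: "\<And>n. v n \<in> semigroup_gen S" "v \<longlonglongrightarrow> h"
    using assms(2) by (auto simp: closed_semigroup_def closure_sequential)
  have "continuous_on UNIV (\<lambda>z :: (real^'d^'d) \<times> (real^'d^'d). fst z ** snd z)"
    by (intro matrix_mult_continuous continuous_intros)
  then have "isCont (\<lambda>z :: (real^'d^'d) \<times> (real^'d^'d). fst z ** snd z) (g, h)"
    by (simp add: continuous_on_eq_continuous_at)
  from isCont_tendsto_compose[OF this tendsto_Pair[OF u(2) v(2)]]
  have "(\<lambda>n. u n ** v n) \<longlonglongrightarrow> g ** h" by simp
  moreover have "u n ** v n \<in> semigroup_gen S" for n using u v by (auto intro: semigroup_gen.mult)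
  ultimately have "g ** h \<in> closure (semigroup_gen S)" unfolding closure_sequential
    by (intro exI[of _ "\<lambda>n. u n ** v n"]) simp
  with assms show ?thesis by (auto simp: closed_semigroup_def invertible_mult)
qed

lemma closed_semigroup_closed_property:
  assumes "closed {g. P g}" "\<And>g. g \<in> semigroup_gen S \<Longrightarrow> P g" "g \<in> closed_semigroup S"
  shows "P g"
proof -
  have "closure (semigroup_gen S) \<subseteq> {g. P g}" using assms by (intro closure_minimal) auto
  with assms(3) show ?thesis by (auto simp: closed_semigroup_def)
qed

lemma mpow_closed_semigroup:
  "g \<in> closed_semigroup S \<Longrightarrow> mpow g (Suc n) \<in> closed_semigroup S"
  by (induction n) (auto intro: closed_semigroup_mult)

locale homogeneous_gauge =
  fixes h :: "real^'d::finite \<Rightarrow> real" and s :: real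
  assumes s_pos: "0 < s"
    and h_cont: "continuous_on UNIV h"
    and h_scale: "\<And>c x. h (c *\<^sub>R x) = \<bar>c\<bar> powr s * h x"
    and h_pos: "\<And>x. x \<noteq> 0 \<Longrightarrow> 0 < h x"
begin

lemma h_0 [simp]: "h 0 = 0"
  using h_scale[of 0 0] by simp

text \<open>The minimum of h on the sphere works everywhere by homogeneity; bounds on h thereby
  bound the norm.\<close>

lemma lower_bound: "\<exists>c>0. \<forall>x. c * norm x powr s \<le> h x"
proof -
  have "compact (sphere (0 :: real^'d) 1)" "sphere (0 :: real^'d) 1 \<noteq> {}" by auto
  then obtain y where y: "y \<in> sphere 0 1" "\<And>x. x \<in> sphere 0 1 \<Longrightarrow> h y \<le> h x"
    using continuous_attains_inf[of "sphere 0 1" h] h_cont continuous_on_subset by blast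
  have "h y * norm x powr s \<le> h x" for x
  proof (cases "x = 0")
    case False
    have "h x = h (norm x *\<^sub>R (x /\<^sub>R norm x))" using False by simp
    also have "\<dots> = norm x powr s * h (x /\<^sub>R norm x)" by (subst h_scale) simp
    finally have "h x = norm x powr s * h (x /\<^sub>R norm x)" .
    moreover have "h y \<le> h (x /\<^sub>R norm x)" using False by (intro y(2)) simp
    ultimately show ?thesis using mult_left_mono[of "h y" "h (x /\<^sub>R norm x)" "norm x powr s"]
      by (simp add: mult.commute)
  qed simp
  moreover have "h y > 0" using y(1) by (intro h_pos) auto
  ultimately show ?thesis by blast
qed

lemma orbit_level:
  assumes "\<And>g. g \<in> semigroup_gen S \<Longrightarrow> h (g *v x) = h x" and "g \<in> closed_semigroup S"
  shows "h (g *v x) = h x"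
proof (rule closed_semigroup_closed_property[OF _ assms(1) assms(2)])
  show "closed {g. h (g *v x) = h x}"
    by (intro closed_Collect_eq continuous_on_const
          continuous_on_compose2[OF h_cont matrix_apply_continuous])
       auto
qed auto

end

text \<open>Along the orbit the semigroup is bounded, so powers of a proximal element accumulate at a
  rank one matrix; its linear form takes only two values on the orbit, which spans. Hence the
  translates of this form by the semigroup are finitely many, and their kernels are a finite
  invariant family of hyperplanes.\<close>

lemma (in homogeneous_gauge) no_orbit_level_of_cond_ip:
  assumes d: "CARD('d) > 1" and ip: "cond_ip (closed_semigroup S)"
    and x: "x \<noteq> 0" and lev: "\<And>g. g \<in> semigroup_gen S \<Longrightarrow> h (g *v x) = h x"
  shows False
proof -
  define T where "T = closed_semigroup S"
  have Tinv: "\<And>g. g \<in> T \<Longrightarrow> invertible g"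
    by (auto simp: T_def intro: invertible_closed_semigroup)
  have Tmult: "\<And>g m. g \<in> T \<Longrightarrow> m \<in> T \<Longrightarrow> g ** m \<in> T"
    unfolding T_def by (rule closed_semigroup_mult)
  have irr: "irreducible_action T" using ip Tinv by (intro cond_ip_irreducible_action) (auto simp: T_def)
  have hT: "h (g *v x) = h x" if "g \<in> T" for g
    using orbit_level[OF lev] that by (simp add: T_def)
  obtain c0 where c0: "c0 > 0" "\<And>z. c0 * norm z powr s \<le> h z" using lower_bound by blast
  have bdx: "norm (g *v x) \<le> (h x / c0) powr (1 / s)" if "g \<in> T" for g
  proof -
    have "norm (g *v x) powr s \<le> h x / c0"
      using c0(2)[of "g *v x"] hT[OF that] c0(1) by (simp add: field_simps)
    then have "(norm (g *v x) powr s) powr (1 / s) \<le> (h x / c0) powr (1 / s)"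
      using s_pos by (intro powr_mono2) auto
    then show ?thesis using s_pos by (simp add: powr_powr)
  qed
  \<comment> \<open>Vectors with bounded orbit form an invariant subspace; it contains
    \<open>x\<close>, so irreducibility makes it the whole space.\<close>
  define W where "W = {v. \<exists>B. \<forall>g\<in>T. norm (g *v v) \<le> B}"
  have "subspace W"
  proof (rule subspaceI)
    show "0 \<in> W" by (auto simp: W_def intro!: exI[of _ 0])
  next
    fix u v assume "u \<in> W" "v \<in> W"
    then obtain B1 B2 where B: "\<forall>g\<in>T. norm (g *v u) \<le> B1" "\<forall>g\<in>T. norm (g *v v) \<le> B2"
      by (auto simp: W_def)
    have "\<forall>g\<in>T. norm (g *v (u + v)) \<le> B1 + B2"
      using B by (auto simp: matrix_vector_right_distrib intro!: order_trans[OF norm_triangle_ineq] add_mono)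
    then show "u + v \<in> W" by (auto simp: W_def)
  next
    fix c :: real and u assume "u \<in> W"
    then obtain B where B: "\<forall>g\<in>T. norm (g *v u) \<le> B" by (auto simp: W_def)
    have "\<forall>g\<in>T. norm (g *v (c *\<^sub>R u)) \<le> \<bar>c\<bar> * B"
      using B by (auto simp: matrix_vector_mult_scaleR intro!: mult_left_mono)
    then show "c *\<^sub>R u \<in> W" by (auto simp: W_def)
  qed
  moreover have "m *v v \<in> W" if "m \<in> T" "v \<in> W" for m v
    using that Tmult by (auto simp: W_def matrix_vector_mul_assoc)
  moreover have "x \<in> W" using bdx by (auto simp: W_def)
  ultimately have WU: "W = UNIV" using irr x irreducible_actionD by blast
  then have "\<forall>j. \<exists>B. \<forall>g\<in>T. norm (g *v axis j 1) \<le> B" by (auto simp: W_def)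
  then obtain Bf where Bf: "\<And>j g. g \<in> T \<Longrightarrow> norm (g *v axis j 1) \<le> Bf j" by metis
  \<comment> \<open>The inserted 1 lets \<open>B\<close> bound the entries of the zeroth power, the
    identity, which need not lie in T.\<close>
  define B where "B = Max (insert 1 (range Bf))"
  have entry: "\<bar>g $ i $ j\<bar> \<le> B" if "g \<in> T" for g i j
  proof -
    have "\<bar>g $ i $ j\<bar> = \<bar>(g *v axis j 1) $ i\<bar>"
      by (simp add: matrix_vector_mult_basis column_def)
    also have "\<dots> \<le> norm (g *v axis j 1)" by (rule component_le_norm_cart)
    also have "\<dots> \<le> Bf j" by (rule Bf[OF that])
    also have "\<dots> \<le> B" unfolding B_def by (rule Max_ge) auto
    finally show ?thesis .
  qed
  obtain g r where g: "g \<in> T" and root: "poly (charpoly_c g) (complex_of_real r) = 0"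
    and ord: "order (complex_of_real r) (charpoly_c g) = 1"
    and dom: "\<And>z. poly (charpoly_c g) z = 0 \<Longrightarrow> z \<noteq> complex_of_real r \<Longrightarrow> cmod z < \<bar>r\<bar>"
    using ip unfolding cond_ip_def T_def by blast
  have pT: "mpow g (Suc n) \<in> T" for n using g unfolding T_def by (rule mpow_closed_semigroup)
  have pB: "\<bar>mpow g n $ i $ j\<bar> \<le> B" for n i j
  proof (cases n)
    case 0
    have "1 \<le> B" by (simp add: B_def)
    with 0 show ?thesis by (auto simp: mat_def)
  next
    case (Suc m)
    then show ?thesis using entry[OF pT[of m]] by simp
  qed
  \<comment> \<open>If the polynomial were 0, every complex number would be a root, including ones
    of modulus above |r|.\<close>
  have nz: "charpoly_c g \<noteq> 0"
  proof
    assume "charpoly_c g = 0"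
    then have "cmod (complex_of_real (\<bar>r\<bar> + 1)) < \<bar>r\<bar>" by (intro dom) (auto simp: complex_eq_iff)
    then show False by (simp only: norm_of_real)
  qed
  have lim0: "(\<lambda>n. mpow g (Suc n) $ i $ j - r * mpow g n $ i $ j) \<longlonglongrightarrow> 0" for i j
    using dominant_eigenvalue_bounded_powers[OF root dom pB] by blast
  have "bounded (range (\<lambda>n. mpow g (Suc n)))"
  proof -
    have "norm (mpow g (Suc n)) \<le> (\<Sum>i\<in>(UNIV::'d set). \<Sum>j\<in>(UNIV::'d set). B)" for n
    proof -
      have "norm (mpow g (Suc n)) \<le> (\<Sum>i\<in>UNIV. norm (mpow g (Suc n) $ i))"
        unfolding norm_vec_def[of "mpow g (Suc n)"] by (rule L2_set_le_sum) simp
      also have "\<dots> \<le> (\<Sum>i\<in>UNIV. \<Sum>j\<in>UNIV. \<bar>mpow g (Suc n) $ i $ j\<bar>)"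
        by (intro sum_mono norm_le_l1_cart)
      also have "\<dots> \<le> (\<Sum>i\<in>(UNIV::'d set). \<Sum>j\<in>(UNIV::'d set). B)" by (intro sum_mono pB)
      finally show ?thesis .
    qed
    then show ?thesis by (auto simp: bounded_iff)
  qed
  then obtain k \<phi> where \<phi>: "strict_mono (\<phi> :: nat \<Rightarrow> nat)" and k: "((\<lambda>n. mpow g (Suc n)) \<circ> \<phi>) \<longlonglongrightarrow> k"
    using bounded_imp_convergent_subsequence by blast
  have k': "(\<lambda>n. mpow g (Suc (\<phi> n))) \<longlonglongrightarrow> k" using k by (simp only: comp_def)
  \<comment> \<open>The limit is taken with g on the right, so the rows of k are left eigenvectors
    for r.\<close>
  have kg: "k ** g = r *\<^sub>R k"
  proof -
    have "(k ** g) $ i $ j = r * k $ i $ j" for i j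
    proof -
      have "(\<lambda>n. (mpow g (Suc (\<phi> n)) ** g) $ i $ j - r * mpow g (Suc (\<phi> n)) $ i $ j)
          \<longlonglongrightarrow> (k ** g) $ i $ j - r * k $ i $ j"
        unfolding matrix_matrix_mult_def by (simp del: mpow.simps, intro tendsto_intros k')
      moreover have "(\<lambda>n. (mpow g (Suc (\<phi> n)) ** g) $ i $ j - r * mpow g (Suc (\<phi> n)) $ i $ j) \<longlonglongrightarrow> 0"
        using LIMSEQ_subseq_LIMSEQ[OF LIMSEQ_Suc[OF lim0[of i j]] \<phi>]
        unfolding comp_def mpow_Suc2[of g "Suc _"] .
      ultimately have "(k ** g) $ i $ j - r * k $ i $ j = 0" by (rule LIMSEQ_unique)
      then show ?thesis by simp
    qed
    then show ?thesis by (simp add: vec_eq_iff)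
  qed
  have row: "(k $ i) v* g = r *\<^sub>R (k $ i)" for i
    using arg_cong[OF kg, of "\<lambda>A. A $ i"]
    by (simp add: vec_eq_iff matrix_matrix_mult_def vector_matrix_mult_def mult.commute)
  \<comment> \<open>Every power of g keeps the orbit point on its level of h, and continuity passes
    this to the limit k, which therefore cannot vanish.\<close>
  have hk: "h (k *v (m *v x)) = h x" if "m \<in> T" for m
  proof -
    have "continuous_on UNIV (\<lambda>A. h (A *v (m *v x)))"
      by (intro continuous_on_compose2[OF h_cont matrix_apply_continuous]) auto
    then have "isCont (\<lambda>A. h (A *v (m *v x))) k" by (simp add: continuous_on_eq_continuous_at)
    from isCont_tendsto_compose[OF this k']
    have "(\<lambda>n. h (mpow g (Suc (\<phi> n)) *v (m *v x))) \<longlonglongrightarrow> h (k *v (m *v x))" .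
    moreover have "h (mpow g (Suc (\<phi> n)) *v (m *v x)) = h x" for n
      unfolding matrix_vector_mul_assoc by (intro hT Tmult pT that)
    ultimately have "(\<lambda>n::nat. h x) \<longlonglongrightarrow> h (k *v (m *v x))" by (simp only:)
    then show ?thesis by (simp add: LIMSEQ_const_iff)
  qed
  have "k *v (g *v x) \<noteq> 0" using hk[OF g] h_pos[OF x] by auto
  then obtain i0 j0 where ij0: "k $ i0 $ j0 \<noteq> 0"
    by (metis matrix_vector_mult_0 vec_eq_iff zero_index)
  define l where "l = k $ i0"
  \<comment> \<open>Simplicity of r makes all rows of k proportional to \<open>l\<close>;
    \<open>c\<close> collects the factors, read off in column \<open>j0\<close>.\<close>
  define c where "c = (\<chi> i. k $ i $ j0 / l $ j0)"
  have kv: "k *v v = (l \<bullet> v) *\<^sub>R c" for v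
  proof -
    have "k $ i $ j = c $ i * l $ j" for i j
      using simple_eigenvalue_minor[OF ord nz row[of i] row[of i0], of j j0] ij0
      by (simp add: c_def l_def field_simps)
    then show ?thesis
      by (simp add: vec_eq_iff matrix_vector_mult_def inner_vec_def sum_distrib_right sum_distrib_left mult_ac)
  qed
  have "c \<noteq> 0" using \<open>k *v (g *v x) \<noteq> 0\<close> kv by auto
  \<comment> \<open>From h x = h (k m x) = |l . m x|^s h c, solved for the absolute value.\<close>
  define a where "a = (h x / h c) powr (1 / s)"
  have a: "a > 0" using h_pos[OF x] h_pos[OF \<open>c \<noteq> 0\<close>] by (simp add: a_def)
  have la: "\<bar>l \<bullet> (m *v x)\<bar> = a" if "m \<in> T" for m
  proof -
    have "\<bar>l \<bullet> (m *v x)\<bar> powr s = h x / h c"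
      using hk[OF that] h_pos[OF \<open>c \<noteq> 0\<close>] by (simp add: kv h_scale field_simps)
    then have "(\<bar>l \<bullet> (m *v x)\<bar> powr s) powr (1 / s) = a" by (simp add: a_def)
    then show ?thesis using s_pos by (simp add: powr_powr)
  qed
  define Orb where "Orb = (\<lambda>m. m *v x) ` T"
  have "span Orb = UNIV"
  proof (rule irreducible_actionD[OF irr subspace_span])
    fix m v assume m: "m \<in> T" and "v \<in> span Orb"
    then have "m *v v \<in> (*v) m ` span Orb" by blast
    also have "\<dots> = span ((*v) m ` Orb)" by (simp add: linear_span_image)
    also have "\<dots> \<subseteq> span Orb"
      using Tmult[OF m] by (intro span_mono) (auto simp: Orb_def matrix_vector_mul_assoc)
    finally show "m *v v \<in> span Orb" .
  next
    show "g *v x \<in> span Orb" using g by (auto simp: Orb_def intro: span_base)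
    show "g *v x \<noteq> 0" using invertible_inj[OF Tinv[OF g]] x by blast
  qed
  obtain Bs where Bs: "Bs \<subseteq> Orb" "independent Bs" "Orb \<subseteq> span Bs"
    using maximal_independent_subset[of Orb] by blast
  have "span Bs = UNIV" using Bs \<open>span Orb = UNIV\<close> by (metis span_minimal subspace_span top.extremum_uniqueI)
  have "finite Bs" using independent_bound[OF Bs(2)] by blast
  define LL where "LL = (\<lambda>m. l v* m) ` T"
  have LLdot: "(l v* m) \<bullet> v = l \<bullet> (m *v v)" for m v by (rule dot_lmul_matrix)
  have LLa: "\<bar>L \<bullet> y\<bar> = a" if "L \<in> LL" "y \<in> Orb" for L y
    using that Tmult by (auto simp: LL_def Orb_def LLdot matrix_vector_mul_assoc intro!: la)
  \<comment> \<open>A form in \<open>LL\<close> is determined by its values on the basis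
    \<open>Bs\<close>, which consists of orbit points, and each such value is a or -a.\<close>
  have "finite LL"
  proof (rule inj_on_finite)
    show "inj_on (\<lambda>L. restrict (\<lambda>y. L \<bullet> y) Bs) LL"
    proof (rule inj_onI)
      fix L L' assume "restrict (\<lambda>y. L \<bullet> y) Bs = restrict (\<lambda>y. L' \<bullet> y) Bs"
      then have "(L - L') \<bullet> y = 0" if "y \<in> Bs" for y
        using that by (auto simp: inner_diff_left restrict_def fun_eq_iff split: if_splits)
      then have "Bs \<subseteq> {v. (L - L') \<bullet> v = 0}" by auto
      then have "span Bs \<subseteq> {v. (L - L') \<bullet> v = 0}" by (intro span_minimal subspace_hyperplane)
      then have "(L - L') \<bullet> (L - L') = 0" using \<open>span Bs = UNIV\<close> by blast
      then show "L = L'" by simp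
    qed
    show "(\<lambda>L. restrict (\<lambda>y. L \<bullet> y) Bs) ` LL \<subseteq> Bs \<rightarrow>\<^sub>E {a, -a}"
      using LLa Bs(1) by (fastforce simp: PiE_iff)
    show "finite (Bs \<rightarrow>\<^sub>E {a, -a})" using \<open>finite Bs\<close> by (intro finite_PiE) auto
  qed
  define F where "F = (\<lambda>L. {v. L \<bullet> v = 0}) ` LL"
  have "finite F" using \<open>finite LL\<close> by (simp add: F_def)
  moreover have "F \<noteq> {}" using g by (auto simp: F_def LL_def)
  moreover have "subspace W \<and> W \<noteq> {0} \<and> W \<noteq> UNIV" if WF: "W \<in> F" for W
  proof -
    obtain L where L: "L \<in> LL" "W = {v. L \<bullet> v = 0}" using WF unfolding F_def by blast
    have "\<bar>L \<bullet> (g *v x)\<bar> = a" using L(1) g by (intro LLa) (auto simp: Orb_def)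
    then have "L \<noteq> 0" "g *v x \<notin> W" using a L(2) by auto
    have "dim W = DIM(real^'d) - 1" unfolding L(2) by (rule dim_hyperplane[OF \<open>L \<noteq> 0\<close>])
    \<comment> \<open>The only place where d > 1 enters: hyperplanes must be nonzero
      subspaces.\<close>
    then have "dim W \<noteq> 0" using d by simp
    then have "W \<noteq> {0}" by auto
    then show ?thesis using \<open>g *v x \<notin> W\<close> L(2) subspace_hyperplane by auto
  qed
  moreover have "(\<lambda>v. m *v v) ` W \<in> F" if m: "m \<in> T" and W: "W \<in> F" for m W
  proof -
    let ?pre = "\<lambda>W. (\<lambda>v. m *v v) -` W"
    have surj: "surj ((*v) m)"
      using Tinv[OF m] by (simp add: invertible_right_inverse matrix_right_invertible_surjective)
    \<comment> \<open>Composing a form with m gives preimages of hyperplanes, not images. Taking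
      preimages is injective on the finite set F, hence a bijection of F, so images stay in F as
      well.\<close>
    have "?pre ` F \<subseteq> F"
    proof
      fix U assume "U \<in> ?pre ` F"
      then obtain m' where m': "m' \<in> T" "U = ?pre {v. (l v* m') \<bullet> v = 0}"
        by (auto simp: F_def LL_def)
      have "U = {v. (l v* (m' ** m)) \<bullet> v = 0}"
        unfolding m'(2) LLdot by (simp add: vimage_def matrix_vector_mul_assoc)
      then show "U \<in> F" using Tmult[OF m'(1) m] by (auto simp: F_def LL_def)
    qed
    moreover have "inj_on ?pre F"
      by (intro inj_onI) (metis surj surj_image_vimage_eq)
    ultimately have "?pre ` F = F" using \<open>finite F\<close> by (simp add: endo_inj_surj)
    then obtain U where "U \<in> F" "W = ?pre U" using W by blast
    then show ?thesis using surj by (simp add: surj_image_vimage_eq)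
  qed
  ultimately have "\<exists>F. finite F \<and> F \<noteq> {} \<and> (\<forall>W\<in>F. subspace W \<and> W \<noteq> {0} \<and> W \<noteq> UNIV) \<and>
      (\<forall>g\<in>T. \<forall>W\<in>F. (\<lambda>v. g *v v) ` W \<in> F)"
    by (intro exI[of _ F] conjI ballI) auto
  then show False using ip[unfolded cond_ip_def, THEN conjunct1] unfolding T_def by (rule notE[rotated])
qed

text \<open>In dimension one g is a scalar a, and h (a x) = |a|^s h x leaves only |a| = 1.\<close>

lemma (in homogeneous_gauge) opnorm_eq_1_of_orbit_level:
  assumes d: "CARD('d) = 1" and x: "x \<noteq> 0"
    and lev: "\<And>g. g \<in> semigroup_gen S \<Longrightarrow> h (g *v x) = h x" and g: "g \<in> closed_semigroup S"
  shows "opnorm g = 1"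
proof -
  obtain i0 :: 'd where "UNIV = {i0}" using d by (auto simp: card_1_singleton_iff)
  then have U: "\<And>i::'d. i = i0" by blast
  have x0: "x $ i0 \<noteq> 0" using x U by (auto simp: vec_eq_iff) (use U in metis)
  define a where "a = g $ i0 $ i0"
  have "(g *v v) $ i = (a *\<^sub>R v) $ i" for v i
    unfolding U[of i] by (simp add: matrix_vector_mult_def a_def \<open>UNIV = {i0}\<close>)
  then have gv: "g *v v = a *\<^sub>R v" for v by (simp add: vec_eq_iff)
  have "\<bar>a\<bar> powr s = 1"
    using orbit_level[OF lev g] h_pos[OF x] by (simp add: gv h_scale)
  then have "(\<bar>a\<bar> powr s) powr (1 / s) = 1" by simp
  then have "\<bar>a\<bar> = 1" using s_pos by (simp add: powr_powr)
  then show ?thesis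
    unfolding opnorm_def gv using onorm_scaleR[OF bounded_linear_ident[where 'a = "real^'d"], of a]
    by (simp add: onorm_id)
qed

subsection \<open>Random products and the affine chain\<close>

lemma measurable_matrix_mult [measurable (raw)]:
  fixes f g :: "'a \<Rightarrow> real^'d^'d"
  assumes [measurable]: "f \<in> borel_measurable M" "g \<in> borel_measurable M"
  shows "(\<lambda>x. f x ** g x) \<in> borel_measurable M"
  by (rule borel_measurable_continuous_Pair[OF assms])
     (intro matrix_mult_continuous continuous_intros)

lemma measurable_matrix_vector_mult [measurable (raw)]:
  fixes f :: "'a \<Rightarrow> real^'d^'d"
  assumes [measurable]: "f \<in> borel_measurable M" "g \<in> borel_measurable M"
  shows "(\<lambda>x. f x *v g x) \<in> borel_measurable M"
  by (rule borel_measurable_continuous_Pair[OF assms])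
     (intro matrix_vector_mult_continuous continuous_intros)

text \<open>After division by a + b both terms lie in [0,1], where x \<le> x^s.\<close>

lemma powr_add_le:
  fixes a b s :: real
  assumes "0 \<le> a" "0 \<le> b" "0 < s" "s \<le> 1"
  shows "(a + b) powr s \<le> a powr s + b powr s"
proof (cases "a + b = 0")
  case True
  then show ?thesis using assms by simp
next
  case False
  define c where "c = a + b"
  have c: "c > 0" using False assms by (simp add: c_def)
  have *: "x \<le> x powr s" if "0 \<le> x" "x \<le> 1" for x :: real
    using powr_mono'[of s 1 x] that assms by simp
  have "1 = a / c + b / c" using c by (simp add: c_def add_divide_distrib[symmetric])
  also have "\<dots> \<le> (a / c) powr s + (b / c) powr s"
    using assms c by (intro add_mono *) (auto simp: c_def)
  also have "\<dots> = (a powr s + b powr s) / c powr s"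
    using assms c by (simp add: powr_divide add_divide_distrib)
  finally show ?thesis using c by (simp add: field_simps c_def)
qed

lemma powr_sum_le:
  fixes a :: "'i \<Rightarrow> real"
  assumes "finite A" "\<And>i. i \<in> A \<Longrightarrow> 0 \<le> a i" "0 < s" "s \<le> 1"
  shows "(\<Sum>i\<in>A. a i) powr s \<le> (\<Sum>i\<in>A. a i powr s)"
  using assms(1,2)
proof (induction A rule: finite_induct)
  case (insert i A)
  have "(\<Sum>i\<in>insert i A. a i) powr s \<le> a i powr s + (\<Sum>i\<in>A. a i) powr s"
    using insert assms(3,4) by (simp add: powr_add_le sum_nonneg)
  then show ?case using insert by fastforce
qed simp

text \<open>Chains driven by the same steps differ only by the linear product; all coupling
  estimates below rest on this.\<close>

lemma chain_diff: "chain x \<omega> n = chain y \<omega> n + Sprod \<omega> n *v (x - y)"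
  by (induction n) (simp_all add: matrix_vector_mul_assoc[symmetric] matrix_vector_right_distrib
      matrix_vector_mult_diff_distrib)

text \<open>The recursion adds the latest factor on the left; exposing the first step of the stream
  adds a factor on the right.\<close>

lemma Sprod_Stream: "Sprod (h ## \<omega>) (Suc n) = Sprod \<omega> n ** fst h"
  by (induction n) (simp_all add: matrix_mul_assoc)

lemma chain_Stream: "chain x (h ## \<omega>) (Suc n) = chain (fst h *v x + snd h) \<omega> n"
  by (induction n) simp_all

locale affine_walk = prob_space lam for lam :: "('d::finite) aff measure" +
  assumes sets_lam [measurable_cong]: "sets lam = sets borel"
begin

abbreviation paths ("\<Omega>") where "\<Omega> \<equiv> stream_space lam"

sublocale paths: prob_space \<Omega>
  by (rule prob_space_stream_space)

sublocale step_path: pair_prob_space lam \<Omega> ..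

sublocale path_path: pair_prob_space \<Omega> \<Omega> ..

lemma space_lam [simp]: "space lam = UNIV"
  using sets_eq_imp_space_eq[OF sets_lam] by simp

lemma space_paths [simp]: "space \<Omega> = UNIV"
  by (simp add: space_stream_space)

lemma emeasure_paths_UNIV [simp]: "emeasure \<Omega> UNIV = 1"
  using paths.emeasure_space_1 by simp

lemma prob_paths_UNIV [simp]: "measure \<Omega> UNIV = 1"
  using paths.prob_space by simp

lemma measurable_linear_part [measurable]: "fst \<in> borel_measurable lam"
  using borel_measurable_continuous_onI[OF continuous_on_fst[OF continuous_on_id]]
  by (simp add: measurable_cong_sets[OF sets_lam refl])

lemma measurable_translation_part [measurable]: "snd \<in> borel_measurable lam"
  using borel_measurable_continuous_onI[OF continuous_on_snd[OF continuous_on_id]]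
  by (simp add: measurable_cong_sets[OF sets_lam refl])

lemma measurable_Sprod [measurable (raw)]:
  assumes [measurable]: "g \<in> measurable N \<Omega>"
  shows "(\<lambda>z. Sprod (g z) n) \<in> borel_measurable N"
  by (induction n) simp_all

lemma measurable_chain [measurable (raw)]:
  assumes [measurable]: "g \<in> measurable N \<Omega>" "f \<in> borel_measurable N"
  shows "(\<lambda>z. chain (f z) (g z) n) \<in> borel_measurable N"
  by (induction n) simp_all

text \<open>A path is a first step followed by an independent path. Stated as an identity of
  measures, this also serves Bochner integrals.\<close>

lemma paths_eq_distr: "\<Omega> = distr (lam \<Otimes>\<^sub>M \<Omega>) \<Omega> (\<lambda>(h, \<omega>). h ## \<omega>)"
proof (rule measure_eqI)
  fix A assume A: "A \<in> sets \<Omega>"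
  have "emeasure \<Omega> A = (\<integral>\<^sup>+\<omega>. indicator A \<omega> \<partial>\<Omega>)" using A by simp
  also have "\<dots> = (\<integral>\<^sup>+h. \<integral>\<^sup>+\<omega>. indicator A (h ## \<omega>) \<partial>\<Omega> \<partial>lam)"
    using A by (intro nn_integral_stream_space) simp
  also have "\<dots> = (\<integral>\<^sup>+z. indicator A (fst z ## snd z) \<partial>(lam \<Otimes>\<^sub>M \<Omega>))"
    using A by (subst paths.nn_integral_fst[symmetric]) (auto intro!: borel_measurable_indicator')
  also have "\<dots> = (\<integral>\<^sup>+\<omega>. indicator A \<omega> \<partial>distr (lam \<Otimes>\<^sub>M \<Omega>) \<Omega> (\<lambda>(h, \<omega>). h ## \<omega>))"
    using A by (subst nn_integral_distr) (auto simp: case_prod_beta)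
  also have "\<dots> = emeasure (distr (lam \<Otimes>\<^sub>M \<Omega>) \<Omega> (\<lambda>(h, \<omega>). h ## \<omega>)) A" using A by simp
  finally show "emeasure \<Omega> A = emeasure (distr (lam \<Otimes>\<^sub>M \<Omega>) \<Omega> (\<lambda>(h, \<omega>). h ## \<omega>)) A" .
qed simp

lemma integral_paths:
  fixes F :: "('d aff) stream \<Rightarrow> 'b::{banach, second_countable_topology}"
  assumes F: "integrable \<Omega> F"
  shows "(\<integral>\<omega>. F \<omega> \<partial>\<Omega>) = (\<integral>h. \<integral>\<omega>. F (h ## \<omega>) \<partial>\<Omega> \<partial>lam)"
    and "integrable lam (\<lambda>h. \<integral>\<omega>. F (h ## \<omega>) \<partial>\<Omega>)"
proof -
  have [measurable]: "F \<in> borel_measurable \<Omega>" using F by simp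
  have "integrable (distr (lam \<Otimes>\<^sub>M \<Omega>) \<Omega> (\<lambda>(h, \<omega>). h ## \<omega>)) F"
    using F by (subst paths_eq_distr[symmetric])
  then have int: "integrable (lam \<Otimes>\<^sub>M \<Omega>) (\<lambda>(h, \<omega>). F (h ## \<omega>))"
    by (subst (asm) integrable_distr_eq) (auto simp: case_prod_beta')
  have "(\<integral>\<omega>. F \<omega> \<partial>\<Omega>) = (\<integral>\<omega>. F \<omega> \<partial>distr (lam \<Otimes>\<^sub>M \<Omega>) \<Omega> (\<lambda>(h, \<omega>). h ## \<omega>))"
    by (subst paths_eq_distr) simp
  also have "\<dots> = (\<integral>(h, \<omega>). F (h ## \<omega>) \<partial>(lam \<Otimes>\<^sub>M \<Omega>))"
    by (subst integral_distr) (auto simp: case_prod_beta')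
  also have "\<dots> = (\<integral>h. \<integral>\<omega>. F (h ## \<omega>) \<partial>\<Omega> \<partial>lam)"
    using int by (intro step_path.integral_fst[symmetric]) simp
  finally show "(\<integral>\<omega>. F \<omega> \<partial>\<Omega>) = (\<integral>h. \<integral>\<omega>. F (h ## \<omega>) \<partial>\<Omega> \<partial>lam)" .
  show "integrable lam (\<lambda>h. \<integral>\<omega>. F (h ## \<omega>) \<partial>\<Omega>)"
    using step_path.integrable_fst[OF int] .
qed

text \<open>The last n factors are independent of the first m. F is generalised in the induction
  because right multiplication by the first step is absorbed into it.\<close>

lemma nn_integral_Sprod_add:
  assumes "F \<in> borel_measurable borel"
  shows "(\<integral>\<^sup>+\<omega>. F (Sprod \<omega> (n + m)) \<partial>\<Omega>) = (\<integral>\<^sup>+\<omega>. \<integral>\<^sup>+\<omega>'. F (Sprod \<omega>' n ** Sprod \<omega> m) \<partial>\<Omega> \<partial>\<Omega>)"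
  using assms
proof (induction m arbitrary: F)
  case 0
  then show ?case by simp
next
  case (Suc m)
  note [measurable] = Suc.prems
  have "(\<integral>\<^sup>+\<omega>. F (Sprod \<omega> (n + Suc m)) \<partial>\<Omega>)
      = (\<integral>\<^sup>+h. \<integral>\<^sup>+\<omega>. F (Sprod (h ## \<omega>) (Suc (n + m))) \<partial>\<Omega> \<partial>lam)"
    by (subst nn_integral_stream_space) (simp_all del: Sprod.simps)
  also have "\<dots> = (\<integral>\<^sup>+h. \<integral>\<^sup>+\<omega>. \<integral>\<^sup>+\<omega>'. F ((Sprod \<omega>' n ** Sprod \<omega> m) ** fst h) \<partial>\<Omega> \<partial>\<Omega> \<partial>lam)"
    unfolding Sprod_Stream by (intro nn_integral_cong Suc.IH[of "\<lambda>A. F (A ** _)"]) simp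
  also have "\<dots> = (\<integral>\<^sup>+h. \<integral>\<^sup>+\<omega>. \<integral>\<^sup>+\<omega>'. F (Sprod \<omega>' n ** Sprod (h ## \<omega>) (Suc m)) \<partial>\<Omega> \<partial>\<Omega> \<partial>lam)"
    unfolding Sprod_Stream by (simp only: matrix_mul_assoc)
  also have "\<dots> = (\<integral>\<^sup>+\<omega>. \<integral>\<^sup>+\<omega>'. F (Sprod \<omega>' n ** Sprod \<omega> (Suc m)) \<partial>\<Omega> \<partial>\<Omega>)"
    by (subst nn_integral_stream_space) (simp_all del: Sprod.simps)
  finally show ?case .
qed

lemma nn_integral_Sprod_1:
  assumes [measurable]: "F \<in> borel_measurable borel"
  shows "(\<integral>\<^sup>+\<omega>. F (Sprod \<omega> (Suc 0)) \<partial>\<Omega>) = (\<integral>\<^sup>+h. F (fst h) \<partial>lam)"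
  by (subst nn_integral_stream_space) (simp_all add: Sprod_Stream del: Sprod.simps(2))

section \<open>Convolution powers and moments of the operator norm\<close>

lemma sets_Spow [measurable_cong]: "sets (Spow (mu_of lam) n) = sets borel"
  by (cases n) simp_all

lemma sets_mu_of [measurable_cong]: "sets (mu_of lam) = sets borel"
  by (simp add: mu_of_def)

lemma prob_space_mu_of: "prob_space (mu_of lam)"
  unfolding mu_of_def by (rule prob_space_distr) simp

lemma prob_space_Spow: "prob_space (Spow (mu_of lam) n)"
proof (induction n)
  case 0
  show ?case by (simp add: prob_space_return)
next
  case (Suc n)
  interpret mu: prob_space "mu_of lam" by (rule prob_space_mu_of)
  interpret S: prob_space "Spow (mu_of lam) n" by (rule Suc)
  interpret pair_prob_space "mu_of lam" "Spow (mu_of lam) n" ..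
  show ?case by (simp, rule prob_space_distr) (simp add: case_prod_beta')
qed

text \<open>Translates the condition k(\<alpha>) = 1, formulated with convolution powers, to
  products along paths.\<close>

lemma nn_integral_Spow:
  assumes "F \<in> borel_measurable borel"
  shows "(\<integral>\<^sup>+g. F g \<partial>Spow (mu_of lam) n) = (\<integral>\<^sup>+\<omega>. F (Sprod \<omega> n) \<partial>\<Omega>)"
  using assms
proof (induction n arbitrary: F)
  case 0
  then show ?case by (simp add: nn_integral_return)
next
  case (Suc n)
  note [measurable] = Suc.prems
  interpret S: prob_space "Spow (mu_of lam) n" by (rule prob_space_Spow)
  have "(\<integral>\<^sup>+g. F g \<partial>Spow (mu_of lam) (Suc n))
      = (\<integral>\<^sup>+z. F (fst z ** snd z) \<partial>(mu_of lam \<Otimes>\<^sub>M Spow (mu_of lam) n))"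
    by (simp, subst nn_integral_distr) (simp_all add: case_prod_beta)
  also have "\<dots> = (\<integral>\<^sup>+g. \<integral>\<^sup>+k. F (g ** k) \<partial>Spow (mu_of lam) n \<partial>mu_of lam)"
    by (subst S.nn_integral_fst[symmetric]) simp_all
  also have "\<dots> = (\<integral>\<^sup>+g. \<integral>\<^sup>+\<omega>. F (g ** Sprod \<omega> n) \<partial>\<Omega> \<partial>mu_of lam)"
    by (intro nn_integral_cong Suc.IH) simp
  also have "\<dots> = (\<integral>\<^sup>+h. \<integral>\<^sup>+\<omega>. F (fst h ** Sprod \<omega> n) \<partial>\<Omega> \<partial>lam)"
    unfolding mu_of_def by (subst nn_integral_distr) simp_all
  also have "\<dots> = (\<integral>\<^sup>+\<omega>. \<integral>\<^sup>+h. F (fst h ** Sprod \<omega> n) \<partial>lam \<partial>\<Omega>)"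
    by (rule step_path.Fubini'[symmetric]) simp
  also have "\<dots> = (\<integral>\<^sup>+\<omega>. \<integral>\<^sup>+\<omega>'. F (Sprod \<omega>' (Suc 0) ** Sprod \<omega> n) \<partial>\<Omega> \<partial>\<Omega>)"
    by (intro nn_integral_cong nn_integral_Sprod_1[symmetric]) simp
  also have "\<dots> = (\<integral>\<^sup>+\<omega>. F (Sprod \<omega> (Suc 0 + n)) \<partial>\<Omega>)"
    by (rule nn_integral_Sprod_add[symmetric]) simp
  finally show ?case by simp
qed

text \<open>Extended values, so that submultiplicativity is available before any finiteness.\<close>

definition moment :: "real \<Rightarrow> nat \<Rightarrow> ennreal" where
  "moment s n = (\<integral>\<^sup>+\<omega>. ennreal (opnorm (Sprod \<omega> n) powr s) \<partial>\<Omega>)"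

lemma moment_0 [simp]: "moment s 0 = 1"
  by (simp add: moment_def)

lemma moment_1: "moment s (Suc 0) = (\<integral>\<^sup>+h. ennreal (opnorm (fst h) powr s) \<partial>lam)"
  unfolding moment_def by (rule nn_integral_Sprod_1) simp

lemma moment_add_le:
  assumes "0 \<le> s"
  shows "moment s (n + m) \<le> moment s n * moment s m"
proof -
  have "moment s (n + m) = (\<integral>\<^sup>+\<omega>. \<integral>\<^sup>+\<omega>'. ennreal (opnorm (Sprod \<omega>' n ** Sprod \<omega> m) powr s) \<partial>\<Omega> \<partial>\<Omega>)"
    unfolding moment_def by (rule nn_integral_Sprod_add) simp
  also have "\<dots> \<le> (\<integral>\<^sup>+\<omega>. \<integral>\<^sup>+\<omega>'. ennreal (opnorm (Sprod \<omega>' n) powr s) * ennreal (opnorm (Sprod \<omega> m) powr s) \<partial>\<Omega> \<partial>\<Omega>)"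
    using assms
    by (intro nn_integral_mono)
       (auto simp: ennreal_mult[symmetric] powr_mult[symmetric] intro!: ennreal_leI powr_mono2 opnorm_mult)
  also have "\<dots> = moment s n * moment s m"
    by (simp add: nn_integral_multc nn_integral_cmult moment_def)
  finally show ?thesis .
qed

lemma moment_finite:
  assumes "0 \<le> s" "moment s (Suc 0) < \<infinity>"
  shows "moment s n < \<infinity>"
proof (induction n)
  case (Suc n)
  have "moment s (Suc n) \<le> moment s (Suc 0) * moment s n"
    using moment_add_le[OF assms(1), of "Suc 0" n] by simp
  also have "\<dots> < \<infinity>" using Suc assms(2) by (simp add: ennreal_mult_less_top)
  finally show ?case .
qed simp

text \<open>Carries finiteness and growth bounds from the exponent \<alpha> down to smaller ones,
  through x^s \<le> 1 + x^t.\<close>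

lemma moment_le_1_add:
  assumes "0 \<le> s" "s \<le> t"
  shows "moment s n \<le> 1 + moment t n"
proof -
  have "x powr s \<le> 1 + x powr t" if "0 \<le> x" for x :: real
  proof (cases "x \<le> 1")
    case True
    then have "x powr s \<le> 1" using powr_mono2[of s x 1] that assms by simp
    then show ?thesis by (smt (verit) powr_ge_zero)
  next
    case False
    then have "x powr s \<le> x powr t" using assms by (intro powr_mono) auto
    then show ?thesis by simp
  qed
  then have "moment s n \<le> (\<integral>\<^sup>+\<omega>. 1 + ennreal (opnorm (Sprod \<omega> n) powr t) \<partial>\<Omega>)"
    unfolding moment_def
    by (intro nn_integral_mono) (simp add: ennreal_1[symmetric] ennreal_plus[symmetric] del: ennreal_1 ennreal_plus)
  also have "\<dots> = 1 + moment t n"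
    by (simp add: nn_integral_add moment_def)
  finally show ?thesis .
qed

abbreviation mean_powr :: "real \<Rightarrow> nat \<Rightarrow> real" where
  "mean_powr s n \<equiv> (\<integral>\<omega>. opnorm (Sprod \<omega> n) powr s \<partial>\<Omega>)"

lemma integrable_opnorm_powr:
  assumes "moment s n < \<infinity>"
  shows "integrable \<Omega> (\<lambda>\<omega>. opnorm (Sprod \<omega> n) powr s)"
    and "ennreal (\<integral>\<omega>. opnorm (Sprod \<omega> n) powr s \<partial>\<Omega>) = moment s n"
proof -
  show *: "integrable \<Omega> (\<lambda>\<omega>. opnorm (Sprod \<omega> n) powr s)"
    using assms by (intro integrableI_nonneg) (auto simp: moment_def)
  show "ennreal (\<integral>\<omega>. opnorm (Sprod \<omega> n) powr s \<partial>\<Omega>) = moment s n"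
    unfolding moment_def by (rule nn_integral_eq_integral[symmetric]) (auto simp: *)
qed

text \<open>Upgrades an almost sure closed property of A to every matrix in the support, hence to
  the generators of T.\<close>

lemma msupp_mu_of_subset:
  assumes "closed F" "AE h in lam. fst h \<in> F"
  shows "msupp (mu_of lam) \<subseteq> F"
proof (rule ccontr)
  assume "\<not> ?thesis"
  then obtain g where g: "g \<in> msupp (mu_of lam)" "g \<notin> F" by blast
  then obtain e where e: "e > 0" "ball g e \<subseteq> - F"
    using assms(1) open_contains_ball[of "- F"] by auto
  have "emeasure (mu_of lam) (ball g e) = emeasure lam (fst -` ball g e \<inter> space lam)"
    unfolding mu_of_def by (rule emeasure_distr) simp_all
  also have "\<dots> = emeasure lam {h \<in> space lam. fst h \<in> ball g e}"
    by (rule arg_cong[where f = "emeasure lam"]) auto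
  also have "\<dots> = 0"
  proof (rule emeasure_eq_0_AE)
    show "AE h in lam. fst h \<notin> ball g e" using assms(2) by eventually_elim (use e(2) in blast)
  qed
  finally show False using g(1) e(1) by (auto simp: msupp_def)
qed

end

subsection \<open>Superharmonic gauges and contraction in mean\<close>

text \<open>Arzela-Ascoli on the unit ball; homogeneity determines the functions elsewhere, so
  pointwise convergence extends to the whole space.\<close>

lemma equi_holder_convergent_subsequence:
  fixes F :: "nat \<Rightarrow> real^'d \<Rightarrow> real"
  assumes s: "0 < s"
    and holder: "\<And>k x y. \<bar>F k x - F k y\<bar> \<le> norm (x - y) powr s"
    and scale: "\<And>k c x. F k (c *\<^sub>R x) = \<bar>c\<bar> powr s * F k x"
  obtains h \<phi> where "strict_mono (\<phi> :: nat \<Rightarrow> nat)" "\<And>x. (\<lambda>k. F (\<phi> k) x) \<longlonglongrightarrow> h x"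
proof -
  have F0: "F k 0 = 0" for k using scale[of k 0 0] by simp
  have bd: "norm (F k x) \<le> 1" if "x \<in> cball 0 1" for k x
  proof -
    have "norm (F k x) \<le> norm x powr s" using holder[of k x 0] F0 by simp
    also have "\<dots> \<le> 1" using that s powr_mono2[of s "norm x" 1] by simp
    finally show ?thesis .
  qed
  have eq: "\<exists>d. 0 < d \<and> (\<forall>n y. y \<in> cball 0 1 \<and> norm (x - y) < d \<longrightarrow> norm (F n x - F n y) < e)"
    if "0 < e" for x e
  proof (intro exI[of _ "e powr (1 / s)"] conjI allI impI)
    fix n y assume *: "y \<in> cball 0 1 \<and> norm (x - y) < e powr (1 / s)"
    have "norm (F n x - F n y) \<le> norm (x - y) powr s" using holder by simp
    also have "\<dots> < (e powr (1 / s)) powr s" using * s by (intro powr_less_mono2) auto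
    also have "\<dots> = e" using s that by (simp add: powr_powr)
    finally show "norm (F n x - F n y) < e" .
  qed (use that in simp)
  obtain g \<phi> where \<phi>: "strict_mono (\<phi> :: nat \<Rightarrow> nat)"
    and g: "\<And>e. 0 < e \<Longrightarrow> \<exists>N. \<forall>n x. n \<ge> N \<and> x \<in> cball 0 1 \<longrightarrow> norm (F (\<phi> n) x - g x) < e"
    using Arzela_Ascoli[OF compact_cball, of 0 1 F 1] bd eq by metis
  have lim: "(\<lambda>k. F (\<phi> k) x) \<longlonglongrightarrow> g x" if x: "x \<in> cball 0 1" for x
  proof (rule LIMSEQ_I)
    fix e :: real assume "0 < e"
    then show "\<exists>N. \<forall>n\<ge>N. norm (F (\<phi> n) x - g x) < e" using g[of e] x by blast
  qed
  have "(\<lambda>k. F (\<phi> k) x) \<longlonglongrightarrow> norm x powr s * g (x /\<^sub>R norm x)" for x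
  proof -
    have "F k x = norm x powr s * F k (x /\<^sub>R norm x)" for k
      using scale[of k "norm x" "x /\<^sub>R norm x"] F0 by (cases "x = 0") auto
    moreover have "x /\<^sub>R norm x \<in> cball 0 1" by (cases "x = 0") auto
    ultimately show ?thesis by (auto intro!: tendsto_mult lim)
  qed
  then show ?thesis by (rule that[OF \<phi>])
qed

lemma holder_continuous_on_norm:
  fixes f :: "'a::real_normed_vector \<Rightarrow> 'b::real_normed_vector"
  assumes s: "0 < s" and le: "\<And>x y. norm (f x - f y) \<le> C * norm (x - y) powr s"
  shows "continuous_on UNIV f"
proof (rule continuous_at_imp_continuous_on, rule ballI)
  fix x :: 'a
  have "((\<lambda>y. C * norm (y - x) powr s) \<longlongrightarrow> C * norm (x - x) powr s) (at x)"
    using s by (intro tendsto_intros tendsto_powr') auto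
  then have "((\<lambda>y. C * norm (y - x) powr s) \<longlongrightarrow> 0) (at x)" using s by simp
  then have "((\<lambda>y. f y - f x) \<longlongrightarrow> 0) (at x)"
    by (rule Lim_null_comparison[rotated]) (simp add: le)
  then show "isCont f x" by (simp add: isCont_def LIM_zero_iff)
qed

lemma holder_continuous_on:
  fixes f :: "'a::real_normed_vector \<Rightarrow> real"
  assumes "0 < s" "\<And>x y. \<bar>f x - f y\<bar> \<le> C * norm (x - y) powr s"
  shows "continuous_on UNIV f"
  by (rule holder_continuous_on_norm[OF assms(1), of _ C]) (simp add: assms(2))

text \<open>Normalising the sum over the axis vectors gives bounds that do not depend on H, which
  makes a family of such gauges equicontinuous.\<close>

lemma subadditive_gauge_bounds:
  fixes H :: "real^'d \<Rightarrow> real"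
  assumes scale: "\<And>c x. H (c *\<^sub>R x) = \<bar>c\<bar> powr s * H x" and add: "\<And>x y. H (x + y) \<le> H x + H y"
    and nonneg: "\<And>x. 0 \<le> H x" and s: "0 < s" and one: "(\<Sum>j\<in>UNIV. H (axis j 1)) = 1"
  shows "H x \<le> norm x powr s" and "\<bar>H x - H y\<bar> \<le> norm (x - y) powr s"
proof -
  have H0: "H 0 = 0" using scale[of 0 0] by simp
  have sum: "H (\<Sum>j\<in>A. f j) \<le> (\<Sum>j\<in>A. H (f j))" if "finite A" for f :: "'d \<Rightarrow> real^'d" and A
    using that by (induction A rule: finite_induct) (auto simp: H0 intro: order_trans[OF add] add_left_mono)
  show le: "H x \<le> norm x powr s" for x
  proof -
    have "H x = H (\<Sum>j\<in>UNIV. (x $ j) *\<^sub>R axis j 1)"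
      using basis_expansion[of x] by (simp add: scalar_mult_eq_scaleR)
    also have "\<dots> \<le> (\<Sum>j\<in>UNIV. \<bar>x $ j\<bar> powr s * H (axis j 1))"
      using sum[of UNIV "\<lambda>j. (x $ j) *\<^sub>R axis j 1"] by (simp add: scale)
    also have "\<dots> \<le> (\<Sum>j\<in>UNIV. norm x powr s * H (axis j 1))"
      using s by (intro sum_mono mult_right_mono powr_mono2) (auto simp: component_le_norm_cart nonneg)
    also have "\<dots> = norm x powr s" by (simp add: sum_distrib_left[symmetric] one)
    finally show ?thesis .
  qed
  have neg: "H (- z) = H z" for z using scale[of "-1" z] by simp
  have "H x \<le> H y + norm (x - y) powr s" for x y
    using add[of y "x - y"] le[of "x - y"] by simp
  from this[of x y] this[of y x] show "\<bar>H x - H y\<bar> \<le> norm (x - y) powr s"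
    by (simp add: norm_minus_commute)
qed

section \<open>Averages of homogeneous functions and their resolvents\<close>

context affine_walk
begin

text \<open>The n-th power of the operator Q of the linear action, applied to \<phi>.\<close>

definition avg :: "(real^'d \<Rightarrow> real) \<Rightarrow> nat \<Rightarrow> real^'d \<Rightarrow> real" where
  "avg \<phi> n x = (\<integral>\<omega>. \<phi> (Sprod \<omega> n *v x) \<partial>\<Omega>)"

lemma avg_0 [simp]: "avg \<phi> 0 x = \<phi> x"
  by (simp add: avg_def)

lemma norm_Sprod_powr_le:
  "0 < s \<Longrightarrow> norm (Sprod \<omega> n *v x) powr s \<le> opnorm (Sprod \<omega> n) powr s * norm x powr s"
  using powr_mono2[OF _ norm_ge_zero norm_mult_opnorm, of s] by (simp add: powr_mult)

context
  fixes s :: real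
  assumes s: "0 < s" and fin1: "moment s (Suc 0) < \<infinity>"
begin

lemma moment_finite': "moment s n < \<infinity>"
  using moment_finite[of s n] s fin1 by simp

lemma integrable_avg:
  assumes [measurable]: "\<phi> \<in> borel_measurable borel" and C: "\<And>y. \<bar>\<phi> y\<bar> \<le> C * norm y powr s"
  shows "integrable \<Omega> (\<lambda>\<omega>. \<phi> (Sprod \<omega> n *v x))"
    and "\<bar>avg \<phi> n x\<bar> \<le> \<bar>C\<bar> * mean_powr s n * norm x powr s"
proof -
  let ?g = "\<lambda>\<omega>. \<bar>C\<bar> * opnorm (Sprod \<omega> n) powr s * norm x powr s"
  have intg: "integrable \<Omega> ?g"
    by (intro integrable_mult_left integrable_mult_right integrable_opnorm_powr moment_finite')
  have bd: "norm (\<phi> (Sprod \<omega> n *v x)) \<le> ?g \<omega>" for \<omega>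
  proof -
    have "norm (\<phi> (Sprod \<omega> n *v x)) \<le> \<bar>C\<bar> * norm (Sprod \<omega> n *v x) powr s"
      using C[of "Sprod \<omega> n *v x"] by (smt (verit) mult_right_mono powr_ge_zero real_norm_def)
    also have "\<dots> \<le> \<bar>C\<bar> * (opnorm (Sprod \<omega> n) powr s * norm x powr s)"
      by (intro mult_left_mono norm_Sprod_powr_le s) auto
    finally show ?thesis by (simp add: mult.assoc)
  qed
  show int: "integrable \<Omega> (\<lambda>\<omega>. \<phi> (Sprod \<omega> n *v x))"
    by (rule Bochner_Integration.integrable_bound[OF intg]) (simp, intro AE_I2 order_trans[OF bd], simp)
  have "\<bar>avg \<phi> n x\<bar> \<le> (\<integral>\<omega>. norm (\<phi> (Sprod \<omega> n *v x)) \<partial>\<Omega>)"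
    unfolding avg_def using integral_norm_bound[of \<Omega> "\<lambda>\<omega>. \<phi> (Sprod \<omega> n *v x)"] by simp
  also have "\<dots> \<le> (\<integral>\<omega>. ?g \<omega> \<partial>\<Omega>)"
    by (intro integral_mono integrable_norm int intg bd)
  finally show "\<bar>avg \<phi> n x\<bar> \<le> \<bar>C\<bar> * mean_powr s n * norm x powr s" by simp
qed

lemma avg_Suc:
  assumes [measurable]: "\<phi> \<in> borel_measurable borel" and C: "\<And>y. \<bar>\<phi> y\<bar> \<le> C * norm y powr s"
  shows "avg \<phi> (Suc n) x = (\<integral>h. avg \<phi> n (fst h *v x) \<partial>lam)"
    and "integrable lam (\<lambda>h. avg \<phi> n (fst h *v x))"
  using integral_paths[OF integrable_avg(1)[OF assms, of "Suc n" x]]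
  unfolding avg_def Sprod_Stream matrix_vector_mul_assoc by simp_all

text \<open>H is the normalised resolvent U = sum_n t^n Q^n p of p = |x|^s. Each term is homogeneous
  and, as s \<le> 1, subadditive.\<close>

lemma resolvent_gauge:
  assumes s1: "s \<le> 1" and t: "0 < t" "t < 1"
    and summ: "summable (\<lambda>n. t ^ n * mean_powr s n)"
  obtains H :: "real^'d \<Rightarrow> real" where
    "\<And>c x. H (c *\<^sub>R x) = \<bar>c\<bar> powr s * H x" "\<And>x y. H (x + y) \<le> H x + H y"
    "\<And>x. 0 \<le> H x" "(\<Sum>j\<in>UNIV. H (axis j 1)) = 1"
    "\<And>x. (\<integral>\<^sup>+k. ennreal (H (fst k *v x)) \<partial>lam) \<le> ennreal (H x / t)"
proof -
  define p :: "real^'d \<Rightarrow> real" where "p = (\<lambda>y. norm y powr s)"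
  have pm [measurable]: "p \<in> borel_measurable borel" by (simp add: p_def)
  have pC: "\<And>y. \<bar>p y\<bar> \<le> 1 * norm y powr s" by (simp add: p_def)
  note int = integrable_avg(1)[OF pm pC]
  define b where "b = avg p"
  have b0: "0 \<le> b n x" for n x by (simp add: b_def avg_def p_def)
  have ble: "b n x \<le> mean_powr s n * norm x powr s" for n x
    using integrable_avg(2)[OF pm pC, of n x] by (simp add: b_def)
  have bscale: "b n (c *\<^sub>R x) = \<bar>c\<bar> powr s * b n x" for n c x
    by (simp add: b_def avg_def p_def matrix_vector_mult_scaleR powr_mult)
  have badd: "b n (x + y) \<le> b n x + b n y" for n x y
  proof -
    have "b n (x + y) \<le> (\<integral>\<omega>. p (Sprod \<omega> n *v x) + p (Sprod \<omega> n *v y) \<partial>\<Omega>)"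
      unfolding b_def avg_def
    proof (intro integral_mono int Bochner_Integration.integrable_add)
      fix \<omega>
      have "p (Sprod \<omega> n *v (x + y)) \<le> (norm (Sprod \<omega> n *v x) + norm (Sprod \<omega> n *v y)) powr s"
        unfolding p_def matrix_vector_right_distrib using s by (intro powr_mono2 norm_triangle_ineq) auto
      also have "\<dots> \<le> p (Sprod \<omega> n *v x) + p (Sprod \<omega> n *v y)"
        unfolding p_def by (intro powr_add_le s s1) auto
      finally show "p (Sprod \<omega> n *v (x + y)) \<le> p (Sprod \<omega> n *v x) + p (Sprod \<omega> n *v y)" .
    qed
    also have "\<dots> = b n x + b n y"
      unfolding b_def avg_def by (intro Bochner_Integration.integral_add int)
    finally show ?thesis .
  qed
  have sumU: "summable (\<lambda>n. t ^ n * b n x)" for x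
  proof (rule summable_comparison_test'[OF summable_mult2[OF summ, of "norm x powr s"], of 0])
    fix n
    have "norm (t ^ n * b n x) = t ^ n * b n x" using t b0 by simp
    also have "\<dots> \<le> t ^ n * (mean_powr s n * norm x powr s)"
      using t by (intro mult_left_mono ble) auto
    finally show "norm (t ^ n * b n x) \<le> t ^ n * mean_powr s n * norm x powr s"
      by (simp add: mult.assoc)
  qed
  define U where "U x = (\<Sum>n. t ^ n * b n x)" for x
  have U0: "0 \<le> U x" for x unfolding U_def using t b0 by (intro suminf_nonneg sumU) auto
  have Uge: "p x \<le> U x" for x
    using sum_le_suminf[OF sumU[of x], of "{0}"] t b0 by (simp add: U_def b_def)
  have Uscale: "U (c *\<^sub>R x) = \<bar>c\<bar> powr s * U x" for c x
    unfolding U_def by (subst suminf_mult[symmetric]) (auto simp: sumU bscale mult_ac)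
  have Uadd: "U (x + y) \<le> U x + U y" for x y
    unfolding U_def suminf_add[OF sumU sumU]
    using t badd by (intro suminf_le sumU summable_add) (auto simp: distrib_left[symmetric])
  \<comment> \<open>Applying Q shifts the series: Q U = (U - p) / t, which is at most U / t.\<close>
  have Usup: "(\<integral>\<^sup>+k. ennreal (U (fst k *v x)) \<partial>lam) \<le> ennreal (U x / t)" for x
  proof -
    have intb: "integrable lam (\<lambda>k. b n (fst k *v x))" for n
      using avg_Suc(2)[OF pm pC] by (simp add: b_def)
    have [measurable]: "(\<lambda>k. b n (fst k *v x)) \<in> borel_measurable lam" for n using intb by simp
    have "(\<integral>\<^sup>+k. ennreal (U (fst k *v x)) \<partial>lam) = (\<integral>\<^sup>+k. (\<Sum>n. ennreal (t ^ n * b n (fst k *v x))) \<partial>lam)"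
      unfolding U_def using t b0 by (intro nn_integral_cong suminf_ennreal2[symmetric] sumU) auto
    also have "\<dots> = (\<Sum>n. \<integral>\<^sup>+k. ennreal (t ^ n * b n (fst k *v x)) \<partial>lam)"
      by (rule nn_integral_suminf) simp
    also have "\<dots> = (\<Sum>n. ennreal (t ^ n * b (Suc n) x))"
    proof (rule suminf_cong)
      fix n
      have "(\<integral>\<^sup>+k. ennreal (t ^ n * b n (fst k *v x)) \<partial>lam) = ennreal (\<integral>k. t ^ n * b n (fst k *v x) \<partial>lam)"
        using t b0 intb by (intro nn_integral_eq_integral) auto
      then show "(\<integral>\<^sup>+k. ennreal (t ^ n * b n (fst k *v x)) \<partial>lam) = ennreal (t ^ n * b (Suc n) x)"
        using avg_Suc(1)[OF pm pC, of n x] by (simp add: b_def)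
    qed
    also have *: "(\<Sum>n. ennreal (t ^ n * b (Suc n) x)) = ennreal (\<Sum>n. t ^ n * b (Suc n) x)"
      and le: "(\<Sum>n. t ^ n * b (Suc n) x) \<le> U x / t"
    proof -
      have S: "summable (\<lambda>n. t ^ Suc n * b (Suc n) x)" using sumU[of x] by (subst summable_Suc_iff)
      have eq: "(\<lambda>n. t ^ n * b (Suc n) x) = (\<lambda>n. (1 / t) * (t ^ Suc n * b (Suc n) x))" using t by auto
      have S': "summable (\<lambda>n. t ^ n * b (Suc n) x)" unfolding eq by (rule summable_mult[OF S])
      show "(\<Sum>n. ennreal (t ^ n * b (Suc n) x)) = ennreal (\<Sum>n. t ^ n * b (Suc n) x)"
        using t b0 by (intro suminf_ennreal2 S') auto
      have "(\<Sum>n. t ^ Suc n * b (Suc n) x) = U x - b 0 x"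
        unfolding U_def using suminf_split_head[OF sumU[of x]] by simp
      then have "(\<Sum>n. t ^ n * b (Suc n) x) = (1 / t) * (U x - b 0 x)"
        unfolding eq by (subst suminf_mult[OF S]) simp
      also have "\<dots> \<le> U x / t" using t b0[of 0 x] by (simp add: field_simps)
      finally show "(\<Sum>n. t ^ n * b (Suc n) x) \<le> U x / t" .
    qed
    note *
    finally show ?thesis using le by (auto intro: order_trans ennreal_leI)
  qed
  \<comment> \<open>Positive because U dominates p, and p is 1 on the axis vectors.\<close>
  define M where "M = (\<Sum>j\<in>UNIV. U (axis j 1))"
  have M: "M > 0" unfolding M_def
  proof (rule sum_pos)
    fix j :: 'd
    show "0 < U (axis j 1)" using Uge[of "axis j 1"] by (simp add: p_def)
  qed auto
  show ?thesis
  proof (rule that[of "\<lambda>x. U x / M"])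
    fix c x y
    show "U (c *\<^sub>R x) / M = \<bar>c\<bar> powr s * (U x / M)" by (simp add: Uscale)
    show "U (x + y) / M \<le> U x / M + U y / M"
      using Uadd[of x y] M by (simp add: add_divide_distrib[symmetric] divide_right_mono)
    show "0 \<le> U x / M" using U0 M by simp
    show "(\<Sum>j\<in>UNIV. U (axis j 1) / M) = 1" using M by (simp add: sum_divide_distrib[symmetric] M_def)
    have cont: "continuous_on UNIV U"
    proof -
      have "\<bar>U x / M - U y / M\<bar> \<le> norm (x - y) powr s" for x y :: "real^'d"
        by (rule subadditive_gauge_bounds(2)[where H = "\<lambda>x. U x / M"])
           (use Uscale Uadd U0 M s in \<open>auto simp: add_divide_distrib[symmetric] divide_right_mono sum_divide_distrib[symmetric] M_def[symmetric]\<close>)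
      then have le: "\<bar>U x - U y\<bar> \<le> M * norm (x - y) powr s" for x y :: "real^'d"
        using M by (simp add: diff_divide_distrib[symmetric] abs_div field_simps)
      show ?thesis by (rule holder_continuous_on[OF s le])
    qed
    then have [measurable]: "U \<in> borel_measurable borel" by (rule borel_measurable_continuous_onI)
    have "(\<integral>\<^sup>+k. ennreal (U (fst k *v x) / M) \<partial>lam) = (\<integral>\<^sup>+k. ennreal (1 / M) * ennreal (U (fst k *v x)) \<partial>lam)"
      using M U0 by (intro nn_integral_cong) (simp add: ennreal_mult[symmetric])
    also have "\<dots> = ennreal (1 / M) * (\<integral>\<^sup>+k. ennreal (U (fst k *v x)) \<partial>lam)"
      by (rule nn_integral_cmult) simp
    also have "\<dots> \<le> ennreal (1 / M) * ennreal (U x / t)" by (intro mult_left_mono Usup) simp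
    also have "\<dots> = ennreal (U x / M / t)" using M t U0 by (simp add: ennreal_mult[symmetric])
    finally show "(\<integral>\<^sup>+k. ennreal (U (fst k *v x) / M) \<partial>lam) \<le> ennreal (U x / M / t)" .
  qed
qed

text \<open>Letting t tend to 1 in the normalised resolvents of the function |x|^s.\<close>

lemma ex_superharmonic_gauge:
  assumes s1: "s \<le> 1"
    and summ: "\<And>t. 0 < t \<Longrightarrow> t < 1 \<Longrightarrow> summable (\<lambda>n. t ^ n * mean_powr s n)"
  obtains h :: "real^'d \<Rightarrow> real" where
    "\<And>c x. h (c *\<^sub>R x) = \<bar>c\<bar> powr s * h x" "\<And>x y. h (x + y) \<le> h x + h y"
    "\<And>x. 0 \<le> h x" "(\<Sum>j\<in>UNIV. h (axis j 1)) = 1"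
    "\<And>x. (\<integral>\<^sup>+k. ennreal (h (fst k *v x)) \<partial>lam) \<le> ennreal (h x)"
proof -
  \<comment> \<open>A sequence in (0,1) with limit 1; the offset 2 keeps it positive at k =
    0.\<close>
  define t where "t k = 1 - 1 / (real k + 2)" for k
  have t: "0 < t k" "t k < 1" for k by (auto simp: t_def field_simps)
  have "\<exists>H. (\<forall>c x. H (c *\<^sub>R x) = \<bar>c\<bar> powr s * H x) \<and> (\<forall>x y. H (x + y) \<le> H x + H y) \<and>
    (\<forall>x. 0 \<le> H x) \<and> (\<Sum>j\<in>UNIV. H (axis j 1)) = 1 \<and>
    (\<forall>x::real^'d. (\<integral>\<^sup>+l. ennreal (H (fst l *v x)) \<partial>lam) \<le> ennreal (H x / t k))" for k
    by (rule resolvent_gauge[OF s1 t(1)[of k] t(2)[of k] summ[OF t(1)[of k] t(2)[of k]]]) blast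
  then obtain H where scale: "\<And>k c x. H k (c *\<^sub>R x) = \<bar>c\<bar> powr s * H k x"
    and add: "\<And>k x y. H k (x + y) \<le> H k x + H k y"
    and nonneg: "\<And>k x. 0 \<le> H k x" and one: "\<And>k. (\<Sum>j\<in>UNIV. H k (axis j 1)) = 1"
    and sup: "\<And>k x::real^'d. (\<integral>\<^sup>+l. ennreal (H k (fst l *v x)) \<partial>lam) \<le> ennreal (H k x / t k)"
    by metis
  have holder: "\<bar>H k x - H k y\<bar> \<le> norm (x - y) powr s" for k and x y :: "real^'d"
    by (rule subadditive_gauge_bounds(2)[of "H k", OF scale add nonneg s one])
  obtain h \<phi> where \<phi>: "strict_mono (\<phi> :: nat \<Rightarrow> nat)" and lim: "\<And>x. (\<lambda>k. H (\<phi> k) x) \<longlonglongrightarrow> h x"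
    by (rule equi_holder_convergent_subsequence[where F = H, OF s holder scale]) (rule that)
  have "continuous_on UNIV (H k)" for k
    by (rule holder_continuous_on[OF s, of _ 1]) (simp add: holder)
  then have [measurable]: "H k \<in> borel_measurable borel" for k by (rule borel_measurable_continuous_onI)
  show ?thesis
  proof (rule that[of h])
    fix c x y
    show "h (c *\<^sub>R x) = \<bar>c\<bar> powr s * h x"
      by (rule LIMSEQ_unique[OF lim[of "c *\<^sub>R x"]]) (simp add: scale, intro tendsto_intros lim)
    show "h (x + y) \<le> h x + h y"
      by (rule LIMSEQ_le[OF lim tendsto_add[OF lim lim]]) (use add in auto)
    show "0 \<le> h x" by (rule LIMSEQ_le_const[OF lim]) (use nonneg in auto)
    have "(\<lambda>k. \<Sum>j\<in>UNIV. H (\<phi> k) (axis j 1)) \<longlonglongrightarrow> (\<Sum>j\<in>UNIV. h (axis j 1))" by (intro tendsto_intros lim)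
    then show "(\<Sum>j\<in>UNIV. h (axis j 1)) = 1" by (simp add: one LIMSEQ_const_iff)
    \<comment> \<open>Fatou's lemma: only the inequality has to survive the limit.\<close>
    have "(\<integral>\<^sup>+l. ennreal (h (fst l *v x)) \<partial>lam) = (\<integral>\<^sup>+l. liminf (\<lambda>k. ennreal (H (\<phi> k) (fst l *v x))) \<partial>lam)"
      by (intro nn_integral_cong lim_imp_Liminf[symmetric] tendsto_ennrealI lim) simp
    also have "\<dots> \<le> liminf (\<lambda>k. \<integral>\<^sup>+l. ennreal (H (\<phi> k) (fst l *v x)) \<partial>lam)"
      by (rule nn_integral_liminf) simp
    also have "\<dots> \<le> liminf (\<lambda>k. ennreal (H (\<phi> k) x / t (\<phi> k)))"
      by (intro Liminf_mono always_eventually allI sup)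
    also have "\<dots> = ennreal (h x / 1)"
    proof (intro lim_imp_Liminf tendsto_ennrealI tendsto_divide lim)
      have "t \<longlonglongrightarrow> 1 - 0" unfolding t_def
        using LIMSEQ_ignore_initial_segment[OF lim_1_over_n, of 2]
        by (intro tendsto_diff tendsto_const) (simp add: add.commute)
      then show "(\<lambda>k. t (\<phi> k)) \<longlonglongrightarrow> 1" using LIMSEQ_subseq_LIMSEQ[OF _ \<phi>] by (auto simp: comp_def)
    qed auto
    finally show "(\<integral>\<^sup>+l. ennreal (h (fst l *v x)) \<partial>lam) \<le> ennreal (h x)" by simp
  qed
qed

end

end

lemma abs_sqrt_diff_le:
  fixes a b :: real
  assumes "0 \<le> a" "0 \<le> b"
  shows "\<bar>sqrt a - sqrt b\<bar> \<le> sqrt \<bar>a - b\<bar>"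
proof -
  have *: "sqrt x - sqrt y \<le> sqrt (x - y)" if "0 \<le> y" "y \<le> x" for x y :: real
    using sqrt_add_le_add_sqrt[of y "x - y"] that by simp
  show ?thesis
    using *[of a b] *[of b a] assms by (cases "a \<le> b") (auto simp: abs_if)
qed

lemma sqrt_powr: "0 \<le> x \<Longrightarrow> sqrt (x powr s) = x powr (s / 2)" for x :: real
  by (simp add: powr_half_sqrt[symmetric] powr_powr)

lemma opnorm_powr_le_sum:
  fixes g :: "real^'d^'d"
  assumes "0 < s" "s \<le> 1"
  shows "opnorm g powr s \<le> (\<Sum>j\<in>UNIV. norm (g *v axis j 1) powr s)"
proof -
  have "opnorm g powr s \<le> (\<Sum>j\<in>UNIV. norm (g *v axis j 1)) powr s"
    using assms by (intro powr_mono2 opnorm_le_sum) auto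
  also have "\<dots> \<le> (\<Sum>j\<in>UNIV. norm (g *v axis j 1) powr s)"
    using assms by (intro powr_sum_le) auto
  finally show ?thesis .
qed

section \<open>From superharmonic gauges to summable moments\<close>

context affine_walk
begin

abbreviation supp_inv :: "(real^'d^'d) set" where
  "supp_inv \<equiv> msupp (mu_of lam) \<inter> {g. invertible g}"

lemma Tsg_eq: "Tsg lam = closed_semigroup supp_inv"
  by (simp add: Tsg_def closed_semigroup_def)

text \<open>The zeros of a superharmonic subadditive gauge form an invariant subspace.\<close>

lemma superharmonic_gauge_pos:
  fixes h :: "real^'d \<Rightarrow> real"
  assumes scale: "\<And>c x. h (c *\<^sub>R x) = \<bar>c\<bar> powr s * h x" and add: "\<And>x y. h (x + y) \<le> h x + h y"
    and nonneg: "\<And>x. 0 \<le> h x" and s: "0 < s" and cont: "continuous_on UNIV h"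
    and nz: "h z \<noteq> 0" and irr: "irreducible_action (closed_semigroup supp_inv)"
    and sup: "\<And>x. (\<integral>\<^sup>+k. ennreal (h (fst k *v x)) \<partial>lam) \<le> ennreal (h x)" and x: "x \<noteq> 0"
  shows "0 < h x"
proof (rule ccontr)
  assume "\<not> 0 < h x"
  then have hx: "h x = 0" using nonneg[of x] by simp
  define W where "W = {x. h x = 0}"
  have [measurable]: "h \<in> borel_measurable borel" using cont by (rule borel_measurable_continuous_onI)
  have clo: "closed {g :: real^'d^'d. h (g *v w) = 0}" for w
    by (intro closed_Collect_eq continuous_on_const
          continuous_on_compose2[OF cont matrix_apply_continuous])
       auto
  have sub: "subspace W"
  proof (rule subspaceI)
    show "0 \<in> W" using scale[of 0 0] by (simp add: W_def)
  next
    fix u v assume "u \<in> W" "v \<in> W"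
    then show "u + v \<in> W" using add[of u v] nonneg[of "u + v"] by (simp add: W_def)
  qed (simp add: W_def scale)
  \<comment> \<open>If h w = 0, then E h(Aw) \<le> 0, so h(Aw) = 0 almost surely; by closedness the
    same holds on the whole support.\<close>
  have supp: "g *v w \<in> W" if "g \<in> supp_inv" "w \<in> W" for g w
  proof -
    have "(\<integral>\<^sup>+k. ennreal (h (fst k *v w)) \<partial>lam) = 0" using sup[of w] that(2) by (simp add: W_def)
    then have "AE k in lam. ennreal (h (fst k *v w)) = 0" by (subst (asm) nn_integral_0_iff_AE) auto
    then have "AE k in lam. fst k \<in> {g. h (g *v w) = 0}"
      by eventually_elim (use nonneg in \<open>auto simp: ennreal_eq_0_iff intro: antisym\<close>)
    from msupp_mu_of_subset[OF clo this] that(1) show ?thesis by (auto simp: W_def)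
  qed
  have gen: "g *v w \<in> W" if "g \<in> semigroup_gen supp_inv" "w \<in> W" for g w
    using that by (induction arbitrary: w) (auto simp: matrix_vector_mul_assoc[symmetric] intro: supp)
  have "W = UNIV"
  proof (rule irreducible_actionD[OF irr sub])
    fix g w assume g: "g \<in> closed_semigroup supp_inv" and w: "w \<in> W"
    have "h (g *v w) = 0"
      by (rule closed_semigroup_closed_property[OF clo _ g]) (use gen[OF _ w] in \<open>simp add: W_def\<close>)
    then show "g *v w \<in> W" by (simp add: W_def)
  qed (use x hx in \<open>simp_all add: W_def\<close>)
  then show False using nz by (auto simp: W_def)
qed

text \<open>The square root r of h satisfies E r(Ax) <= r(x), by the Cauchy--Schwarz inequality. Either
  some iterate contracts r uniformly on the sphere, which is excluded, or compactness yields a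
  point where all these inequalities are equalities.\<close>

lemma ex_orbit_level:
  fixes h :: "real^'d \<Rightarrow> real"
  assumes gauge: "homogeneous_gauge h s"
    and holder: "\<And>x y. \<bar>h x - h y\<bar> \<le> norm (x - y) powr s"
    and sup: "\<And>x. (\<integral>\<^sup>+k. ennreal (h (fst k *v x)) \<partial>lam) \<le> ennreal (h x)"
    and s1: "s \<le> 1" and fin1: "moment s (Suc 0) < \<infinity>" and ge: "\<And>n. 1 \<le> moment (s / 2) n"
  obtains x where "x \<noteq> 0" "\<And>g. g \<in> semigroup_gen supp_inv \<Longrightarrow> h (g *v x) = h x"
proof -
  interpret homogeneous_gauge h s by (rule gauge)
  have s: "0 < s" by (rule s_pos)
  have s2: "0 < s / 2" using s by simp
  have hnn: "0 \<le> h x" for x using h_pos[of x] by (cases "x = 0") auto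
  have [measurable]: "h \<in> borel_measurable borel" using h_cont by (rule borel_measurable_continuous_onI)
  define r where "r x = sqrt (h x)" for x
  have rr: "r x * r x = h x" for x using hnn by (simp add: r_def)
  have r0: "0 \<le> r x" for x using hnn by (simp add: r_def)
  have rpos: "0 < r x" if "x \<noteq> 0" for x using h_pos[OF that] by (simp add: r_def)
  have rm [measurable]: "r \<in> borel_measurable borel" unfolding r_def by measurable
  have rscale: "r (c *\<^sub>R x) = \<bar>c\<bar> powr (s / 2) * r x" for c x
    by (simp add: r_def h_scale real_sqrt_mult sqrt_powr)
  have rholder: "\<bar>r x - r y\<bar> \<le> 1 * norm (x - y) powr (s / 2)" for x y
  proof -
    have "\<bar>r x - r y\<bar> \<le> sqrt \<bar>h x - h y\<bar>" unfolding r_def by (rule abs_sqrt_diff_le) (rule hnn)+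
    also have "\<dots> \<le> sqrt (norm (x - y) powr s)" using holder by simp
    finally show ?thesis by (simp add: sqrt_powr)
  qed
  have rC: "\<bar>r y\<bar> \<le> 1 * norm y powr (s / 2)" for y using rholder[of y 0] by (simp add: r_def)
  have fin2: "moment (s / 2) (Suc 0) < \<infinity>"
    using moment_le_1_add[of "s / 2" s "Suc 0"] s fin1 by (auto intro: le_less_trans)
  define Q where "Q = avg r"
  note Qint = integrable_avg(1)[OF s2 fin2 rm rC]
  have QSuc: "Q (Suc n) x = (\<integral>k. Q n (fst k *v x) \<partial>lam)" "integrable lam (\<lambda>k. Q n (fst k *v x))" for n x
    using avg_Suc[OF s2 fin2 rm rC] by (simp_all add: Q_def)
  have Q0 [simp]: "Q 0 x = r x" for x by (simp add: Q_def)
  have Qnn: "0 \<le> Q n x" for n x by (simp add: Q_def avg_def r0)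
  have Qscale: "Q n (c *\<^sub>R x) = \<bar>c\<bar> powr (s / 2) * Q n x" for n c x
    by (simp add: Q_def avg_def matrix_vector_mult_scaleR rscale)
  have Qcont: "continuous_on UNIV (Q n)" for n
  proof (rule holder_continuous_on[OF s2])
    fix x y
    have pm: "(\<lambda>y :: real^'d. norm y powr (s / 2)) \<in> borel_measurable borel"
      and pC: "\<And>y :: real^'d. \<bar>norm y powr (s / 2)\<bar> \<le> 1 * norm y powr (s / 2)" by auto
    have "\<bar>Q n x - Q n y\<bar> = \<bar>\<integral>\<omega>. r (Sprod \<omega> n *v x) - r (Sprod \<omega> n *v y) \<partial>\<Omega>\<bar>"
      unfolding Q_def avg_def by (subst Bochner_Integration.integral_diff) (rule Qint refl)+
    also have "\<dots> \<le> (\<integral>\<omega>. \<bar>r (Sprod \<omega> n *v x) - r (Sprod \<omega> n *v y)\<bar> \<partial>\<Omega>)"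
      by (rule integral_abs_bound)
    also have "\<dots> \<le> avg (\<lambda>y. norm y powr (s / 2)) n (x - y)"
      unfolding avg_def
    proof (intro integral_mono integrable_abs Bochner_Integration.integrable_diff Qint)
      show "integrable \<Omega> (\<lambda>\<omega>. norm (Sprod \<omega> n *v (x - y)) powr (s / 2))"
        by (rule integrable_avg(1)[OF s2 fin2 pm pC])
    qed (use rholder in \<open>simp add: matrix_vector_mult_diff_distrib\<close>)
    also have "\<dots> \<le> mean_powr (s / 2) n * norm (x - y) powr (s / 2)"
      using integrable_avg(2)[OF s2 fin2 pm pC, of n "x - y"] by simp
    finally show "\<bar>Q n x - Q n y\<bar> \<le> mean_powr (s / 2) n * norm (x - y) powr (s / 2)" .
  qed
  have inth: "integrable lam (\<lambda>k. h (fst k *v x))" for x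
    by (intro integrableI_nonneg) (use hnn in \<open>auto intro: le_less_trans[OF sup]\<close>)
  have int_le: "(\<integral>k. h (fst k *v x) \<partial>lam) \<le> h x" for x
    using sup[of x] hnn by (subst (asm) nn_integral_eq_integral[OF inth]) auto
  have intr: "integrable lam (\<lambda>k. r (fst k *v x))" for x using QSuc(2)[of 0] by simp
  have sq: "(\<lambda>k. (r (fst k *v x) - r x)\<^sup>2) = (\<lambda>k. h (fst k *v x) - 2 * r x * r (fst k *v x) + h x)" for x
    by (rule ext) (simp add: rr[symmetric] power2_eq_square algebra_simps)
  have int_sq: "integrable lam (\<lambda>k. (r (fst k *v x) - r x)\<^sup>2)" for x
    unfolding sq by (intro Bochner_Integration.integrable_add Bochner_Integration.integrable_diff
        inth integrable_mult_right intr integrable_const)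
  \<comment> \<open>Cauchy-Schwarz with its deficit: expand the square and use E r(Ax)^2 = E h(Ax)
    \<le> r(x)^2. Equality of \<open>Q (Suc 0) x\<close> and \<open>r x\<close> then forces r(Ax) =
    r(x) almost surely.\<close>
  have sq_le: "(\<integral>k. (r (fst k *v x) - r x)\<^sup>2 \<partial>lam) \<le> 2 * r x * (r x - Q (Suc 0) x)" for x
  proof -
    have "(\<integral>k. (r (fst k *v x) - r x)\<^sup>2 \<partial>lam) = (\<integral>k. h (fst k *v x) \<partial>lam) - 2 * r x * Q (Suc 0) x + h x"
      unfolding sq using inth intr prob_space by (simp add: QSuc)
    also have "\<dots> \<le> 2 * h x - 2 * r x * Q (Suc 0) x" using int_le[of x] by simp
    finally show ?thesis by (simp add: algebra_simps rr[symmetric])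
  qed
  have Q1: "Q (Suc 0) x \<le> r x" for x
  proof (cases "x = 0")
    case True
    then show ?thesis by (simp add: Q_def avg_def r_def)
  next
    case False
    have "0 \<le> 2 * r x * (r x - Q (Suc 0) x)" by (rule order_trans[OF _ sq_le]) simp
    with rpos[OF False] show ?thesis by (simp add: zero_le_mult_iff)
  qed
  have Qdec: "Q (Suc n) x \<le> Q n x" for n x
  proof (induction n arbitrary: x)
    case (Suc n)
    have "Q (Suc (Suc n)) x = (\<integral>k. Q (Suc n) (fst k *v x) \<partial>lam)" by (rule QSuc(1))
    also have "\<dots> \<le> (\<integral>k. Q n (fst k *v x) \<partial>lam)" by (intro integral_mono QSuc(2) Suc)
    also have "\<dots> = Q (Suc n) x" by (rule QSuc(1)[symmetric])
    finally show ?case .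
  qed (simp add: Q1)
  have Qanti: "Q m x \<le> Q n x" if "n \<le> m" for n m x
    using that by (induction rule: dec_induct) (auto intro: order_trans[OF Qdec])
  have Qr: "Q n x \<le> r x" for n x using Qanti[of 0 n x] by simp
  \<comment> \<open>Q^n r decreases in n from r, so these sets are nested, and they are
    compact.\<close>
  define Z where "Z n = {x \<in> sphere 0 1. Q n x = r x}" for n
  have rcont: "continuous_on UNIV r" using Qcont[of 0] by simp
  show ?thesis
  proof (cases "\<exists>n. Z n = {}")
    case False
    have "\<Inter> (range Z) \<noteq> {}"
    proof (rule compact_nest)
      fix n
      have "closed {x. Q n x = r x}" by (intro closed_Collect_eq Qcont rcont)
      then have "compact (sphere 0 1 \<inter> {x. Q n x = r x})" by (intro compact_Int_closed compact_sphere)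
      then show "compact (Z n)" by (simp add: Z_def Int_def)
      show "Z n \<noteq> {}" using False by blast
    next
      fix m n :: nat assume "m \<le> n"
      then show "Z n \<subseteq> Z m"
      proof (intro subsetI)
        fix x assume "m \<le> n" "x \<in> Z n"
        then show "x \<in> Z m" using Qanti[of m n x] Qr[of m x] by (simp add: Z_def)
      qed
    qed
    then obtain x where "x \<in> \<Inter> (range Z)" by (meson ex_in_conv)
    then have x: "x \<in> Z n" for n by (rule INT_D) simp
    \<comment> \<open>Equality for all n at once is what makes Y invariant: moving one step along
      the orbit uses up one n.\<close>
    define Y where "Y = {x. \<forall>n. Q n x = r x}"
    have step: "g *v y \<in> Y \<and> h (g *v y) = h y" if g: "g \<in> supp_inv" and y: "y \<in> Y" for g y
    proof
      have eq: "Q n y = r y" for n using y by (simp add: Y_def)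
      note mv = matrix_apply_continuous[of UNIV y]
      have "(\<integral>k. (r (fst k *v y) - r y)\<^sup>2 \<partial>lam) = 0"
        using sq_le[of y] eq[of "Suc 0"] by (intro antisym) auto
      then have "AE k in lam. (r (fst k *v y) - r y)\<^sup>2 = 0"
        by (subst (asm) integral_nonneg_eq_0_iff_AE[OF int_sq]) auto
      then have "AE k in lam. fst k \<in> {g. h (g *v y) = h y}"
        by eventually_elim (simp add: rr[symmetric])
      moreover have "closed {g :: real^'d^'d. h (g *v y) = h y}"
        by (intro closed_Collect_eq continuous_on_const continuous_on_compose2[OF h_cont mv]) auto
      ultimately show "h (g *v y) = h y" using msupp_mu_of_subset g by blast
      \<comment> \<open>Both Q^(n+1) r and Q r equal r at y, so the nonnegative r - Q^n r has mean 0
        after one step and vanishes there.\<close>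
      have "Q n (g *v y) = r (g *v y)" for n
      proof -
        have "(\<integral>k. r (fst k *v y) - Q n (fst k *v y) \<partial>lam) = Q (Suc 0) y - Q (Suc n) y"
          using intr QSuc(2) by (simp add: QSuc(1))
        then have "(\<integral>k. r (fst k *v y) - Q n (fst k *v y) \<partial>lam) = 0" by (simp add: eq)
        then have "AE k in lam. r (fst k *v y) - Q n (fst k *v y) = 0"
          by (subst (asm) integral_nonneg_eq_0_iff_AE)
             (auto intro!: Bochner_Integration.integrable_diff intr QSuc(2) Qr)
        then have "AE k in lam. fst k \<in> {g. Q n (g *v y) = r (g *v y)}" by eventually_elim simp
        moreover have "closed {g :: real^'d^'d. Q n (g *v y) = r (g *v y)}"
          by (intro closed_Collect_eq continuous_on_compose2[OF Qcont mv] continuous_on_compose2[OF rcont mv]) auto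
        ultimately show ?thesis using msupp_mu_of_subset g by blast
      qed
      then show "g *v y \<in> Y" by (simp add: Y_def)
    qed
    have gen: "g *v y \<in> Y \<and> h (g *v y) = h y" if "g \<in> semigroup_gen supp_inv" "y \<in> Y" for g y
      using that
    proof (induction arbitrary: y)
      case (mult g m)
      then show ?case by (simp add: matrix_vector_mul_assoc[symmetric])
    qed (rule step)
    have "x \<in> Y" "x \<noteq> 0" using x by (auto simp: Z_def Y_def)
    then show ?thesis using that gen by blast
  next
    case True
    then obtain n where Zn: "Z n = {}" by blast
    have lt: "Q n x < r x" if "x \<in> sphere 0 1" for x
    proof -
      have "x \<notin> Z n" using Zn by simp
      then show ?thesis using that Qr[of n x] by (simp add: Z_def)
    qed
    have ne: "sphere (0 :: real^'d) 1 \<noteq> {}" by simp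
    have "r x \<noteq> 0" if "x \<in> sphere 0 1" for x
    proof -
      have "x \<noteq> 0" using that by auto
      then show ?thesis using rpos[of x] by simp
    qed
    then have "continuous_on (sphere 0 1) (\<lambda>x. Q n x / r x)"
      by (intro continuous_on_divide continuous_on_subset[OF Qcont] continuous_on_subset[OF rcont]) auto
    then obtain y where y: "y \<in> sphere 0 1" "\<And>x. x \<in> sphere 0 1 \<Longrightarrow> Q n x / r x \<le> Q n y / r y"
      using continuous_attains_sup[OF compact_sphere ne] by blast
    \<comment> \<open>The largest ratio of Q^n r to r on the sphere, attained there and hence
      strictly below 1; homogeneity makes it a global factor.\<close>
    define \<theta> where "\<theta> = Q n y / r y"
    have "r y > 0" using y(1) by (intro rpos) auto
    then have \<theta>: "0 \<le> \<theta>" "\<theta> < 1" using Qnn[of n y] lt[OF y(1)] by (auto simp: \<theta>_def)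
    have contr: "Q n x \<le> \<theta> * r x" for x
    proof (cases "x = 0")
      case True
      then show ?thesis using Qr[of n 0] by (simp add: r_def)
    next
      case False
      let ?u = "x /\<^sub>R norm x"
      have u: "?u \<in> sphere 0 1" using False by simp
      then have "r ?u > 0" by (intro rpos) auto
      then have "Q n ?u \<le> \<theta> * r ?u" using y(2)[OF u] by (simp add: \<theta>_def field_simps)
      then have "norm x powr (s / 2) * Q n ?u \<le> norm x powr (s / 2) * (\<theta> * r ?u)" by (rule mult_left_mono) simp
      moreover have "Q n x = norm x powr (s / 2) * Q n ?u" using Qscale[of n "norm x" ?u] False by simp
      moreover have "r x = norm x powr (s / 2) * r ?u" using rscale[of "norm x" ?u] False by simp
      ultimately show ?thesis by (simp add: mult_ac)
    qed
    have contr2: "Q (n + m) x \<le> \<theta> * Q m x" for m x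
    proof (induction m arbitrary: x)
      case (Suc m)
      have "Q (n + Suc m) x = (\<integral>k. Q (n + m) (fst k *v x) \<partial>lam)" using QSuc(1)[of "n + m"] by simp
      also have "\<dots> \<le> (\<integral>k. \<theta> * Q m (fst k *v x) \<partial>lam)"
        by (intro integral_mono integrable_mult_right QSuc(2) Suc)
      also have "\<dots> = \<theta> * Q (Suc m) x" by (simp add: QSuc(1))
      finally show ?case .
    qed (simp add: contr)
    have contr3: "Q (k * n) x \<le> \<theta> ^ k * r x" for k x
    proof (induction k)
      case (Suc k)
      have "Q (Suc k * n) x \<le> \<theta> * Q (k * n) x" using contr2[of "k * n" x] by simp
      also have "\<dots> \<le> \<theta> * (\<theta> ^ k * r x)" using \<theta> Suc by (intro mult_left_mono) auto
      finally show ?case by simp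
    qed simp
    obtain c where c: "c > 0" "\<And>x. c * norm x powr s \<le> h x" using lower_bound by blast
    have rlow: "sqrt c * norm x powr (s / 2) \<le> r x" for x
    proof -
      have "sqrt c * norm x powr (s / 2) = sqrt (c * norm x powr s)" by (simp add: real_sqrt_mult sqrt_powr)
      also have "\<dots> \<le> r x" using c(2) by (simp add: r_def)
      finally show ?thesis .
    qed
    let ?M = "(\<Sum>j\<in>UNIV. r (axis j 1)) / sqrt c"
    \<comment> \<open>r dominates a multiple of |x|^(s/2), so summing over the axis vectors gives
      E|S_{kn}|^(s/2) \<le> \<theta>^k M, against the assumed lower bound 1.\<close>
    have one: "1 \<le> \<theta> ^ k * ?M" for k
    proof -
      have "mean_powr (s / 2) (k * n)
        \<le> (\<integral>\<omega>. (\<Sum>j\<in>UNIV. r (Sprod \<omega> (k * n) *v axis j 1) / sqrt c) \<partial>\<Omega>)"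
      proof (rule integral_mono)
        show "integrable \<Omega> (\<lambda>\<omega>. opnorm (Sprod \<omega> (k * n)) powr (s / 2))"
          by (rule integrable_opnorm_powr(1)[OF moment_finite'[OF s2 fin2]])
        show "integrable \<Omega> (\<lambda>\<omega>. \<Sum>j\<in>UNIV. r (Sprod \<omega> (k * n) *v axis j 1) / sqrt c)"
          by (intro Bochner_Integration.integrable_sum integrable_divide Qint)
        fix \<omega> :: "'d aff stream"
        have "opnorm (Sprod \<omega> (k * n)) powr (s / 2) \<le> (\<Sum>j\<in>UNIV. norm (Sprod \<omega> (k * n) *v axis j 1) powr (s / 2))"
          using s s1 by (intro opnorm_powr_le_sum) auto
        also have "\<dots> \<le> (\<Sum>j\<in>UNIV. r (Sprod \<omega> (k * n) *v axis j 1) / sqrt c)"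
          using rlow c(1) by (intro sum_mono) (simp add: field_simps)
        finally show "opnorm (Sprod \<omega> (k * n)) powr (s / 2) \<le> (\<Sum>j\<in>UNIV. r (Sprod \<omega> (k * n) *v axis j 1) / sqrt c)" .
      qed
      also have "\<dots> = (\<Sum>j\<in>UNIV. Q (k * n) (axis j 1) / sqrt c)"
        using Qint by (simp add: Q_def avg_def)
      also have "\<dots> \<le> (\<Sum>j\<in>UNIV. \<theta> ^ k * r (axis j 1) / sqrt c)"
        using c(1) by (intro sum_mono divide_right_mono contr3) auto
      also have "\<dots> = \<theta> ^ k * ?M"
        by (simp add: sum_divide_distrib sum_distrib_left)
      finally have le: "mean_powr (s / 2) (k * n) \<le> \<theta> ^ k * ?M" .
      have "1 \<le> ennreal (mean_powr (s / 2) (k * n))"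
        using ge[of "k * n"] integrable_opnorm_powr(2)[OF moment_finite'[OF s2 fin2]] by simp
      then have "1 \<le> mean_powr (s / 2) (k * n)" by simp
      with le show ?thesis by simp
    qed
    have "(\<lambda>k. \<theta> ^ k * ?M) \<longlonglongrightarrow> 0 * ?M"
      using \<theta> by (intro tendsto_mult LIMSEQ_realpow_zero tendsto_const)
    then have "1 \<le> 0 * ?M"
      by (rule LIMSEQ_le_const) (use one in blast)
    then show ?thesis by simp
  qed
qed

text \<open>The factor \<open>gam (fst h) powr \<epsilon>\<close> is at least 1 on invertible
  matrices, so dropping it keeps the integral finite.\<close>

lemma moment_finite_of_cond_ce:
  assumes inv: "AE h in lam. invertible (fst h)" and ce: "cond_ce lam \<alpha>"
  shows "moment \<alpha> (Suc 0) < \<infinity>"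
proof -
  obtain \<epsilon> where \<epsilon>: "\<epsilon> > 0" and fin: "(\<integral>\<^sup>+ h. ennreal (opnorm (fst h) powr \<alpha> * gam (fst h) powr \<epsilon>
                          + norm (snd h) powr (\<alpha> + \<epsilon>)) \<partial>lam) < \<infinity>"
    using ce unfolding cond_ce_def by blast
  have "moment \<alpha> (Suc 0) \<le> (\<integral>\<^sup>+ h. ennreal (opnorm (fst h) powr \<alpha> * gam (fst h) powr \<epsilon>
                          + norm (snd h) powr (\<alpha> + \<epsilon>)) \<partial>lam)"
    unfolding moment_1
  proof (rule nn_integral_mono_AE)
    show "AE h in lam. ennreal (opnorm (fst h) powr \<alpha>) \<le> ennreal (opnorm (fst h) powr \<alpha> * gam (fst h) powr \<epsilon>
                          + norm (snd h) powr (\<alpha> + \<epsilon>))"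
      using inv
    proof eventually_elim
      fix h :: "'d aff" assume "invertible (fst h)"
      then have "1 \<le> gam (fst h) powr \<epsilon>" using \<epsilon> gam_ge_1 by (intro ge_one_powr_ge_zero) auto
      then have "opnorm (fst h) powr \<alpha> * 1 \<le> opnorm (fst h) powr \<alpha> * gam (fst h) powr \<epsilon>"
        by (rule mult_left_mono) simp
      then show "ennreal (opnorm (fst h) powr \<alpha>) \<le> ennreal (opnorm (fst h) powr \<alpha> * gam (fst h) powr \<epsilon>
                          + norm (snd h) powr (\<alpha> + \<epsilon>))"
        by (intro ennreal_leI) (simp add: add_increasing2)
    qed
  qed
  then show ?thesis using fin by (rule le_less_trans)
qed

text \<open>The exponent delivered is half of the local \<open>s\<close>, since strictness is
  obtained for the square root of the gauge.\<close>

theorem contraction_in_mean: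
  assumes inv: "AE h in lam. invertible (fst h)" and ce: "cond_ce lam \<alpha>"
  obtains s where "0 < s" "s \<le> 1" "\<And>n. integrable \<Omega> (\<lambda>\<omega>. opnorm (Sprod \<omega> n) powr s)"
    "summable (\<lambda>n. \<integral>\<omega>. opnorm (Sprod \<omega> n) powr s \<partial>\<Omega>)"
proof -
  have \<alpha>: "\<alpha> > 0" using ce by (simp add: cond_ce_def)
  have fin\<alpha>: "moment \<alpha> (Suc 0) < \<infinity>" by (rule moment_finite_of_cond_ce[OF inv ce])
  define s where "s = min 1 \<alpha>"
  have s: "0 < s" "s \<le> 1" "s \<le> \<alpha>" using \<alpha> by (auto simp: s_def)
  have fin1: "moment s (Suc 0) < \<infinity>"
    using moment_le_1_add[of s \<alpha> "Suc 0"] s fin\<alpha> by (auto intro: le_less_trans)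
  define a where "a \<beta> n = mean_powr \<beta> n" for \<beta> n
  have a0: "0 \<le> a \<beta> n" for \<beta> n by (simp add: a_def)
  have a_moment: "ennreal (a \<beta> n) = moment \<beta> n" if "0 < \<beta>" "moment \<beta> (Suc 0) < \<infinity>" for \<beta> n
    unfolding a_def by (rule integrable_opnorm_powr(2)) (rule moment_finite'[OF that])
  have Spow_eq: "(\<integral>g. opnorm g powr \<alpha> \<partial>(Spow (mu_of lam) n)) = a \<alpha> n" for n
    unfolding a_def by (simp add: integral_eq_nn_integral nn_integral_Spow)
  have root: "(\<lambda>n. a \<alpha> n powr (1 / real n)) \<longlonglongrightarrow> 1"
    using ce unfolding cond_ce_def Spow_eq by blast
  \<comment> \<open>k(\<alpha>) = 1 bounds E|S_n|^\<alpha> eventually by \<delta>^n for every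
    \<delta> > 1; taking \<delta> < 1/t leaves two convergent geometric series.\<close>
  have summ: "summable (\<lambda>n. t ^ n * a s n)" if t: "0 < t" "t < 1" for t
  proof -
    obtain \<delta> where \<delta>: "1 < \<delta>" "\<delta> < 1 / t" using dense[of 1 "1 / t"] t by auto
    have "\<forall>\<^sub>F n in sequentially. a \<alpha> n powr (1 / real n) < \<delta>" using order_tendstoD(2)[OF root \<delta>(1)] .
    then have ev: "\<forall>\<^sub>F n in sequentially. norm (t ^ n * a s n) \<le> t ^ n + (t * \<delta>) ^ n"
      using eventually_gt_at_top[of 0]
    proof eventually_elim
      fix n :: nat assume n: "a \<alpha> n powr (1 / real n) < \<delta>" "0 < n"
      have "a \<alpha> n = (a \<alpha> n powr (1 / real n)) powr real n" using n a0 by (simp add: powr_powr)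
      also have "\<dots> \<le> \<delta> powr real n" using n by (intro powr_mono2) auto
      also have "\<dots> = \<delta> ^ n" using \<delta> by (simp add: powr_realpow)
      finally have 1: "a \<alpha> n \<le> \<delta> ^ n" .
      have "ennreal (a s n) \<le> 1 + ennreal (a \<alpha> n)"
        using moment_le_1_add[of s \<alpha> n] s \<alpha> fin1 fin\<alpha> by (simp add: a_moment)
      then have "a s n \<le> 1 + a \<alpha> n"
        using a0 by (simp add: ennreal_1[symmetric] ennreal_plus[symmetric] del: ennreal_1 ennreal_plus)
      with 1 have "t ^ n * a s n \<le> t ^ n * (1 + \<delta> ^ n)" using t by (intro mult_left_mono) auto
      then show "norm (t ^ n * a s n) \<le> t ^ n + (t * \<delta>) ^ n"
        using t a0 by (simp add: algebra_simps power_mult_distrib)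
    qed
    have "summable (\<lambda>n. t ^ n + (t * \<delta>) ^ n)"
      using t \<delta> by (intro summable_add summable_geometric) (auto simp: field_simps)
    then show ?thesis using ev by (rule summable_comparison_test_ev[rotated])
  qed
  have "\<exists>n. moment (s / 2) n < 1"
  proof (rule ccontr)
    assume "\<not> ?thesis"
    then have ge: "1 \<le> moment (s / 2) n" for n by (auto simp: not_less)
    obtain h where scale: "\<And>c x. h (c *\<^sub>R x) = \<bar>c\<bar> powr s * h x"
      and add: "\<And>x y. h (x + y) \<le> h x + h y"
      and nonneg: "\<And>x. 0 \<le> h x" and one: "(\<Sum>j\<in>UNIV. h (axis j 1)) = 1"
      and sup: "\<And>x::real^'d. (\<integral>\<^sup>+k. ennreal (h (fst k *v x)) \<partial>lam) \<le> ennreal (h x)"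
      by (rule ex_superharmonic_gauge[OF s(1) fin1 s(2) summ[unfolded a_def]]) (assumption, assumption, rule that)
    have holder: "\<bar>h x - h y\<bar> \<le> norm (x - y) powr s" for x y
      by (rule subadditive_gauge_bounds(2)[of h, OF scale add nonneg s(1) one])
    have cont: "continuous_on UNIV h"
      by (rule holder_continuous_on[OF s(1), of _ 1]) (simp add: holder)
    have "\<exists>z. h z \<noteq> 0"
    proof (rule ccontr)
      assume "\<not> ?thesis"
      then have "(\<Sum>j\<in>UNIV. h (axis j 1)) = 0" by simp
      with one show False by simp
    qed
    then obtain z where z: "h z \<noteq> 0" by blast
    have ip: "cond_ip (closed_semigroup supp_inv)" if "CARD('d) > 1"
      using ce that unfolding cond_ce_def Tsg_eq by blast
    have irr: "irreducible_action (closed_semigroup supp_inv)"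
    proof (cases "CARD('d) > 1")
      case True
      then show ?thesis using ip by (intro cond_ip_irreducible_action invertible_closed_semigroup)
    next
      case False
      then have "CARD('d) = 1" using zero_less_card_finite[where 'a = 'd] by linarith
      then show ?thesis by (rule irreducible_action_dim_1)
    qed
    have "homogeneous_gauge h s"
      by unfold_locales
         (use s cont scale superharmonic_gauge_pos[OF scale add nonneg s(1) cont z irr sup] in auto)
    then interpret homogeneous_gauge h s .
    obtain x where x: "x \<noteq> 0" "\<And>g. g \<in> semigroup_gen supp_inv \<Longrightarrow> h (g *v x) = h x"
      by (rule ex_orbit_level[OF \<open>homogeneous_gauge h s\<close> holder sup s(2) fin1 ge]) (rule that)
    show False
    proof (cases "CARD('d) > 1")
      case True
      show False by (rule no_orbit_level_of_cond_ip[OF True ip[OF True] x])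
    next
      case False
      then have d: "CARD('d) = 1" using zero_less_card_finite[where 'a = 'd] by linarith
      then have dense: "closure (add_subgroup_gen {ln (opnorm a) | a. a \<in> Tsg lam}) = UNIV"
        using ce unfolding cond_ce_def by blast
      \<comment> \<open>With |a| = 1 on T the logarithms generate the trivial group, which is not
        dense.\<close>
      have "{ln (opnorm a) | a. a \<in> Tsg lam} \<subseteq> {0}"
        using opnorm_eq_1_of_orbit_level[OF d x] by (auto simp: Tsg_eq)
      then have "add_subgroup_gen {ln (opnorm a) | a. a \<in> Tsg lam} \<subseteq> {0}"
        unfolding add_subgroup_gen_def by (intro Inter_lower) auto
      then have "closure (add_subgroup_gen {ln (opnorm a) | a. a \<in> Tsg lam}) \<subseteq> {0}"
        by (rule closure_minimal) simp
      then have "(1::real) \<in> {0}" unfolding dense by blast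
      then show False by simp
    qed
  qed
  then obtain N where N: "moment (s / 2) N < 1" by blast
  have s2: "0 < s / 2" "s / 2 \<le> 1" using s by auto
  have fin2: "moment (s / 2) (Suc 0) < \<infinity>"
    using moment_le_1_add[of "s / 2" s "Suc 0"] s fin1 by (auto intro: le_less_trans)
  have aN: "a (s / 2) N < 1" using N a0 by (simp add: a_moment[OF s2(1) fin2, symmetric] ennreal_less_one_iff)
  have sub: "a (s / 2) (n + N) \<le> a (s / 2) n * a (s / 2) N" for n
  proof -
    have "ennreal (a (s / 2) (n + N)) \<le> ennreal (a (s / 2) n * a (s / 2) N)"
      using moment_add_le[of "s / 2" n N] s2 by (simp add: a_moment[OF s2(1) fin2] ennreal_mult a0)
    then show ?thesis using a0 by (simp add: mult_nonneg_nonneg)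
  qed
  have "summable (a (s / 2))"
  proof (rule summableI_nonneg_bounded)
    fix M
    let ?A = "\<lambda>M. \<Sum>n<M. a (s / 2) n"
    have "?A M \<le> ?A (N + M)" by (intro sum_mono2) (auto simp: a0)
    also have "\<dots> = ?A N + (\<Sum>n<M. a (s / 2) (n + N))"
      by (induction M) (simp_all add: add.commute)
    also have "(\<Sum>n<M. a (s / 2) (n + N)) \<le> (\<Sum>n<M. a (s / 2) n * a (s / 2) N)"
      by (intro sum_mono sub)
    \<comment> \<open>Submultiplicativity bounds a partial sum by a constant plus a fraction of
      itself; solving bounds it uniformly in M.\<close>
    finally have "?A M \<le> ?A N + ?A M * a (s / 2) N" by (simp add: sum_distrib_right)
    then show "?A M \<le> ?A N / (1 - a (s / 2) N)" using aN by (simp add: field_simps)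
  qed (rule a0)
  then show ?thesis
    using that[of "s / 2"] s2 integrable_opnorm_powr(1)[OF moment_finite'[OF s2(1) fin2]]
    by (simp add: a_def[abs_def])
qed

end

subsection \<open>Laplace functionals of the scaled chain\<close>

lemma norm_exp_minus_le_1: "0 \<le> Re z \<Longrightarrow> norm (exp (- z)) \<le> 1"
  by (simp add: norm_exp_eq_Re)

text \<open>The right half-plane is convex and the derivative of exp(-z) has modulus at most 1 on
  it.\<close>

lemma norm_exp_minus_diff_le:
  assumes "0 \<le> Re z" "0 \<le> Re w"
  shows "norm (exp (- z) - exp (- w)) \<le> norm (z - w)"
proof -
  have "norm (exp (- z) - exp (- w)) \<le> 1 * norm (z - w)"
  proof (rule field_differentiable_bound[of "{z. 0 \<le> Re z}" "\<lambda>z. exp (- z)" "\<lambda>z. - exp (- z)"])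
    show "convex {z. 0 \<le> Re z}" using convex_halfspace_Re_ge[of 0] by simp
    show "((\<lambda>z. exp (- z)) has_field_derivative - exp (- u)) (at u within {z. 0 \<le> Re z})" for u
      by (auto intro!: derivative_eq_intros)
  qed (use assms norm_exp_minus_le_1 in auto)
  then show ?thesis by simp
qed

lemma min_1_powr_add:
  fixes a b s :: real
  assumes "0 \<le> a" "0 \<le> b" "0 < s" "s \<le> 1"
  shows "min 1 ((a + b) powr s) \<le> min 1 (a powr s) + min 1 (b powr s)"
proof -
  have "min 1 z \<le> min 1 x + min 1 y" if "z \<le> x + y" "0 \<le> x" "0 \<le> y" for x y z :: real
    using that by (auto simp: min_def)
  then show ?thesis using powr_add_le[OF assms] by simp
qed

lemma min_1_powr_sum:
  fixes y :: "'i \<Rightarrow> real"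
  assumes "finite A" "\<And>i. i \<in> A \<Longrightarrow> 0 \<le> y i" "0 < s" "s \<le> 1"
  shows "min 1 ((\<Sum>i\<in>A. y i) powr s) \<le> (\<Sum>i\<in>A. min 1 (y i powr s))"
  using assms(1,2)
proof (induction A rule: finite_induct)
  case (insert i A)
  have "min 1 ((\<Sum>i\<in>insert i A. y i) powr s) \<le> min 1 (y i powr s) + min 1 ((\<Sum>i\<in>A. y i) powr s)"
    using insert assms(3,4) min_1_powr_add[of "y i" "\<Sum>i\<in>A. y i" s] by (simp add: sum_nonneg)
  also have "\<dots> \<le> min 1 (y i powr s) + (\<Sum>i\<in>A. min 1 (y i powr s))"
    using insert by (intro add_left_mono insert.IH) auto
  finally show ?case using insert by simp
qed simp

text \<open>The comparison with q^n is additive, so it remains valid where \<phi> vanishes. As B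
  \<ge> 1, each error grows by at most the common factor B^n.\<close>

lemma discrete_gronwall:
  fixes \<phi> :: "nat \<Rightarrow> complex"
  assumes step: "\<And>j. j < n \<Longrightarrow> norm (\<phi> (Suc j) - q * \<phi> j) \<le> e j" and q: "norm q \<le> B" "1 \<le> B"
  shows "norm (\<phi> n - q ^ n * \<phi> 0) \<le> B ^ n * (\<Sum>j<n. e j)"
  using step
proof (induction n)
  case (Suc n)
  have e0: "0 \<le> e j" if "j < Suc n" for j using Suc.prems[OF that] norm_ge_zero order_trans by blast
  have "\<phi> (Suc n) - q ^ Suc n * \<phi> 0 = q * (\<phi> n - q ^ n * \<phi> 0) + (\<phi> (Suc n) - q * \<phi> n)"
    by (simp add: algebra_simps)
  then have "norm (\<phi> (Suc n) - q ^ Suc n * \<phi> 0) \<le> norm (q * (\<phi> n - q ^ n * \<phi> 0)) + norm (\<phi> (Suc n) - q * \<phi> n)"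
    by (metis norm_triangle_ineq)
  also have "\<dots> \<le> B * (B ^ n * (\<Sum>j<n. e j)) + B ^ Suc n * e n"
  proof (rule add_mono)
    show "norm (q * (\<phi> n - q ^ n * \<phi> 0)) \<le> B * (B ^ n * (\<Sum>j<n. e j))"
      unfolding norm_mult using q by (intro mult_mono Suc.IH Suc.prems) auto
    have "norm (\<phi> (Suc n) - q * \<phi> n) \<le> 1 * e n" using Suc.prems[of n] by simp
    also have "\<dots> \<le> B ^ Suc n * e n" using q e0[of n] by (intro mult_right_mono one_le_power) auto
    finally show "norm (\<phi> (Suc n) - q * \<phi> n) \<le> B ^ Suc n * e n" .
  qed
  also have "\<dots> = B ^ Suc n * (\<Sum>j<Suc n. e j)" by (simp add: algebra_simps)
  finally show ?case .
qed simp

lemma norm_integral_le_integral: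
  fixes F :: "'a \<Rightarrow> 'b::{banach, second_countable_topology}"
  assumes F: "F \<in> borel_measurable M" and g: "integrable M g" and le: "\<And>x. norm (F x) \<le> g x"
  shows "norm (\<integral>x. F x \<partial>M) \<le> (\<integral>x. g x \<partial>M)"
proof -
  have "integrable M F"
    by (rule Bochner_Integration.integrable_bound[OF g F]) (intro AE_I2 order_trans[OF le], simp)
  have "norm (\<integral>x. F x \<partial>M) \<le> (\<integral>x. norm (F x) \<partial>M)" by (rule integral_norm_bound)
  also have "\<dots> \<le> (\<integral>x. g x \<partial>M)"
    by (intro integral_mono integrable_norm \<open>integrable M F\<close> g le)
  finally show ?thesis .
qed

text \<open>Here \<open>s\<close> is any exponent with summable moments, and f is Lipschitz on the
  whole space, the origin included, vanishing near it.\<close>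

locale contracting_walk = affine_walk lam for lam :: "('d::finite) aff measure" +
  fixes s L \<delta> R :: real and f :: "real^'d \<Rightarrow> complex"
  assumes s_pos: "0 < s" and s_le_1: "s \<le> 1"
    and int_opnorm: "\<And>n. integrable \<Omega> (\<lambda>\<omega>. opnorm (Sprod \<omega> n) powr s)"
    and summ: "summable (\<lambda>n. \<integral>\<omega>. opnorm (Sprod \<omega> n) powr s \<partial>\<Omega>)"
    and lip: "\<And>x y. norm (f x - f y) \<le> L * norm (x - y)"
    and Re_f: "\<And>x. 0 \<le> Re (f x)"
    and \<delta>_pos: "0 < \<delta>" and supp_f: "\<And>x. f x \<noteq> 0 \<Longrightarrow> \<delta> \<le> norm x \<and> norm x \<le> R"
begin

definition a :: "nat \<Rightarrow> real" where "a n = mean_powr s n"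

lemma a_nonneg [simp]: "0 \<le> a n" by (simp add: a_def)

lemma summable_a: "summable a" using summ by (simp add: a_def[abs_def])

lemma L_nonneg: "0 \<le> L"
proof -
  obtain x :: "real^'d" where "norm x = 1" using vector_choose_size[of 1] by auto
  then have "norm (f x - f 0) \<le> L" using lip[of x 0] by simp
  then show ?thesis by (rule order_trans[OF norm_ge_zero])
qed

lemma f_0 [simp]: "f 0 = 0" using supp_f[of 0] \<delta>_pos by auto

lemma cont_f: "continuous_on UNIV f"
  by (rule holder_continuous_on_norm[of 1 f L]) (use lip in auto)

lemma measurable_f [measurable]: "f \<in> borel_measurable borel"
  using cont_f by (rule borel_measurable_continuous_onI)

text \<open>Truncated at 1, it is integrable under every probability and stays subadditive; near 0
  it is the power whose moments are summable.\<close>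

definition tau :: "real^'d \<Rightarrow> real" where "tau z = min 1 (norm z powr s)"

lemma tau_bounds [simp]: "0 \<le> tau z" "tau z \<le> 1" "tau z \<le> norm z powr s" "tau 0 = 0"
  by (simp_all add: tau_def)

lemma tau_add: "tau (x + y) \<le> tau x + tau y"
proof -
  have "tau (x + y) \<le> min 1 ((norm x + norm y) powr s)"
    unfolding tau_def using s_pos powr_mono2[of s "norm (x + y)" "norm x + norm y"] norm_triangle_ineq[of x y]
    by (intro min.mono) auto
  also have "\<dots> \<le> tau x + tau y" unfolding tau_def by (intro min_1_powr_add s_pos s_le_1) auto
  finally show ?thesis .
qed

lemma tau_minus [simp]: "tau (- x) = tau x" by (simp add: tau_def)

lemma tau_diff: "tau (x - y) \<le> tau x + tau y" using tau_add[of x "- y"] by simp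

lemma cont_tau: "continuous_on UNIV tau"
  unfolding tau_def using s_pos by (intro continuous_intros continuous_on_powr') auto

lemma measurable_tau [measurable]: "tau \<in> borel_measurable borel"
  using cont_tau by (rule borel_measurable_continuous_onI)

lemma tau_scaled_limit: "t \<longlonglongrightarrow> 0 \<Longrightarrow> (\<lambda>n. tau (t n *\<^sub>R x)) \<longlonglongrightarrow> 0" for t :: "nat \<Rightarrow> real"
proof -
  assume "t \<longlonglongrightarrow> 0"
  then have "(\<lambda>n. t n *\<^sub>R x) \<longlonglongrightarrow> 0" using tendsto_scaleR[OF _ tendsto_const, of t 0 _ x] by simp
  moreover have "isCont tau 0" using cont_tau by (simp add: continuous_on_eq_continuous_at)
  ultimately have "(\<lambda>n. tau (t n *\<^sub>R x)) \<longlonglongrightarrow> tau 0" by (rule isCont_tendsto_compose[rotated])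
  then show ?thesis by simp
qed

text \<open>The factor 2 bounds the difference of two exponentials of modulus at most 1; the factor
  \<open>1 + L powr s\<close> moves the Lipschitz constant out of the truncation.\<close>

definition D :: real where "D = 2 * (1 + L powr s)"

lemma D_nonneg: "0 \<le> D" by (simp add: D_def)

text \<open>The Lipschitz bound is weakened to exponent s, since only s-th moments are summable;
  subadditivity of min(1, x^s) then splits the sum.\<close>

lemma exp_sum_diff_le:
  assumes "finite A"
  shows "norm (exp (- (\<Sum>i\<in>A. f (u i))) - exp (- (\<Sum>i\<in>A. f (v i)))) \<le> D * (\<Sum>i\<in>A. tau (u i - v i))"
proof -
  let ?z = "\<Sum>i\<in>A. f (u i)" and ?w = "\<Sum>i\<in>A. f (v i)"
  have Re: "0 \<le> Re ?z" "0 \<le> Re ?w" by (auto intro!: sum_nonneg Re_f)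
  have "norm (exp (- ?z) - exp (- ?w)) \<le> norm (exp (- ?z)) + norm (exp (- ?w))" by (rule norm_triangle_ineq4)
  also have "\<dots> \<le> 1 + 1" by (intro add_mono norm_exp_minus_le_1 Re)
  finally have le2: "norm (exp (- ?z) - exp (- ?w)) \<le> 2" by simp
  have "norm (exp (- ?z) - exp (- ?w)) \<le> 2 * min 1 (norm (?z - ?w) powr s)"
  proof (cases "norm (?z - ?w) \<le> 1")
    case True
    have "norm (?z - ?w) \<le> norm (?z - ?w) powr s"
      using powr_mono'[of s 1 "norm (?z - ?w)"] True s_le_1 by simp
    moreover have "norm (?z - ?w) powr s \<le> 1" using powr_mono2[of s _ 1] True s_pos by simp
    ultimately show ?thesis
      unfolding min_absorb2[OF \<open>norm (?z - ?w) powr s \<le> 1\<close>]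
      using norm_exp_minus_diff_le[OF Re] powr_ge_zero[of "norm (?z - ?w)" s] by linarith
  next
    case False
    then have "1 \<le> norm (?z - ?w) powr s" using s_pos by (intro ge_one_powr_ge_zero) auto
    then show ?thesis using le2 by (simp add: min_def)
  qed
  also have "norm (?z - ?w) \<le> (\<Sum>i\<in>A. L * norm (u i - v i))"
    unfolding sum_subtractf[symmetric] by (intro order_trans[OF norm_sum] sum_mono lip)
  then have "2 * min 1 (norm (?z - ?w) powr s) \<le> 2 * min 1 ((\<Sum>i\<in>A. L * norm (u i - v i)) powr s)"
    using s_pos powr_mono2[of s "norm (?z - ?w)"] by (intro mult_left_mono min.mono) auto
  also have "\<dots> \<le> 2 * (\<Sum>i\<in>A. min 1 ((L * norm (u i - v i)) powr s))"
    using assms s_pos s_le_1 L_nonneg by (intro mult_left_mono min_1_powr_sum) auto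
  also have "\<dots> \<le> 2 * (\<Sum>i\<in>A. (1 + L powr s) * tau (u i - v i))"
  proof (intro mult_left_mono sum_mono)
    fix i
    have "min 1 (l * x) \<le> (1 + l) * min 1 x" if "0 \<le> x" "0 \<le> l" for x l :: real
      using that by (cases "x \<le> 1") (auto simp: min_def algebra_simps)
    then show "min 1 ((L * norm (u i - v i)) powr s) \<le> (1 + L powr s) * tau (u i - v i)"
      using L_nonneg by (simp add: tau_def powr_mult)
  qed simp
  also have "\<dots> = D * (\<Sum>i\<in>A. tau (u i - v i))" by (simp only: D_def sum_distrib_left mult.assoc)
  finally show ?thesis .
qed

section \<open>Laplace functionals of the affine and the linear chain\<close>

definition weight :: "real \<Rightarrow> nat \<Rightarrow> real^'d \<Rightarrow> 'd aff stream \<Rightarrow> complex" where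
  "weight t j x \<omega> = exp (- (\<Sum>i<j. f (t *\<^sub>R chain x \<omega> (Suc i))))"

definition G :: "real \<Rightarrow> nat \<Rightarrow> real^'d \<Rightarrow> complex" where
  "G t j x = (\<integral>\<omega>. weight t j x \<omega> \<partial>\<Omega>)"

text \<open>The sum starts at S_1 v; the term f(v) of index 0 is carried by
  \<open>one_minus_exp\<close>.\<close>

definition linear_weight :: "nat \<Rightarrow> real^'d \<Rightarrow> 'd aff stream \<Rightarrow> complex" where
  "linear_weight m v \<omega> = exp (- (\<Sum>i<m. f (Sprod \<omega> (Suc i) *v v)))"

definition \<Psi> :: "nat \<Rightarrow> real^'d \<Rightarrow> complex" where
  "\<Psi> m v = (\<integral>\<omega>. linear_weight m v \<omega> \<partial>\<Omega>)"

lemma measurable_weight [measurable (raw)]: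
  assumes [measurable]: "g \<in> measurable N \<Omega>" "h \<in> borel_measurable N"
  shows "(\<lambda>z. weight t j (h z) (g z)) \<in> borel_measurable N"
  unfolding weight_def by (intro measurable_compose[OF _ borel_measurable_exp] ) measurable

lemma measurable_linear_weight [measurable]: "linear_weight m v \<in> borel_measurable \<Omega>"
  unfolding linear_weight_def[abs_def] by measurable

lemma norm_weight_le: "norm (weight t j x \<omega>) \<le> 1"
  unfolding weight_def by (intro norm_exp_minus_le_1) (auto intro!: sum_nonneg Re_f)

lemma norm_linear_weight_le: "norm (linear_weight m v \<omega>) \<le> 1"
  unfolding linear_weight_def by (intro norm_exp_minus_le_1) (auto intro!: sum_nonneg Re_f)

lemma integrable_paths_bounded:
  fixes F :: "'d aff stream \<Rightarrow> 'b::{banach, second_countable_topology}"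
  assumes "F \<in> borel_measurable \<Omega>" "\<And>\<omega>. norm (F \<omega>) \<le> B"
  shows "integrable \<Omega> F"
  by (rule paths.integrable_const_bound[of _ B]) (use assms in auto)

end

context contracting_walk
begin

abbreviation one_minus_exp :: "real^'d \<Rightarrow> complex" where
  "one_minus_exp v \<equiv> 1 - exp (- f v)"

lemma measurable_G [measurable]: "G t j \<in> borel_measurable borel"
  unfolding G_def[abs_def] by measurable

lemma norm_G_le: "norm (G t j x) \<le> 1"
  using norm_integral_le_integral[of "weight t j x" \<Omega> "\<lambda>_. 1"] norm_weight_le
  by (simp add: G_def measurable_weight[of "\<lambda>\<omega>. \<omega>"])

lemma norm_\<Psi>_le: "norm (\<Psi> m v) \<le> 1"
  using norm_integral_le_integral[of "linear_weight m v" \<Omega> "\<lambda>_. 1"] norm_linear_weight_le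
  by (simp add: \<Psi>_def)

lemma G_0 [simp]: "G t 0 x = 1"
  by (simp add: G_def weight_def)

lemma tau_Sprod_le: "tau (Sprod \<omega> n *v v) \<le> opnorm (Sprod \<omega> n) powr s * norm v powr s"
  by (rule order_trans[OF tau_bounds(3) norm_Sprod_powr_le[OF s_pos]])

lemma integrable_tau: "g \<in> borel_measurable \<Omega> \<Longrightarrow> integrable \<Omega> (\<lambda>\<omega>. tau (g \<omega>))"
  by (rule integrable_paths_bounded[of _ 1]) (auto simp: measurable_compose[OF _ measurable_tau])

lemma integral_tau_Sprod_le: "(\<integral>\<omega>. tau (Sprod \<omega> n *v v) \<partial>\<Omega>) \<le> a n * norm v powr s"
proof -
  have "(\<integral>\<omega>. tau (Sprod \<omega> n *v v) \<partial>\<Omega>) \<le> (\<integral>\<omega>. opnorm (Sprod \<omega> n) powr s * norm v powr s \<partial>\<Omega>)"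
    by (intro integral_mono integrable_tau integrable_mult_left int_opnorm tau_Sprod_le) measurable
  then show ?thesis by (simp add: a_def)
qed

lemma sum_a_le: "(\<Sum>i<j. a (Suc i)) \<le> suminf a"
proof -
  have "(\<Sum>i<j. a (Suc i)) \<le> (\<Sum>i<Suc j. a i)" by (subst sum.lessThan_Suc_shift) simp
  also have "\<dots> \<le> suminf a" by (rule sum_le_suminf[OF summable_a]) auto
  finally show ?thesis .
qed

text \<open>Common source of three comparisons: \<Psi> at two points, G at two points, and G against
  \<Psi>.\<close>

lemma exp_sum_diff_integral_le:
  fixes j :: nat
  assumes [measurable]: "\<And>i. u i \<in> borel_measurable \<Omega>" "\<And>i. v i \<in> borel_measurable \<Omega>"
  shows "norm ((\<integral>\<omega>. exp (- (\<Sum>i<j. f (u i \<omega>))) \<partial>\<Omega>) - (\<integral>\<omega>. exp (- (\<Sum>i<j. f (v i \<omega>))) \<partial>\<Omega>))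
    \<le> D * (\<Sum>i<j. \<integral>\<omega>. tau (u i \<omega> - v i \<omega>) \<partial>\<Omega>)"
proof -
  have int: "integrable \<Omega> (\<lambda>\<omega>. exp (- (\<Sum>i<j. f (w i \<omega>))))"
    if [measurable]: "\<And>i. w i \<in> borel_measurable \<Omega>" for w
    by (rule integrable_paths_bounded[of _ 1]) (measurable, intro norm_exp_minus_le_1, auto intro!: sum_nonneg Re_f)
  have "norm ((\<integral>\<omega>. exp (- (\<Sum>i<j. f (u i \<omega>))) \<partial>\<Omega>) - (\<integral>\<omega>. exp (- (\<Sum>i<j. f (v i \<omega>))) \<partial>\<Omega>))
     = norm (\<integral>\<omega>. exp (- (\<Sum>i<j. f (u i \<omega>))) - exp (- (\<Sum>i<j. f (v i \<omega>))) \<partial>\<Omega>)"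
    by (subst Bochner_Integration.integral_diff) (auto intro!: int)
  also have "\<dots> \<le> (\<integral>\<omega>. D * (\<Sum>i<j. tau (u i \<omega> - v i \<omega>)) \<partial>\<Omega>)"
  proof (rule norm_integral_le_integral)
    fix \<omega>
    show "norm (exp (- (\<Sum>i<j. f (u i \<omega>))) - exp (- (\<Sum>i<j. f (v i \<omega>)))) \<le> D * (\<Sum>i<j. tau (u i \<omega> - v i \<omega>))"
      by (rule exp_sum_diff_le) simp
  qed (auto intro!: integrable_mult_right Bochner_Integration.integrable_sum integrable_tau)
  also have "\<dots> = D * (\<Sum>i<j. \<integral>\<omega>. tau (u i \<omega> - v i \<omega>) \<partial>\<Omega>)"
    by (subst integral_mult_right_zero, subst Bochner_Integration.integral_sum) (auto intro!: integrable_tau)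
  finally show ?thesis .
qed

text \<open>Summability of the moments makes the bound independent of the number j of steps.\<close>

lemma sum_tau_Sprod_le:
  "D * (\<Sum>i<j. \<integral>\<omega>. tau (Sprod \<omega> (Suc i) *v v) \<partial>\<Omega>) \<le> D * suminf a * norm v powr s"
proof -
  have "(\<Sum>i<j. \<integral>\<omega>. tau (Sprod \<omega> (Suc i) *v v) \<partial>\<Omega>) \<le> (\<Sum>i<j. a (Suc i) * norm v powr s)"
    by (intro sum_mono integral_tau_Sprod_le)
  also have "\<dots> \<le> suminf a * norm v powr s"
    unfolding sum_distrib_right[symmetric] by (intro mult_right_mono sum_a_le) simp
  finally show ?thesis using mult_left_mono[OF _ D_nonneg] by (simp add: mult.assoc)
qed

lemma \<Psi>_holder: "norm (\<Psi> m v - \<Psi> m w) \<le> D * suminf a * norm (v - w) powr s"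
proof -
  have "norm (\<Psi> m v - \<Psi> m w) \<le> D * (\<Sum>i<m. \<integral>\<omega>. tau (Sprod \<omega> (Suc i) *v v - Sprod \<omega> (Suc i) *v w) \<partial>\<Omega>)"
    unfolding \<Psi>_def linear_weight_def by (rule exp_sum_diff_integral_le) measurable
  also have "\<dots> \<le> D * suminf a * norm (v - w) powr s"
    using sum_tau_Sprod_le[where j = m and v = "v - w"] by (simp only: matrix_vector_mult_diff_distrib)
  finally show ?thesis .
qed

lemma cont_\<Psi>: "continuous_on UNIV (\<Psi> m)"
  by (rule holder_continuous_on_norm[OF s_pos \<Psi>_holder])

lemma measurable_\<Psi> [measurable]: "\<Psi> m \<in> borel_measurable borel"
  using cont_\<Psi> by (rule borel_measurable_continuous_onI)

text \<open>The summand 2 covers points so far apart that tau equals 1.\<close>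

definition C :: real where "C = 2 + D * suminf a"

lemma C_nonneg: "0 \<le> C"
  using D_nonneg suminf_nonneg[OF summable_a] by (simp add: C_def)

text \<open>The chain forgets its starting point at a summable rate, so its Laplace functionals have a
  Hoelder modulus at scale 1/t that does not depend on the number of steps.\<close>

lemma G_diff_le: "norm (G t j x - G t j y) \<le> C * tau (t *\<^sub>R (x - y))"
proof (cases "norm (t *\<^sub>R (x - y)) \<le> 1")
  case True
  have eq: "t *\<^sub>R chain x \<omega> n - t *\<^sub>R chain y \<omega> n = Sprod \<omega> n *v (t *\<^sub>R (x - y))" for \<omega> n
    using chain_diff[of x \<omega> n y] by (simp add: matrix_vector_mult_scaleR scaleR_diff_right[symmetric])
  have "norm (G t j x - G t j y) \<le> D * (\<Sum>i<j. \<integral>\<omega>. tau (t *\<^sub>R chain x \<omega> (Suc i) - t *\<^sub>R chain y \<omega> (Suc i)) \<partial>\<Omega>)"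
    unfolding G_def weight_def by (rule exp_sum_diff_integral_le) measurable
  also have "\<dots> \<le> D * suminf a * norm (t *\<^sub>R (x - y)) powr s"
    unfolding eq by (rule sum_tau_Sprod_le)
  also have "\<dots> \<le> C * norm (t *\<^sub>R (x - y)) powr s" by (intro mult_right_mono) (simp_all add: C_def)
  also have "norm (t *\<^sub>R (x - y)) powr s = tau (t *\<^sub>R (x - y))"
  proof -
    have "norm (t *\<^sub>R (x - y)) powr s \<le> 1" using powr_mono2[of s _ 1] True s_pos by simp
    then show ?thesis unfolding tau_def by (rule min_absorb2[symmetric])
  qed
  finally show ?thesis .
next
  case False
  then have "1 \<le> norm (t *\<^sub>R (x - y)) powr s" using s_pos by (intro ge_one_powr_ge_zero) auto
  then have tau1: "tau (t *\<^sub>R (x - y)) = 1" unfolding tau_def by (rule min_absorb1)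
  have "norm (G t j x - G t j y) \<le> 1 + 1" by (intro order_trans[OF norm_triangle_ineq4] add_mono norm_G_le)
  also have "\<dots> \<le> C" using D_nonneg suminf_nonneg[OF summable_a] by (simp add: C_def)
  finally show ?thesis by (simp add: tau1)
qed

lemma weight_Stream:
  "weight t (Suc j) x (h ## \<omega>) =
     exp (- f (t *\<^sub>R (fst h *v x + snd h))) * weight t j (fst h *v x + snd h) \<omega>"
  unfolding weight_def sum.lessThan_Suc_shift chain_Stream
  by (simp add: exp_add[symmetric] del: chain.simps(2))

text \<open>The Markov property at time m, by splitting off the first step.\<close>

lemma G_add: "G t (m + j) x = (\<integral>\<omega>. weight t m x \<omega> * G t j (chain x \<omega> m) \<partial>\<Omega>)"
proof (induction m arbitrary: x)
  case 0
  show ?case by (simp add: weight_def)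
next
  case (Suc m)
  let ?y = "\<lambda>h. fst h *v x + snd h"
  have "G t (Suc m + j) x = (\<integral>h. \<integral>\<omega>. weight t (Suc (m + j)) x (h ## \<omega>) \<partial>\<Omega> \<partial>lam)"
    unfolding G_def add_Suc
    by (rule integral_paths(1), rule integrable_paths_bounded[of _ 1]) (measurable, rule norm_weight_le)
  also have "\<dots> = (\<integral>h. exp (- f (t *\<^sub>R ?y h)) * G t (m + j) (?y h) \<partial>lam)"
    unfolding weight_Stream G_def by simp
  also have "\<dots> = (\<integral>h. exp (- f (t *\<^sub>R ?y h)) * (\<integral>\<omega>. weight t m (?y h) \<omega> * G t j (chain (?y h) \<omega> m) \<partial>\<Omega>) \<partial>lam)"
    by (simp only: Suc)
  also have "\<dots> = (\<integral>h. (\<integral>\<omega>. weight t (Suc m) x (h ## \<omega>) * G t j (chain x (h ## \<omega>) (Suc m)) \<partial>\<Omega>) \<partial>lam)"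
    unfolding weight_Stream chain_Stream mult.assoc by simp
  also have "\<dots> = (\<integral>\<omega>. weight t (Suc m) x \<omega> * G t j (chain x \<omega> (Suc m)) \<partial>\<Omega>)"
  proof (rule integral_paths(1)[symmetric], rule integrable_paths_bounded[of _ 1])
    fix \<omega>
    have "norm (weight t (Suc m) x \<omega>) * norm (G t j (chain x \<omega> (Suc m))) \<le> 1 * 1"
      by (intro mult_mono norm_weight_le norm_G_le) auto
    then show "norm (weight t (Suc m) x \<omega> * G t j (chain x \<omega> (Suc m))) \<le> 1" by (simp add: norm_mult)
  qed measurable
  finally show ?case .
qed

text \<open>Measures the accumulated translations at scale t, since a chain started at 0 consists of
  nothing else.\<close>

definition zeta :: "nat \<Rightarrow> real \<Rightarrow> real" where
  "zeta m t = (\<integral>\<omega>. tau (t *\<^sub>R chain 0 \<omega> m) \<partial>\<Omega>)"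

lemma zeta_limit: "t \<longlonglongrightarrow> 0 \<Longrightarrow> (\<lambda>n. zeta m (t n)) \<longlonglongrightarrow> 0"
proof -
  assume t: "t \<longlonglongrightarrow> 0"
  have "(\<lambda>n. zeta m (t n)) \<longlonglongrightarrow> (\<integral>\<omega>. 0 \<partial>\<Omega>)"
    unfolding zeta_def
    by (rule integral_dominated_convergence[where w = "\<lambda>_. 1"])
       (auto simp: measurable_compose[OF _ measurable_tau] intro!: tau_scaled_limit[OF t] AE_I2)
  then show ?thesis by simp
qed

text \<open>By \<open>chain_diff\<close> the affine chain differs from the linear one by the chain
  started at 0, whatever x is.\<close>

lemma G_\<Psi>_le: "norm (G t m x - \<Psi> m (t *\<^sub>R x)) \<le> D * (\<Sum>i<m. zeta (Suc i) t)"
proof -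
  have eq: "t *\<^sub>R chain x \<omega> n - Sprod \<omega> n *v (t *\<^sub>R x) = t *\<^sub>R chain 0 \<omega> n" for \<omega> n
    using chain_diff[of x \<omega> n 0] by (simp add: matrix_vector_mult_scaleR scaleR_add_right)
  have "norm (G t m x - \<Psi> m (t *\<^sub>R x))
     \<le> D * (\<Sum>i<m. \<integral>\<omega>. tau (t *\<^sub>R chain x \<omega> (Suc i) - Sprod \<omega> (Suc i) *v (t *\<^sub>R x)) \<partial>\<Omega>)"
    unfolding G_def weight_def \<Psi>_def linear_weight_def by (rule exp_sum_diff_integral_le) measurable
  then show ?thesis unfolding eq zeta_def .
qed

end

section \<open>Stationarity and decoupling\<close>

locale stationary_walk = contracting_walk lam s L \<delta> R f + rho: prob_space \<rho> 
  for lam :: "('d::finite) aff measure" and s L \<delta> R f and \<rho> :: "(real^'d) measure" +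
  assumes sets_rho [measurable_cong]: "sets \<rho> = sets borel"
    and rho_inv: "distr (\<rho> \<Otimes>\<^sub>M lam) borel (\<lambda>(x, h). fst h *v x + snd h) = \<rho>"
begin

sublocale rho_step: pair_prob_space \<rho> lam ..

lemma space_rho [simp]: "space \<rho> = UNIV"
  using sets_eq_imp_space_eq[OF sets_rho] by simp

lemma integrable_rho_bounded:
  fixes F :: "real^'d \<Rightarrow> 'b::{banach, second_countable_topology}"
  assumes "F \<in> borel_measurable borel" "\<And>x. norm (F x) \<le> B"
  shows "integrable \<rho> F"
  by (rule rho.integrable_const_bound[of _ B]) (use assms in \<open>auto simp: measurable_cong_sets[OF sets_rho refl]\<close>)

lemma rho_invariant:
  fixes F :: "real^'d \<Rightarrow> 'b::{banach, second_countable_topology}"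
  assumes [measurable]: "F \<in> borel_measurable borel" and B: "\<And>x. norm (F x) \<le> B"
  shows "(\<integral>x. \<integral>h. F (fst h *v x + snd h) \<partial>lam \<partial>\<rho>) = (\<integral>x. F x \<partial>\<rho>)"
proof -
  have "(\<integral>x. F x \<partial>\<rho>) = (\<integral>x. F x \<partial>distr (\<rho> \<Otimes>\<^sub>M lam) borel (\<lambda>(x, h). fst h *v x + snd h))"
    by (simp only: rho_inv)
  also have "\<dots> = (\<integral>z. F (fst (snd z) *v fst z + snd (snd z)) \<partial>(\<rho> \<Otimes>\<^sub>M lam))"
    by (subst integral_distr) (auto simp: case_prod_beta')
  also have "\<dots> = (\<integral>(x, h). F (fst h *v x + snd h) \<partial>(\<rho> \<Otimes>\<^sub>M lam))" by (simp add: case_prod_beta')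
  also have "\<dots> = (\<integral>x. \<integral>h. F (fst h *v x + snd h) \<partial>lam \<partial>\<rho>)"
  proof (rule rho_step.integral_fst[symmetric])
    show "integrable (\<rho> \<Otimes>\<^sub>M lam) (\<lambda>(x, h). F (fst h *v x + snd h))"
      by (rule rho_step.P.integrable_const_bound[of _ B]) (auto simp: B case_prod_beta')
  qed
  finally show ?thesis by simp
qed

definition phi :: "real \<Rightarrow> nat \<Rightarrow> complex" where
  "phi t j = (\<integral>x. G t j x \<partial>\<rho>)"

lemma integrable_G: "integrable \<rho> (G t j)"
  by (rule integrable_rho_bounded[of _ 1]) (auto simp: norm_G_le)

lemma phi_0 [simp]: "phi t 0 = 1"
  using rho.prob_space by (simp add: phi_def)

lemma norm_phi_le: "norm (phi t j) \<le> 1"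
  using norm_integral_le_integral[of "G t j" \<rho> "\<lambda>_. 1"] norm_G_le rho.prob_space
  by (simp add: phi_def measurable_cong_sets[OF sets_rho refl])

lemma norm_exp_f_le: "norm (exp (- f v)) \<le> 1"
  by (rule norm_exp_minus_le_1[OF Re_f])

text \<open>Taking out the first factor writes phi_(j+1) as the mean of exp(-f(t X_1)) G_j(X_1), and
  X_1 has the law of X_0.\<close>

lemma phi_diff: "phi t j - phi t (Suc j) = (\<integral>x. one_minus_exp (t *\<^sub>R x) * G t j x \<partial>\<rho>)"
proof -
  have bd: "norm (exp (- f (t *\<^sub>R x)) * G t j x) \<le> 1" for x
  proof -
    have "norm (exp (- f (t *\<^sub>R x))) * norm (G t j x) \<le> 1 * 1"
      by (intro mult_mono norm_exp_f_le norm_G_le) auto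
    then show ?thesis by (simp add: norm_mult)
  qed
  have GS: "G t (Suc j) x = (\<integral>h. exp (- f (t *\<^sub>R (fst h *v x + snd h))) * G t j (fst h *v x + snd h) \<partial>lam)" for x
  proof -
    have "G t (Suc j) x = (\<integral>h. \<integral>\<omega>. weight t (Suc j) x (h ## \<omega>) \<partial>\<Omega> \<partial>lam)"
      unfolding G_def
      by (rule integral_paths(1), rule integrable_paths_bounded[of _ 1]) (measurable, rule norm_weight_le)
    then show ?thesis unfolding weight_Stream G_def by simp
  qed
  have "phi t (Suc j) = (\<integral>x. exp (- f (t *\<^sub>R x)) * G t j x \<partial>\<rho>)"
    unfolding phi_def GS by (rule rho_invariant[OF _ bd]) measurable
  moreover have "integrable \<rho> (\<lambda>x. exp (- f (t *\<^sub>R x)) * G t j x)"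
    by (rule integrable_rho_bounded[OF _ bd]) measurable
  ultimately show ?thesis
    unfolding phi_def using integrable_G by (simp add: left_diff_distrib)
qed

definition eta :: "real \<Rightarrow> real" where "eta t = (\<integral>x. tau (t *\<^sub>R x) \<partial>\<rho>)"

lemma integrable_tau_rho: "integrable \<rho> (\<lambda>x. tau (t *\<^sub>R x))"
  by (rule integrable_rho_bounded[of _ 1]) auto

lemma eta_limit: "t \<longlonglongrightarrow> 0 \<Longrightarrow> (\<lambda>n. eta (t n)) \<longlonglongrightarrow> 0"
proof -
  assume t: "t \<longlonglongrightarrow> 0"
  have "(\<lambda>n. eta (t n)) \<longlonglongrightarrow> (\<integral>x. 0 \<partial>\<rho>)"
    unfolding eta_def
    by (rule integral_dominated_convergence[where w = "\<lambda>_. 1"])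
       (auto intro!: tau_scaled_limit[OF t] AE_I2 simp: measurable_cong_sets[OF sets_rho refl])
  then show ?thesis by simp
qed

text \<open>phi is the rho-average of G, and G varies little at scale 1/t; \<open>eta t\<close>
  accounts for the spread of rho at that scale.\<close>

lemma G_phi_le: "norm (G t j y - phi t j) \<le> C * (tau (t *\<^sub>R y) + eta t)"
proof -
  have "G t j y - phi t j = (\<integral>x. G t j y - G t j x \<partial>\<rho>)"
    unfolding phi_def using integrable_G rho.prob_space by simp
  also have "norm \<dots> \<le> (\<integral>x. C * (tau (t *\<^sub>R y) + tau (t *\<^sub>R x)) \<partial>\<rho>)"
  proof (rule norm_integral_le_integral)
    fix x
    have "norm (G t j y - G t j x) \<le> C * tau (t *\<^sub>R (y - x))" by (rule G_diff_le)
    also have "\<dots> \<le> C * (tau (t *\<^sub>R y) + tau (t *\<^sub>R x))"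
      unfolding scaleR_diff_right by (intro mult_left_mono tau_diff C_nonneg)
    finally show "norm (G t j y - G t j x) \<le> C * (tau (t *\<^sub>R y) + tau (t *\<^sub>R x))" .
  qed (auto intro!: integrable_tau_rho simp: measurable_cong_sets[OF sets_rho refl])
  also have "\<dots> = C * (tau (t *\<^sub>R y) + eta t)"
    using integrable_tau_rho rho.prob_space by (simp add: eta_def)
  finally show ?thesis .
qed

text \<open>After m steps the rescaled chain is S_m(t x) plus t times a chain from 0. The first is
  small in mean for large m, the second for small t, so the remaining j steps start almost from
  stationarity.\<close>

lemma G_add_phi_le:
  assumes "0 \<le> t" "norm (t *\<^sub>R x) \<le> R"
  shows "norm (G t (m + j) x - phi t j * G t m x) \<le> C * (a m * R powr s + zeta m t + eta t)"
proof -
  have intw: "integrable \<Omega> (weight t m x)"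
    by (rule integrable_paths_bounded[of _ 1]) (measurable, rule norm_weight_le)
  have intwG: "integrable \<Omega> (\<lambda>\<omega>. weight t m x \<omega> * G t j (chain x \<omega> m))"
  proof (rule integrable_paths_bounded[of _ 1])
    fix \<omega>
    have "norm (weight t m x \<omega>) * norm (G t j (chain x \<omega> m)) \<le> 1 * 1"
      by (intro mult_mono norm_weight_le norm_G_le) auto
    then show "norm (weight t m x \<omega> * G t j (chain x \<omega> m)) \<le> 1" by (simp add: norm_mult)
  qed measurable
  have "G t (m + j) x - phi t j * G t m x
      = (\<integral>\<omega>. weight t m x \<omega> * G t j (chain x \<omega> m) - phi t j * weight t m x \<omega> \<partial>\<Omega>)"
    unfolding G_add[of t m j x] unfolding G_def[of t m] using intw intwG by simp
  also have "norm \<dots> \<le> (\<integral>\<omega>. C * (tau (Sprod \<omega> m *v (t *\<^sub>R x)) + tau (t *\<^sub>R chain 0 \<omega> m) + eta t) \<partial>\<Omega>)"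
  proof (rule norm_integral_le_integral)
    fix \<omega>
    have "norm (weight t m x \<omega> * G t j (chain x \<omega> m) - phi t j * weight t m x \<omega>)
        = norm (weight t m x \<omega>) * norm (G t j (chain x \<omega> m) - phi t j)"
      by (simp add: norm_mult[symmetric] algebra_simps)
    also have "\<dots> \<le> 1 * (C * (tau (t *\<^sub>R chain x \<omega> m) + eta t))"
      by (intro mult_mono norm_weight_le G_phi_le) auto
    also have "tau (t *\<^sub>R chain x \<omega> m) \<le> tau (Sprod \<omega> m *v (t *\<^sub>R x)) + tau (t *\<^sub>R chain 0 \<omega> m)"
      using tau_add[of "Sprod \<omega> m *v (t *\<^sub>R x)" "t *\<^sub>R chain 0 \<omega> m"] chain_diff[of x \<omega> m 0]
      by (simp add: matrix_vector_mult_scaleR scaleR_add_right add.commute)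
    finally show "norm (weight t m x \<omega> * G t j (chain x \<omega> m) - phi t j * weight t m x \<omega>)
        \<le> C * (tau (Sprod \<omega> m *v (t *\<^sub>R x)) + tau (t *\<^sub>R chain 0 \<omega> m) + eta t)"
      using C_nonneg by (simp add: mult_left_mono)
  qed (auto intro!: integrable_tau Bochner_Integration.integrable_add integrable_mult_right)
  also have "\<dots> = C * ((\<integral>\<omega>. tau (Sprod \<omega> m *v (t *\<^sub>R x)) \<partial>\<Omega>) + zeta m t + eta t)"
    by (simp add: zeta_def integrable_tau)
  also have "\<dots> \<le> C * (a m * R powr s + zeta m t + eta t)"
  proof (intro mult_left_mono add_right_mono C_nonneg)
    have "a m * norm (t *\<^sub>R x) powr s \<le> a m * R powr s"
      using assms s_pos by (intro mult_left_mono powr_mono2) auto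
    then show "(\<integral>\<omega>. tau (Sprod \<omega> m *v (t *\<^sub>R x)) \<partial>\<Omega>) \<le> a m * R powr s"
      using integral_tau_Sprod_le[of m "t *\<^sub>R x"] by simp
  qed
  finally show ?thesis .
qed

end

section \<open>Passage to infinitely many steps of the linear chain\<close>

context contracting_walk
begin

text \<open>The series of s-th powers has finite mean, hence converges almost surely.\<close>

lemma AE_opnorm_tendsto_0: "AE \<omega> in \<Omega>. (\<lambda>n. opnorm (Sprod \<omega> n)) \<longlonglongrightarrow> 0"
proof -
  have "(\<integral>\<^sup>+\<omega>. (\<Sum>n. ennreal (opnorm (Sprod \<omega> n) powr s)) \<partial>\<Omega>) = (\<Sum>n. ennreal (a n))"
    by (subst nn_integral_suminf) (auto simp: a_def nn_integral_eq_integral int_opnorm)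
  also have "\<dots> = ennreal (suminf a)" by (intro suminf_ennreal2 summable_a) simp
  finally have "(\<integral>\<^sup>+\<omega>. (\<Sum>n. ennreal (opnorm (Sprod \<omega> n) powr s)) \<partial>\<Omega>) \<noteq> \<infinity>" by simp
  then have "AE \<omega> in \<Omega>. (\<Sum>n. ennreal (opnorm (Sprod \<omega> n) powr s)) \<noteq> \<infinity>"
    by (intro nn_integral_noteq_infinite) auto
  then show ?thesis
  proof eventually_elim
    fix \<omega> assume "(\<Sum>n. ennreal (opnorm (Sprod \<omega> n) powr s)) \<noteq> \<infinity>"
    then have "summable (\<lambda>n. opnorm (Sprod \<omega> n) powr s)" by (intro summable_suminf_not_top) auto
    then have "(\<lambda>n. opnorm (Sprod \<omega> n) powr s) \<longlonglongrightarrow> 0" by (rule summable_LIMSEQ_zero)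
    then have "(\<lambda>n. (opnorm (Sprod \<omega> n) powr s) powr (1 / s)) \<longlonglongrightarrow> 0 powr (1 / s)"
      using s_pos by (intro tendsto_powr' tendsto_const) auto
    then show "(\<lambda>n. opnorm (Sprod \<omega> n)) \<longlonglongrightarrow> 0" using s_pos by (simp add: powr_powr)
  qed
qed

text \<open>Almost surely S_i v ends up in the ball where f vanishes, so only finitely many terms
  are nonzero.\<close>

lemma AE_sum_f_sums: "AE \<omega> in \<Omega>. summable (\<lambda>i. f (Sprod \<omega> i *v v))"
  using AE_opnorm_tendsto_0
proof eventually_elim
  fix \<omega> :: "'d aff stream" assume "(\<lambda>n. opnorm (Sprod \<omega> n)) \<longlonglongrightarrow> 0"
  then have "(\<lambda>n. opnorm (Sprod \<omega> n) * norm v) \<longlonglongrightarrow> 0 * norm v" by (intro tendsto_intros)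
  then have "\<forall>\<^sub>F n in sequentially. opnorm (Sprod \<omega> n) * norm v < \<delta>"
    by (rule order_tendstoD(2)) (simp add: \<delta>_pos)
  then have "\<forall>\<^sub>F n in sequentially. f (Sprod \<omega> n *v v) = 0"
  proof eventually_elim
    case (elim n)
    then have "norm (Sprod \<omega> n *v v) < \<delta>" using norm_mult_opnorm[of "Sprod \<omega> n" v] by simp
    then show ?case using supp_f[of "Sprod \<omega> n *v v"] by auto
  qed
  then show "summable (\<lambda>i. f (Sprod \<omega> i *v v))"
    by (simp add: summable_cong[of _ "\<lambda>_. 0"])
qed

text \<open>Since 1 - exp(-f) = (exp f - 1) exp(-f), the first factor supplies the missing term of
  index 0 in the occupation sum.\<close>

lemma \<Psi>_limit:
  "(\<lambda>m. one_minus_exp v * \<Psi> m v)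
     \<longlonglongrightarrow> (\<integral>\<omega>. (exp (f v) - 1) * exp (- (\<Sum>i. f (Sprod \<omega> i *v v))) \<partial>\<Omega>)"
proof -
  have eq: "one_minus_exp v * linear_weight m v \<omega> = (exp (f v) - 1) * exp (- (\<Sum>i<Suc m. f (Sprod \<omega> i *v v)))" for m \<omega>
  proof -
    have "exp (- (\<Sum>i<Suc m. f (Sprod \<omega> i *v v))) = exp (- f v) * linear_weight m v \<omega>"
      unfolding linear_weight_def sum.lessThan_Suc_shift by (simp add: exp_add[symmetric] del: Sprod.simps(2))
    moreover have "(exp (f v) - 1) * exp (- f v) = one_minus_exp v"
      by (simp add: algebra_simps exp_minus)
    ultimately show ?thesis by (simp only: mult.assoc[symmetric])
  qed
  have "(\<lambda>m. \<integral>\<omega>. one_minus_exp v * linear_weight m v \<omega> \<partial>\<Omega>)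
     \<longlonglongrightarrow> (\<integral>\<omega>. (exp (f v) - 1) * exp (- (\<Sum>i. f (Sprod \<omega> i *v v))) \<partial>\<Omega>)"
  proof (rule integral_dominated_convergence[where w = "\<lambda>_. norm (one_minus_exp v)"])
    show "AE \<omega> in \<Omega>. (\<lambda>m. one_minus_exp v * linear_weight m v \<omega>)
       \<longlonglongrightarrow> (exp (f v) - 1) * exp (- (\<Sum>i. f (Sprod \<omega> i *v v)))"
      using AE_sum_f_sums
    proof eventually_elim
      fix \<omega> assume "summable (\<lambda>i. f (Sprod \<omega> i *v v))"
      then have "(\<lambda>m. \<Sum>i<Suc m. f (Sprod \<omega> i *v v)) \<longlonglongrightarrow> (\<Sum>i. f (Sprod \<omega> i *v v))"
        by (intro LIMSEQ_Suc summable_LIMSEQ)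
      then show "(\<lambda>m. one_minus_exp v * linear_weight m v \<omega>)
         \<longlonglongrightarrow> (exp (f v) - 1) * exp (- (\<Sum>i. f (Sprod \<omega> i *v v)))"
        unfolding eq by (intro tendsto_intros)
    qed
    show "AE \<omega> in \<Omega>. norm (one_minus_exp v * linear_weight m v \<omega>) \<le> norm (one_minus_exp v)" for m
      using mult_left_mono[OF norm_linear_weight_le norm_ge_zero, of "one_minus_exp v"] by (auto simp: norm_mult)
  qed measurable
  then show ?thesis by (simp add: \<Psi>_def)
qed

definition annulus :: "(real^'d) set" where
  "annulus = {v. \<delta> \<le> norm v \<and> norm v \<le> R}"

lemma closed_annulus: "closed annulus"
  unfolding annulus_def by (intro closed_Collect_conj closed_Collect_le continuous_intros)

lemma compact_annulus: "compact annulus"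
  using closed_annulus by (auto simp: compact_eq_bounded_closed annulus_def bounded_iff)

lemma annulus_borel [measurable]: "annulus \<in> sets borel"
  using closed_annulus by (rule borel_closed)

lemma one_minus_exp_eq_0: "v \<notin> annulus \<Longrightarrow> one_minus_exp v = 0"
proof -
  assume "v \<notin> annulus"
  then have "f v = 0" using supp_f[of v] by (auto simp: annulus_def)
  then show ?thesis by simp
qed

lemma norm_one_minus_exp_le: "norm (one_minus_exp v) \<le> 2 * indicator annulus v"
proof (cases "v \<in> annulus")
  case True
  have "norm (one_minus_exp v) \<le> 1 + 1"
    using norm_exp_minus_le_1[OF Re_f, of v] by (intro order_trans[OF norm_triangle_ineq4] add_mono) auto
  with True show ?thesis by simp
next
  case False
  then show ?thesis using one_minus_exp_eq_0[OF False] by simp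
qed

end

section \<open>Error terms and the limit of the recursion\<close>

context stationary_walk
begin

text \<open>The rho-probability that t X_0 lies in the support region of f; it is O(1/n) at t =
  1/u_n.\<close>

definition mass :: "real \<Rightarrow> real" where "mass t = (\<integral>x. indicator annulus (t *\<^sub>R x) \<partial>\<rho>)"

lemma integrable_mass: "integrable \<rho> (\<lambda>x. indicator annulus (t *\<^sub>R x) :: real)"
  by (rule integrable_rho_bounded[of _ 1]) (auto simp: indicator_def)

lemma norm_integral_rho_le_mass:
  assumes [measurable]: "F \<in> borel_measurable borel"
    and le: "\<And>x. t *\<^sub>R x \<in> annulus \<Longrightarrow> norm (F x) \<le> K" and K: "0 \<le> K"
  shows "norm (\<integral>x. one_minus_exp (t *\<^sub>R x) * F x \<partial>\<rho>) \<le> 2 * mass t * K"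
proof -
  have "norm (\<integral>x. one_minus_exp (t *\<^sub>R x) * F x \<partial>\<rho>) \<le> (\<integral>x. 2 * indicator annulus (t *\<^sub>R x) * K \<partial>\<rho>)"
  proof (rule norm_integral_le_integral)
    fix x
    show "norm (one_minus_exp (t *\<^sub>R x) * F x) \<le> 2 * indicator annulus (t *\<^sub>R x) * K"
    proof (cases "t *\<^sub>R x \<in> annulus")
      case True
      then show ?thesis unfolding norm_mult
        using norm_one_minus_exp_le[of "t *\<^sub>R x"] by (intro mult_mono le K) auto
    next
      case False
      then show ?thesis using one_minus_exp_eq_0[OF False] by simp
    qed
  qed (auto intro!: integrable_mult_left integrable_mult_right integrable_mass
       simp: measurable_cong_sets[OF sets_rho refl])
  then show ?thesis by (simp add: mass_def)
qed

definition J :: "nat \<Rightarrow> real \<Rightarrow> complex" where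
  "J m t = (\<integral>x. one_minus_exp (t *\<^sub>R x) * \<Psi> m (t *\<^sub>R x) \<partial>\<rho>)"

lemma J_le: "norm (J m t) \<le> 2 * mass t"
  using norm_integral_rho_le_mass[of "\<lambda>x. \<Psi> m (t *\<^sub>R x)" t 1] norm_\<Psi>_le by (simp add: J_def)

lemma phi_diff_le: "norm (phi t j - phi t (Suc j)) \<le> 2 * mass t"
  unfolding phi_diff using norm_integral_rho_le_mass[of "G t j" t 1] norm_G_le by simp

text \<open>Changing the index by m costs O(m/n), which is negligible for fixed m.\<close>

lemma phi_diff_le_mult: "norm (phi t j - phi t (m + j)) \<le> real m * (2 * mass t)"
proof (induction m)
  case (Suc m)
  have "norm (phi t j - phi t (Suc m + j)) \<le> norm (phi t j - phi t (m + j)) + norm (phi t (m + j) - phi t (Suc (m + j)))"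
    using norm_triangle_ineq[of "phi t j - phi t (m + j)" "phi t (m + j) - phi t (Suc (m + j))"] by simp
  also have "\<dots> \<le> real m * (2 * mass t) + 2 * mass t" by (intro add_mono Suc phi_diff_le)
  finally show ?case by (simp add: algebra_simps)
qed simp

text \<open>Decoupling error plus linearisation error; only the term with \<open>a m\<close>
  survives t tending to 0.\<close>

definition err :: "nat \<Rightarrow> real \<Rightarrow> real" where
  "err m t = C * (a m * R powr s + zeta m t + eta t) + D * (\<Sum>i<m. zeta (Suc i) t)"

text \<open>Of the m + j steps the first m are replaced by the linear chain, giving
  \<open>J m t\<close>, and the other j factor out as \<open>phi t j\<close>. The gain
  \<open>mass t\<close> comes from integrating over the annulus only.\<close>

lemma phi_step:
  assumes "0 \<le> t"
  shows "norm (phi t (m + j) - phi t (Suc (m + j)) - phi t j * J m t) \<le> 2 * mass t * err m t"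
proof -
  have zeta0: "0 \<le> zeta i t" for i by (simp add: zeta_def)
  have eta0: "0 \<le> eta t" by (simp add: eta_def)
  have err0: "0 \<le> err m t"
    using C_nonneg D_nonneg zeta0 eta0 unfolding err_def
    by (intro add_nonneg_nonneg mult_nonneg_nonneg sum_nonneg) auto
  have bd1: "norm (one_minus_exp (t *\<^sub>R x) * G t (m + j) x) \<le> 2"
    and bd2: "norm (one_minus_exp (t *\<^sub>R x) * \<Psi> m (t *\<^sub>R x)) \<le> 2" for x
  proof -
    have "norm (one_minus_exp (t *\<^sub>R x)) \<le> 2"
      by (rule order_trans[OF norm_one_minus_exp_le]) (simp add: indicator_def)
    then have "norm (one_minus_exp (t *\<^sub>R x)) * norm (G t (m + j) x) \<le> 2 * 1"
      "norm (one_minus_exp (t *\<^sub>R x)) * norm (\<Psi> m (t *\<^sub>R x)) \<le> 2 * 1"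
      by (intro mult_mono norm_G_le norm_\<Psi>_le; simp)+
    then show "norm (one_minus_exp (t *\<^sub>R x) * G t (m + j) x) \<le> 2"
      "norm (one_minus_exp (t *\<^sub>R x) * \<Psi> m (t *\<^sub>R x)) \<le> 2" by (simp_all only: norm_mult)
  qed
  have int1: "integrable \<rho> (\<lambda>x. one_minus_exp (t *\<^sub>R x) * G t (m + j) x)"
    by (rule integrable_rho_bounded[OF _ bd1]) measurable
  have int2: "integrable \<rho> (\<lambda>x. one_minus_exp (t *\<^sub>R x) * \<Psi> m (t *\<^sub>R x))"
    by (rule integrable_rho_bounded[OF _ bd2]) measurable
  have "phi t (m + j) - phi t (Suc (m + j)) - phi t j * J m t
      = (\<integral>x. one_minus_exp (t *\<^sub>R x) * G t (m + j) x - phi t j * (one_minus_exp (t *\<^sub>R x) * \<Psi> m (t *\<^sub>R x)) \<partial>\<rho>)"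
    unfolding phi_diff J_def
    by (subst Bochner_Integration.integral_diff[OF int1 integrable_mult_right[OF int2]]) simp
  also have "\<dots> = (\<integral>x. one_minus_exp (t *\<^sub>R x) * (G t (m + j) x - phi t j * \<Psi> m (t *\<^sub>R x)) \<partial>\<rho>)"
    by (simp only: right_diff_distrib mult.left_commute)
  also have "norm \<dots> \<le> 2 * mass t * err m t"
  proof (rule norm_integral_rho_le_mass[OF _ _ err0])
    fix x assume "t *\<^sub>R x \<in> annulus"
    then have R: "norm (t *\<^sub>R x) \<le> R" by (simp add: annulus_def)
    have "G t (m + j) x - phi t j * \<Psi> m (t *\<^sub>R x)
        = (G t (m + j) x - phi t j * G t m x) + phi t j * (G t m x - \<Psi> m (t *\<^sub>R x))"
      by (simp add: algebra_simps)
    also have "norm \<dots> \<le> norm (G t (m + j) x - phi t j * G t m x) + norm (phi t j) * norm (G t m x - \<Psi> m (t *\<^sub>R x))"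
      unfolding norm_mult[symmetric] by (rule norm_triangle_ineq)
    also have "\<dots> \<le> C * (a m * R powr s + zeta m t + eta t) + 1 * (D * (\<Sum>i<m. zeta (Suc i) t))"
      by (intro add_mono mult_mono G_add_phi_le assms R norm_phi_le G_\<Psi>_le) auto
    finally show "norm (G t (m + j) x - phi t j * \<Psi> m (t *\<^sub>R x)) \<le> err m t" by (simp add: err_def)
  qed measurable
  finally show ?thesis .
qed

text \<open>A difference quotient of exp(-I z) at 0, along z = 1/n.\<close>

lemma tendsto_n_one_minus_exp: "(\<lambda>n. of_nat n * (1 - exp (- (I / of_nat n)))) \<longlonglongrightarrow> (I :: complex)"
proof -
  have "((\<lambda>z. exp (- (I * z))) has_field_derivative - I) (at 0)"
    by (auto intro!: derivative_eq_intros)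
  then have "((\<lambda>z. (exp (- (I * z)) - 1) / z) \<longlongrightarrow> - I) (at 0)" by (simp add: has_field_derivative_iff)
  moreover have "filterlim (\<lambda>n. 1 / of_nat n :: complex) (at 0) sequentially"
    by (intro filterlim_atI lim_1_over_n) (auto intro: eventually_mono[OF eventually_gt_at_top[of 0]])
  ultimately have "(\<lambda>n. (exp (- (I * (1 / of_nat n))) - 1) / (1 / of_nat n)) \<longlonglongrightarrow> - I"
    by (rule filterlim_compose)
  then have "(\<lambda>n. - ((exp (- (I * (1 / of_nat n))) - 1) / (1 / of_nat n))) \<longlonglongrightarrow> - (- I)"
    by (rule tendsto_minus)
  then show ?thesis by (simp add: algebra_simps)
qed

text \<open>The identity for phi j - phi (j+1) is, up to o(1/n), the linear recursion
  phi (j+1) = exp (-I/n) phi j.\<close>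

theorem phi_limit:
  assumes t: "\<And>n. 0 \<le> t n" "t \<longlonglongrightarrow> 0"
    and B: "\<And>n. real n * mass (t n) \<le> B"
    and J: "\<And>m. (\<lambda>n. of_nat n * J m (t n)) \<longlonglongrightarrow> II m" and I: "II \<longlonglongrightarrow> I"
  shows "(\<lambda>n. phi (t n) n) \<longlonglongrightarrow> exp (- I)"
proof -
  define d where "d n = of_nat n * (1 - exp (- (I / of_nat n)))" for n :: nat
  have d: "d \<longlonglongrightarrow> I" unfolding d_def by (rule tendsto_n_one_minus_exp)
  then have "Bseq d" by (intro convergent_imp_Bseq convergentI)
  then obtain Bd where Bd: "\<And>n. norm (d n) \<le> Bd" by (auto simp: Bseq_def)
  have B0: "0 \<le> B" using B[of 0] by simp
  have Bd0: "0 \<le> Bd" using Bd[of 0] norm_ge_zero order_trans by blast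
  \<comment> \<open>n times the one-step error: replacing n J by its limit, shifting the index by m,
    and the error of \<open>phi_step\<close>.\<close>
  define E where "E m n = norm (d n - of_nat n * J m (t n)) + real m * (2 * B) * (2 * B) / real n + 2 * B * err m (t n)" for m n
  define X where "X m n = exp (norm I) * (real m * ((2 * B + Bd) / real n) + E m n)" for m n
  have err0: "0 \<le> err m (t n)" for m n
    using C_nonneg D_nonneg unfolding err_def zeta_def eta_def
    by (intro add_nonneg_nonneg mult_nonneg_nonneg sum_nonneg) auto
  have E0: "0 \<le> E m n" for m n
    using B0 err0 unfolding E_def by (intro add_nonneg_nonneg) auto
  have main: "norm (phi (t n) n - exp (- I)) \<le> X m n" if n: "0 < n" for m n
  proof -
    define q where "q = exp (- (I / of_nat n))"
    have mass: "mass (t n) \<le> B / n" using B[of n] n by (simp add: field_simps)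
    have dq: "1 - q = d n / of_nat n" using n by (simp add: d_def q_def)
    \<comment> \<open>For the first m indices there are too few steps to decouple; m errors of order
      1/n are still negligible.\<close>
    have crude: "norm (phi (t n) (Suc j) - q * phi (t n) j) \<le> (2 * B + Bd) / n" for j
    proof -
      have "phi (t n) (Suc j) - q * phi (t n) j = (1 - q) * phi (t n) j - (phi (t n) j - phi (t n) (Suc j))"
        by (simp add: algebra_simps)
      also have "norm \<dots> \<le> norm (1 - q) * norm (phi (t n) j) + norm (phi (t n) j - phi (t n) (Suc j))"
        unfolding norm_mult[symmetric] by (rule norm_triangle_ineq4)
      also have "\<dots> \<le> Bd / n * 1 + 2 * mass (t n)"
        unfolding dq norm_divide using n Bd Bd0
        by (intro add_mono mult_mono norm_phi_le phi_diff_le) (auto intro!: divide_right_mono)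
      also have "\<dots> \<le> (2 * B + Bd) / n" using mass by (simp add: add_divide_distrib)
      finally show ?thesis .
    qed
    have fine: "norm (phi (t n) (Suc (m + j)) - q * phi (t n) (m + j)) \<le> E m n / n" for j
    proof -
      let ?p = "phi (t n)" and ?J = "J m (t n)"
      \<comment> \<open>Three replacements in succession: \<open>?J\<close> for 1 - q, the index j
        for m + j in front of \<open>?J\<close>, and the product for the true increment.\<close>
      have eq: "?p (Suc (m + j)) - q * ?p (m + j) = ?p (m + j) * ((1 - q) - ?J)
          + (?p (m + j) - ?p j) * ?J - (?p (m + j) - ?p (Suc (m + j)) - ?p j * ?J)"
        by (simp add: algebra_simps)
      have "norm (?p (Suc (m + j)) - q * ?p (m + j))
          \<le> norm (?p (m + j)) * norm ((1 - q) - ?J) + norm (?p (m + j) - ?p j) * norm ?J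
          + norm (?p (m + j) - ?p (Suc (m + j)) - ?p j * ?J)"
        unfolding eq norm_mult[symmetric]
        by (intro order_trans[OF norm_triangle_ineq4] add_right_mono norm_triangle_ineq)
      also have "\<dots> \<le> 1 * (norm (d n - of_nat n * ?J) / n) + (real m * (2 * (B / n))) * (2 * (B / n)) + 2 * (B / n) * err m (t n)"
      proof (intro add_mono mult_mono norm_phi_le)
        have "(1 - q) - ?J = (d n - of_nat n * ?J) / of_nat n"
          using n by (simp add: dq diff_divide_distrib)
        then show "norm ((1 - q) - ?J) \<le> norm (d n - of_nat n * ?J) / n" by (simp add: norm_divide)
        show "norm (?p (m + j) - ?p j) \<le> real m * (2 * (B / n))"
          using phi_diff_le_mult[of "t n" j m] mult_left_mono[OF mass, of "real m * 2"]
          by (simp add: norm_minus_commute mult.assoc)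
        show "norm ?J \<le> 2 * (B / n)" using J_le[of m "t n"] mass by simp
        show "norm (?p (m + j) - ?p (Suc (m + j)) - ?p j * ?J) \<le> 2 * (B / n) * err m (t n)"
          using phi_step[OF t(1), of n m j] mult_right_mono[OF mass err0[of m n]] by simp
      qed (use B0 in auto)
      also have "\<dots> = E m n / n" using n by (simp add: E_def field_simps)
      finally show ?thesis .
    qed
    have step: "norm (phi (t n) (Suc j) - q * phi (t n) j) \<le> (if j < m then (2 * B + Bd) / n else 0) + E m n / n" for j
    proof (cases "j < m")
      case True
      then show ?thesis using crude[of j] E0[of m n] by (simp add: add_increasing2)
    next
      case False
      then show ?thesis using fine[of "j - m"] by simp
    qed
    have nq: "norm q \<le> exp (norm I / n)"
      using divide_right_mono[of "- Re I" "norm I" "real n"] abs_Re_le_cmod[of I]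
      by (simp add: q_def norm_exp_eq_Re)
    have sum_le: "(\<Sum>j<n. (if j < m then (2 * B + Bd) / n else 0) + E m n / n) \<le> real m * ((2 * B + Bd) / n) + E m n"
    proof -
      have "(\<Sum>j<n. if j < m then (2 * B + Bd) / n else 0) = (\<Sum>j\<in>{..<n} \<inter> {j. j < m}. (2 * B + Bd) / n)"
        by (subst sum.inter_restrict) auto
      also have "\<dots> \<le> (\<Sum>j<m. (2 * B + Bd) / n)"
        using B0 Bd0 by (intro sum_mono2) auto
      finally show ?thesis using n by (simp add: sum.distrib)
    qed
    have "norm (phi (t n) n - q ^ n * phi (t n) 0)
        \<le> exp (norm I / n) ^ n * (\<Sum>j<n. (if j < m then (2 * B + Bd) / n else 0) + E m n / n)"
      by (rule discrete_gronwall[where e = "\<lambda>j. (if j < m then (2 * B + Bd) / n else 0) + E m n / n"])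
         (rule step nq | simp)+
    also have "\<dots> \<le> exp (norm I / n) ^ n * (real m * ((2 * B + Bd) / n) + E m n)"
      by (rule mult_left_mono[OF sum_le]) simp
    finally have "norm (phi (t n) n - q ^ n * phi (t n) 0)
        \<le> exp (norm I / n) ^ n * (real m * ((2 * B + Bd) / n) + E m n)" .
    moreover have "q ^ n = exp (- I)" using n by (simp add: q_def exp_of_nat_mult[symmetric])
    moreover have "exp (norm I / n) ^ n = exp (norm I)" using n by (simp add: exp_of_nat_mult[symmetric])
    ultimately show ?thesis by (simp add: X_def)
  qed
  \<comment> \<open>The limit of \<open>X m\<close> in n; what remains is the truncation of the
    linear chain and its decoupling error, both vanishing as m grows.\<close>
  define Y where "Y m = exp (norm I) * (norm (I - II m) + 2 * B * (C * (a m * R powr s)))" for m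
  have XY: "X m \<longlonglongrightarrow> Y m" for m
  proof -
    have inv_n: "(\<lambda>n. b / real n) \<longlonglongrightarrow> 0" for b
      using tendsto_mult[OF tendsto_const[of b] lim_1_over_n[where 'a = real]] by simp
    have "(\<lambda>n. err m (t n)) \<longlonglongrightarrow> C * (a m * R powr s + 0 + 0) + D * (\<Sum>i<m. 0)"
      unfolding err_def by (intro tendsto_intros zeta_limit eta_limit t)
    then have "E m \<longlonglongrightarrow> norm (I - II m) + 0 + 2 * B * (C * (a m * R powr s))"
      unfolding E_def[abs_def] by (intro tendsto_intros d J inv_n) simp
    then have "X m \<longlonglongrightarrow> exp (norm I) * (real m * 0 + (norm (I - II m) + 0 + 2 * B * (C * (a m * R powr s))))"
      unfolding X_def[abs_def] by (intro tendsto_intros inv_n)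
    then show ?thesis by (simp add: Y_def)
  qed
  have "a \<longlonglongrightarrow> 0" by (rule summable_LIMSEQ_zero[OF summable_a])
  then have "Y \<longlonglongrightarrow> exp (norm I) * (norm (I - I) + 2 * B * (C * (0 * R powr s)))"
    unfolding Y_def[abs_def] by (intro tendsto_intros I)
  then have Y0: "Y \<longlonglongrightarrow> 0" by simp
  show ?thesis
  proof (rule LIMSEQ_I)
    fix \<epsilon> :: real assume "\<epsilon> > 0"
    then obtain m where "Y m < \<epsilon>"
      using order_tendstoD(2)[OF Y0] by (auto simp: eventually_sequentially)
    then have "\<forall>\<^sub>F n in sequentially. X m n < \<epsilon>" using order_tendstoD(2)[OF XY] by blast
    then have "\<forall>\<^sub>F n in sequentially. norm (phi (t n) n - exp (- I)) < \<epsilon>"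
      using eventually_gt_at_top[of 0] by eventually_elim (rule le_less_trans[OF main])
    then show "\<exists>no. \<forall>n\<ge>no. norm (phi (t n) n - exp (- I)) < \<epsilon>" by (simp add: eventually_sequentially)
  qed
qed

end

subsection \<open>Radial measures and vague convergence\<close>

lemma nn_integral_radial_meas:
  fixes \<sigma> :: "(real^'d) measure"
  assumes sets [measurable_cong]: "sets \<sigma> = sets borel" and [measurable]: "F \<in> borel_measurable borel"
  shows "(\<integral>\<^sup>+v. F v \<partial>radial_meas \<sigma> \<kappa> \<alpha>) =
    (\<integral>\<^sup>+u. \<integral>\<^sup>+r. ennreal (indicator {0<..} r * \<kappa> * r powr (- \<alpha> - 1)) * F (r *\<^sub>R u) \<partial>lborel \<partial>\<sigma>)"
proof -
  let ?g = "\<lambda>r :: real. ennreal (indicator {0<..} r * \<kappa> * r powr (- \<alpha> - 1))"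
  let ?\<nu> = "density lborel ?g"
  \<comment> \<open>The radial measure is infinite near 0, so Fubini rests on sigma-finiteness,
    obtained from the finite density.\<close>
  interpret \<nu>: sigma_finite_measure ?\<nu>
    by (subst sigma_finite_measure.sigma_finite_iff_density_finite[OF sigma_finite_lborel]) auto
  have "(\<integral>\<^sup>+v. F v \<partial>radial_meas \<sigma> \<kappa> \<alpha>) = (\<integral>\<^sup>+z. F (snd z *\<^sub>R fst z) \<partial>(\<sigma> \<Otimes>\<^sub>M ?\<nu>))"
    unfolding radial_meas_def by (subst nn_integral_distr) (auto simp: case_prod_beta')
  also have "\<dots> = (\<integral>\<^sup>+u. \<integral>\<^sup>+r. F (r *\<^sub>R u) \<partial>?\<nu> \<partial>\<sigma>)"
    by (subst \<nu>.nn_integral_fst[symmetric]) auto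
  also have "\<dots> = (\<integral>\<^sup>+u. \<integral>\<^sup>+r. ?g r * F (r *\<^sub>R u) \<partial>lborel \<partial>\<sigma>)"
    by (intro nn_integral_cong nn_integral_density) auto
  finally show ?thesis .
qed

lemma sets_radial_meas [measurable_cong, simp]: "sets (radial_meas \<sigma> \<kappa> \<alpha>) = sets borel"
  by (simp add: radial_meas_def)

text \<open>Passes from \<Lambda> to \<Lambda>_0, with factor b = \<alpha>/c.\<close>

lemma radial_meas_scale:
  fixes \<sigma> :: "(real^'d) measure"
  assumes sets: "sets \<sigma> = sets borel" and "0 \<le> b" "0 \<le> \<kappa>"
  shows "radial_meas \<sigma> (b * \<kappa>) \<alpha> = density (radial_meas \<sigma> \<kappa> \<alpha>) (\<lambda>_. ennreal b)"
proof (rule measure_eqI)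
  fix A assume A': "A \<in> sets (radial_meas \<sigma> (b * \<kappa>) \<alpha>)"
  then have A [measurable]: "A \<in> sets borel" by simp
  note [measurable_cong] = sets
  have "emeasure (radial_meas \<sigma> (b * \<kappa>) \<alpha>) A = (\<integral>\<^sup>+v. indicator A v \<partial>radial_meas \<sigma> (b * \<kappa>) \<alpha>)"
    using A' by simp
  also have "\<dots> = (\<integral>\<^sup>+u. \<integral>\<^sup>+r. ennreal b * (ennreal (indicator {0<..} r * \<kappa> * r powr (- \<alpha> - 1)) * indicator A (r *\<^sub>R u)) \<partial>lborel \<partial>\<sigma>)"
  proof -
    have "ennreal (indicator {0<..} r * (b * \<kappa>) * r powr (- \<alpha> - 1))
        = ennreal b * ennreal (indicator {0<..} r * \<kappa> * r powr (- \<alpha> - 1))" for r :: real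
    proof -
      have "indicator {0<..} r * (b * \<kappa>) * r powr (- \<alpha> - 1) = b * (indicator {0<..} r * \<kappa> * r powr (- \<alpha> - 1))"
        by simp
      then show ?thesis using assms(2,3) by (simp only: ennreal_mult' indicator_pos_le)
    qed
    then show ?thesis
      using nn_integral_radial_meas[OF sets, of "indicator A" "b * \<kappa>" \<alpha>] by (simp only: mult.assoc) simp
  qed
  also have "\<dots> = ennreal b * (\<integral>\<^sup>+v. indicator A v \<partial>radial_meas \<sigma> \<kappa> \<alpha>)"
    using sets by (subst nn_integral_radial_meas) (simp_all add: nn_integral_cmult)
  also have "\<dots> = emeasure (density (radial_meas \<sigma> \<kappa> \<alpha>) (\<lambda>_. ennreal b)) A"
    by (subst emeasure_density) (auto simp: nn_integral_cmult)
  finally show "emeasure (radial_meas \<sigma> (b * \<kappa>) \<alpha>) A = emeasure (density (radial_meas \<sigma> \<kappa> \<alpha>) (\<lambda>_. ennreal b)) A" .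
qed simp

text \<open>For directions on the unit sphere the annulus restricts r to [\<delta>, R], where the
  radial density is bounded by its value at \<delta>.\<close>

lemma emeasure_radial_meas_annulus_finite:
  fixes \<sigma> :: "(real^'d) measure"
  assumes prob: "prob_space \<sigma>" and sets: "sets \<sigma> = sets borel" and sphere: "emeasure \<sigma> (sphere 0 1) = 1"
    and \<delta>: "0 < \<delta>" and \<kappa>: "0 \<le> \<kappa>" and \<alpha>: "0 < \<alpha>"
  shows "emeasure (radial_meas \<sigma> \<kappa> \<alpha>) {v. \<delta> \<le> norm v \<and> norm v \<le> R} < \<infinity>"
proof -
  interpret \<sigma>: prob_space \<sigma> by (rule prob)
  let ?A = "{v :: real^'d. \<delta> \<le> norm v \<and> norm v \<le> R}"
  let ?B = "ennreal (\<kappa> * \<delta> powr (- \<alpha> - 1)) * emeasure lborel {\<delta>..R}"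
  have [measurable]: "?A \<in> sets borel" by measurable
  have "emeasure (radial_meas \<sigma> \<kappa> \<alpha>) ?A = (\<integral>\<^sup>+v. indicator ?A v \<partial>radial_meas \<sigma> \<kappa> \<alpha>)"
    by (subst nn_integral_indicator) auto
  also have "\<dots> = (\<integral>\<^sup>+u. \<integral>\<^sup>+r. ennreal (indicator {0<..} r * \<kappa> * r powr (- \<alpha> - 1)) * indicator ?A (r *\<^sub>R u) \<partial>lborel \<partial>\<sigma>)"
    by (rule nn_integral_radial_meas[OF sets]) simp
  also have "\<dots> \<le> (\<integral>\<^sup>+u. ?B \<partial>\<sigma>)"
  proof (rule nn_integral_mono_AE)
    have "\<sigma>.prob (sphere 0 1) = 1" using sphere by (simp add: measure_def)
    then have "AE u in \<sigma>. u \<in> sphere 0 1"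
      using sets by (subst (asm) \<sigma>.prob_eq_1) auto
    then show "AE u in \<sigma>. (\<integral>\<^sup>+r. ennreal (indicator {0<..} r * \<kappa> * r powr (- \<alpha> - 1)) * indicator ?A (r *\<^sub>R u) \<partial>lborel) \<le> ?B"
    proof eventually_elim
      fix u :: "real^'d" assume u: "u \<in> sphere 0 1"
      have "(\<integral>\<^sup>+r. ennreal (indicator {0<..} r * \<kappa> * r powr (- \<alpha> - 1)) * indicator ?A (r *\<^sub>R u) \<partial>lborel)
         \<le> (\<integral>\<^sup>+r. ennreal (\<kappa> * \<delta> powr (- \<alpha> - 1)) * indicator {\<delta>..R} r \<partial>lborel)"
      proof (rule nn_integral_mono)
        fix r :: real
        show "ennreal (indicator {0<..} r * \<kappa> * r powr (- \<alpha> - 1)) * indicator ?A (r *\<^sub>R u)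
          \<le> ennreal (\<kappa> * \<delta> powr (- \<alpha> - 1)) * indicator {\<delta>..R} r"
        proof (cases "0 < r \<and> \<delta> \<le> r \<and> r \<le> R")
          case True
          then have "r powr (- \<alpha> - 1) \<le> \<delta> powr (- \<alpha> - 1)" using \<delta> \<alpha> by (intro powr_mono2') auto
          then show ?thesis using True u \<kappa> by (auto intro!: ennreal_leI mult_left_mono)
        next
          case False
          then show ?thesis using u by (auto simp: indicator_def)
        qed
      qed
      also have "\<dots> = ?B" by (subst nn_integral_cmult) auto
      finally show "(\<integral>\<^sup>+r. ennreal (indicator {0<..} r * \<kappa> * r powr (- \<alpha> - 1)) * indicator ?A (r *\<^sub>R u) \<partial>lborel) \<le> ?B" .
    qed
  qed
  also have "\<dots> = ?B" by (simp add: \<sigma>.emeasure_space_1)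
  also have "\<dots> < \<infinity>" by (simp add: ennreal_mult_less_top emeasure_lborel_Icc_eq)
  finally show ?thesis .
qed

text \<open>The complement of the origin does not contain all segments, so pairs involving 0 need
  their own argument.\<close>

lemma lipschitz_extend_0:
  fixes f :: "real^'d \<Rightarrow> complex"
  assumes lip: "lipschitz_on L (- {0}) f" and \<delta>: "0 < \<delta>" and z: "\<And>x. norm x < \<delta> \<Longrightarrow> f x = 0"
  shows "norm (f x - f y) \<le> L * norm (x - y)"
proof -
  have L: "0 \<le> L" using lip by (simp add: lipschitz_on_def)
  have f0: "f 0 = 0" using z[of 0] \<delta> by simp
  have nz: "norm (f x - f y) \<le> L * norm (x - y)" if "x \<noteq> 0" "y \<noteq> 0" for x y
    using lipschitz_onD[OF lip, of x y] that by (simp add: dist_norm)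
  have one: "norm (f x) \<le> L * norm x" if "x \<noteq> 0" for x
  proof (cases "norm x < \<delta>")
    case True
    then show ?thesis using z L by simp
  next
    case False
    \<comment> \<open>Shrinks x along its ray to norm \<delta>/2: nonzero, yet inside the zero set
      of f.\<close>
    define c where "c = \<delta> / (2 * norm x)"
    have c: "0 < c" "c < 1" using that \<delta> False by (auto simp: c_def field_simps)
    have "norm (c *\<^sub>R x) < \<delta>" using that \<delta> by (simp add: c_def)
    then have "norm (f x) = norm (f x - f (c *\<^sub>R x))" using z by simp
    also have "\<dots> \<le> L * norm (x - c *\<^sub>R x)" using that c by (intro nz) auto
    also have "x - c *\<^sub>R x = (1 - c) *\<^sub>R x" by (simp add: algebra_simps)
    also have "L * norm ((1 - c) *\<^sub>R x) \<le> L * norm x"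
      using c L by (intro mult_left_mono) (auto simp: mult_left_le_one_le)
    finally show ?thesis .
  qed
  show ?thesis
    using nz[of x y] one[of x] one[of y] f0 by (cases "x = 0"; cases "y = 0") auto
qed

text \<open>The limit is given as an exponential, which involves no branch of the complex logarithm.
  The known consequences of (c-e) used here, invariance of rho and vague convergence, are
  hypotheses; the support condition fixes f 0 = 0.\<close>

theorem theorem5p1:
  fixes lam :: "('d::finite) aff measure"
    and \<alpha> c :: real
    and \<rho> \<sigma> :: "(real^'d) measure"
    and f :: "real^'d \<Rightarrow> complex"
  assumes lam_prob: "prob_space lam" and lam_sets: "sets lam = sets borel"
    and lam_H: "AE h in lam. invertible (fst h)"
    and ce: "cond_ce lam \<alpha>"
    and rho_prob: "prob_space \<rho>" and rho_sets: "sets \<rho> = sets borel"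
    and rho_inv: "distr (\<rho> \<Otimes>\<^sub>M lam) borel (\<lambda>(x, h). fst h *v x + snd h) = \<rho>"
    and c_pos: "c > 0"
    and sigma_prob: "prob_space \<sigma>" and sigma_sets: "sets \<sigma> = sets borel"
    and sigma_sphere: "emeasure \<sigma> (sphere 0 1) = 1"
    and vague: "\<And>\<phi> :: real^'d \<Rightarrow> real. continuous_on UNIV \<phi> \<Longrightarrow>
                  (\<exists>K. compact K \<and> 0 \<notin> K \<and> (\<forall>x. \<phi> x \<noteq> 0 \<longrightarrow> x \<in> K)) \<Longrightarrow>
                  ((\<lambda>t. t powr (- \<alpha>) * (\<integral>v. \<phi> (t *\<^sub>R v) \<partial>\<rho>))
                     \<longlongrightarrow> (\<integral>v. \<phi> v \<partial>(radial_meas \<sigma> c \<alpha>))) (at_right 0)"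
    and f_lip: "\<exists>L. lipschitz_on L (- {0}) f"
    and f_supp: "\<exists>K. compact K \<and> 0 \<notin> K \<and> {x. f x \<noteq> 0} \<subseteq> K"
    and f_re: "\<And>x. Re (f x) \<ge> 0"
  shows "(\<lambda>n. \<integral>x. \<integral>\<omega>. exp (- (\<Sum>i=1..n. f (inverse ((c * real n / \<alpha>) powr (1 / \<alpha>)) *\<^sub>R chain x \<omega> i)))
                 \<partial>(stream_space lam) \<partial>\<rho>)
         \<longlonglongrightarrow> exp (- (\<integral>v. \<integral>\<omega>. (exp (f v) - 1) * exp (- (\<Sum>i. f (Sprod \<omega> i *v v)))
                         \<partial>(stream_space lam) \<partial>(radial_meas \<sigma> \<alpha> \<alpha>)))"
proof -
  interpret lam: prob_space lam by (rule lam_prob)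
  interpret affine_walk lam by unfold_locales (rule lam_sets)
  have \<alpha>: "0 < \<alpha>" using ce by (simp add: cond_ce_def)
  obtain s where s: "0 < s" "s \<le> 1" "\<And>n. integrable \<Omega> (\<lambda>\<omega>. opnorm (Sprod \<omega> n) powr s)"
    "summable (\<lambda>n. \<integral>\<omega>. opnorm (Sprod \<omega> n) powr s \<partial>\<Omega>)"
    by (rule contraction_in_mean[OF lam_H ce]) (rule that)
  obtain K where K: "compact K" "0 \<notin> K" "{x. f x \<noteq> 0} \<subseteq> K" using f_supp by blast
  have "open (- K)" using K(1) by (simp add: compact_imp_closed open_Compl)
  then obtain \<delta> where \<delta>: "0 < \<delta>" "ball 0 \<delta> \<subseteq> - K" using K(2) open_contains_ball[of "- K"] by auto
  obtain R where R: "\<And>x. x \<in> K \<Longrightarrow> norm x \<le> R"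
    using compact_imp_bounded[OF K(1)] by (auto simp: bounded_iff)
  have supp: "\<delta> \<le> norm x \<and> norm x \<le> R" if "f x \<noteq> 0" for x
  proof -
    have "x \<in> K" using K(3) that by blast
    then show ?thesis using \<delta>(2) R by (auto simp: not_less[symmetric])
  qed
  obtain L where L: "lipschitz_on L (- {0}) f" using f_lip by blast
  have zero: "f x = 0" if "norm x < \<delta>" for x using supp[of x] that by auto
  interpret rho: prob_space \<rho> by (rule rho_prob)
  interpret stationary_walk lam s L \<delta> R f \<rho>
    by unfold_locales
       (use s f_re \<delta>(1) supp rho_sets rho_inv lipschitz_extend_0[OF L \<delta>(1) zero] in auto)
  let ?\<Lambda> = "radial_meas \<sigma> \<alpha> \<alpha>"
  define t where "t n = inverse ((c * real n / \<alpha>) powr (1 / \<alpha>))" for n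
  have t0: "0 \<le> t n" for n by (simp add: t_def)
  have tpos: "0 < t n" if "0 < n" for n using that c_pos \<alpha> by (simp add: t_def)
  \<comment> \<open>At n = 0 both sides are 0, since \<open>inverse 0\<close> and powers of 0 are
    0.\<close>
  have tpowr: "t n powr (- \<alpha>) = c * real n / \<alpha>" for n
    using \<alpha> c_pos by (cases "n = 0") (simp_all add: t_def powr_minus[symmetric] powr_powr)
  have tlim: "t \<longlonglongrightarrow> 0"
  proof -
    have "filterlim (\<lambda>n. real n * (c / \<alpha>)) at_top sequentially"
      using c_pos \<alpha> by (intro filterlim_at_top_mult_tendsto_pos[OF tendsto_const] filterlim_real_sequentially) auto
    then have "filterlim (\<lambda>n. c * real n / \<alpha>) at_top sequentially" by (simp add: mult.commute)
    then have "((\<lambda>n. (c * real n / \<alpha>) powr (- (1 / \<alpha>))) \<longlongrightarrow> 0) sequentially"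
      using \<alpha> by (intro tendsto_neg_powr) auto
    then show ?thesis by (simp add: t_def[abs_def] powr_minus)
  qed
  have tright: "filterlim t (at_right 0) sequentially"
  proof -
    have "\<forall>\<^sub>F n in sequentially. 0 < t n" by (rule eventually_mono[OF eventually_gt_at_top[of 0] tpos])
    then show ?thesis using tlim by (auto simp: filterlim_at elim: eventually_mono)
  qed
  have \<Lambda>_eq: "?\<Lambda> = density (radial_meas \<sigma> c \<alpha>) (\<lambda>_. ennreal (\<alpha> / c))"
    using radial_meas_scale[OF sigma_sets, of "\<alpha> / c" c \<alpha>] \<alpha> c_pos by simp
  \<comment> \<open>As t^(-\<alpha>) = c n / \<alpha>, the factor \<alpha>/c leaves exactly n on one
    side and turns \<Lambda> into \<Lambda>_0 on the other.\<close>
  have vague_seq: "(\<lambda>n. real n * (\<integral>v. \<phi> (t n *\<^sub>R v) \<partial>\<rho>)) \<longlonglongrightarrow> (\<integral>v. \<phi> v \<partial>?\<Lambda>)"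
    if cont: "continuous_on UNIV \<phi>" and \<phi>: "compact K'" "0 \<notin> K'" "\<And>x. \<phi> x \<noteq> 0 \<Longrightarrow> x \<in> K'"
    for \<phi> :: "real^'d \<Rightarrow> real" and K'
  proof -
    have [measurable]: "\<phi> \<in> borel_measurable borel" using cont by (rule borel_measurable_continuous_onI)
    have "(\<lambda>n. t n powr (- \<alpha>) * (\<integral>v. \<phi> (t n *\<^sub>R v) \<partial>\<rho>)) \<longlonglongrightarrow> (\<integral>v. \<phi> v \<partial>(radial_meas \<sigma> c \<alpha>))"
      by (rule filterlim_compose[OF vague[OF cont] tright]) (use \<phi> in blast)
    then have "(\<lambda>n. (\<alpha> / c) * (t n powr (- \<alpha>) * (\<integral>v. \<phi> (t n *\<^sub>R v) \<partial>\<rho>))) \<longlonglongrightarrow> (\<alpha> / c) * (\<integral>v. \<phi> v \<partial>(radial_meas \<sigma> c \<alpha>))"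
      by (intro tendsto_intros)
    moreover have "(\<integral>v. \<phi> v \<partial>?\<Lambda>) = (\<alpha> / c) * (\<integral>v. \<phi> v \<partial>(radial_meas \<sigma> c \<alpha>))"
      unfolding \<Lambda>_eq using \<alpha> c_pos by (subst integral_density) auto
    ultimately show ?thesis using \<alpha> c_pos by (simp add: tpowr)
  qed
  have zero_notin: "0 \<notin> annulus" using \<delta>(1) by (simp add: annulus_def)
  have fin: "emeasure ?\<Lambda> annulus < \<infinity>"
    unfolding annulus_def
    by (rule emeasure_radial_meas_annulus_finite[OF sigma_prob sigma_sets sigma_sphere \<delta>(1) _ \<alpha>]) (use \<alpha> in simp)
  have int_ind: "integrable ?\<Lambda> (\<lambda>v. 2 * indicator annulus v :: real)"
    using fin by (intro integrable_mult_right integrable_real_indicator) auto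
  have bound: "norm (one_minus_exp v * \<Psi> m v) \<le> 2 * indicator annulus v" for m v
    using mult_mono[OF norm_one_minus_exp_le[of v] norm_\<Psi>_le[of m v]] by (simp add: norm_mult)
  have cont_g: "continuous_on UNIV (\<lambda>v. one_minus_exp v * \<Psi> m v)" for m
    by (intro continuous_intros cont_f cont_\<Psi>)
  have meas_g [measurable]: "(\<lambda>v. one_minus_exp v * \<Psi> m v) \<in> borel_measurable borel" for m
    using cont_g by (rule borel_measurable_continuous_onI)
  have int_g: "integrable ?\<Lambda> (\<lambda>v. one_minus_exp v * \<Psi> m v)" for m
    by (rule Bochner_Integration.integrable_bound[OF int_ind]) (simp, intro AE_I2 order_trans[OF bound], simp)
  define II where "II m = (\<integral>v. one_minus_exp v * \<Psi> m v \<partial>?\<Lambda>)" for m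
  define I where "I = (\<integral>v. \<integral>\<omega>. (exp (f v) - 1) * exp (- (\<Sum>i. f (Sprod \<omega> i *v v))) \<partial>\<Omega> \<partial>?\<Lambda>)"
  have "II \<longlonglongrightarrow> I"
    unfolding II_def I_def
  proof (rule integral_dominated_convergence[OF _ _ int_ind])
    show "(\<lambda>v. \<integral>\<omega>. (exp (f v) - 1) * exp (- (\<Sum>i. f (Sprod \<omega> i *v v))) \<partial>\<Omega>) \<in> borel_measurable ?\<Lambda>"
      by (rule borel_measurable_LIMSEQ_metric[OF _ \<Psi>_limit]) simp
  qed (use \<Psi>_limit bound in auto)
  moreover have "(\<lambda>n. of_nat n * J m (t n)) \<longlonglongrightarrow> II m" for m
  proof -
    let ?g = "\<lambda>v. one_minus_exp v * \<Psi> m v"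
    have int_rho: "integrable \<rho> (\<lambda>x. ?g (t n *\<^sub>R x))" for n
      by (rule integrable_rho_bounded[of _ 2]) (measurable, rule order_trans[OF bound], simp add: indicator_def)
    have g0: "?g v = 0" if "v \<notin> annulus" for v using one_minus_exp_eq_0[OF that] by (simp only: mult_zero_left)
    \<comment> \<open>Test functions are real, so the two parts are treated separately; continuity
      comes from the fixed m, compact support from the annulus.\<close>
    have Re_lim: "(\<lambda>n. real n * (\<integral>v. Re (?g (t n *\<^sub>R v)) \<partial>\<rho>)) \<longlonglongrightarrow> (\<integral>v. Re (?g v) \<partial>?\<Lambda>)"
      by (rule vague_seq[OF continuous_on_Re[OF cont_g] compact_annulus zero_notin]) (metis g0 zero_complex.sel(1))
    have Im_lim: "(\<lambda>n. real n * (\<integral>v. Im (?g (t n *\<^sub>R v)) \<partial>\<rho>)) \<longlonglongrightarrow> (\<integral>v. Im (?g v) \<partial>?\<Lambda>)"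
      by (rule vague_seq[OF continuous_on_Im[OF cont_g] compact_annulus zero_notin]) (metis g0 zero_complex.sel(2))
    show ?thesis
      unfolding tendsto_complex_iff II_def J_def
      using Re_lim[unfolded integral_Re[OF int_rho] integral_Re[OF int_g]]
        Im_lim[unfolded integral_Im[OF int_rho] integral_Im[OF int_g]] by simp
  qed
  moreover have "\<exists>B. \<forall>n. real n * mass (t n) \<le> B"
  proof -
    \<comment> \<open>A continuous majorant of the indicator of the annulus: the two ramps reach 1
      at norms \<delta> and R and vanish at \<delta>/2 and R + 1.\<close>
    define \<phi> :: "real^'d \<Rightarrow> real" where "\<phi> x = max 0 (min 1 (min (2 * norm x / \<delta> - 1) (R + 1 - norm x)))" for x
    have cont: "continuous_on UNIV \<phi>" unfolding \<phi>_def by (intro continuous_intros) (use \<delta> in auto)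
    have [measurable]: "\<phi> \<in> borel_measurable borel" using cont by (rule borel_measurable_continuous_onI)
    have \<phi>01: "0 \<le> \<phi> x" "\<phi> x \<le> 1" for x by (auto simp: \<phi>_def)
    have ge: "indicator annulus x \<le> \<phi> x" for x
      using \<delta>(1) by (auto simp: indicator_def annulus_def \<phi>_def field_simps)
    let ?K = "cball 0 (R + 1) - ball 0 (\<delta> / 2) :: (real^'d) set"
    have "(\<lambda>n. real n * (\<integral>v. \<phi> (t n *\<^sub>R v) \<partial>\<rho>)) \<longlonglongrightarrow> (\<integral>v. \<phi> v \<partial>?\<Lambda>)"
    proof (rule vague_seq[OF cont, of ?K])
      show "compact ?K" by (intro compact_diff) auto
      show "0 \<notin> ?K" using \<delta>(1) by simp
      show "x \<in> ?K" if "\<phi> x \<noteq> 0" for x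
      proof -
        have "0 < p \<and> 0 < q" if "max 0 (min 1 (min p q)) \<noteq> 0" for p q :: real
          using that by (auto simp: max_def min_def split: if_splits)
        then have "0 < 2 * norm x / \<delta> - 1 \<and> 0 < R + 1 - norm x"
          using \<open>\<phi> x \<noteq> 0\<close> unfolding \<phi>_def by blast
        then show ?thesis using \<delta>(1) by (auto simp: field_simps)
      qed
    qed
    then have "Bseq (\<lambda>n. real n * (\<integral>v. \<phi> (t n *\<^sub>R v) \<partial>\<rho>))" by (intro convergent_imp_Bseq convergentI)
    then obtain B where B: "\<And>n. norm (real n * (\<integral>v. \<phi> (t n *\<^sub>R v) \<partial>\<rho>)) \<le> B" by (auto simp: Bseq_def)
    have "real n * mass (t n) \<le> B" for n
    proof -
      have "mass (t n) \<le> (\<integral>v. \<phi> (t n *\<^sub>R v) \<partial>\<rho>)"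
        unfolding mass_def using \<phi>01 ge
        by (intro integral_mono integrable_mass integrable_rho_bounded[of _ 1]) auto
      then have "real n * mass (t n) \<le> real n * (\<integral>v. \<phi> (t n *\<^sub>R v) \<partial>\<rho>)" by (rule mult_left_mono) simp
      also have "\<dots> \<le> B" using B[of n] by simp
      finally show ?thesis .
    qed
    then show ?thesis by blast
  qed
  ultimately have "(\<lambda>n. phi (t n) n) \<longlonglongrightarrow> exp (- I)"
    using phi_limit[OF t0 tlim] by blast
  moreover have "phi (t n) n = (\<integral>x. \<integral>\<omega>. exp (- (\<Sum>i=1..n. f (t n *\<^sub>R chain x \<omega> i))) \<partial>\<Omega> \<partial>\<rho>)" for n
    by (simp add: phi_def G_def weight_def sum.atLeast1_atMost_eq del: chain.simps)
  ultimately show ?thesis by (simp add: t_def I_def)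
qed

end
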